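(* Let $m\ge1$ be an integer and let $n=n_N$, $s=s_N$ (positive integers with $N=sn$) and $\lambda=\lambda_N>0$ depend on $N$, with $h=\lambda^{1/(2m)}$. Suppose that $h\to0$ and $n\to\infty$ as $N\to\infty$, and that $\lim_{N\to\infty}nh$ exists (it may be infinite). Then under $H_0: f=0$, $$\frac{T_{N,\lambda}-\mu_{N,\lambda}}{\sigma_{N,\lambda}}\ \xrightarrow{d}\ N(0,1)\quad\text{as }N\to\infty.$$
   Context: Let $\mathbb{I}=[0,1]$ and let $m\ge1$ be an integer. For $k=1,2,\ldots$ put $\varphi_{2k-1}(t)=\sqrt2\cos(2\pi kt)$, $\varphi_{2k}(t)=\sqrt2\sin(2\pi kt)$, $\gamma_{2k-1}=\gamma_{2k}=(2\pi k)^{2m}$. The periodic Sobolev space is $$S^m(\mathbb{I})=\left\{\sum_{\nu=1}^\infty f_\nu\varphi_\nu(\cdot):\ f_\nu\in\mathbb{R},\ \sum_{\nu=1}^\infty f_\nu^2\gamma_\nu<\infty\right\}.$$ For $f,g\in S^m(\mathbb{I})$, $J(f,g)=\int_{\mathbb{I}} f^{(m)}(t)g^{(m)}(t)\,dt$ and $J(f)=J(f,f)$ (so $J(\sum_\nu f_\nu\varphi_\nu)=\sum_\nu f_\nu^2\gamma_\nu$). Also $\|f\|_2=\sqrt{\int_{\mathbb{I}}f(t)^2dt}$. Model: $y_l=f(l/N)+\epsilon_l$, $l=0,1,\ldots,N-1$, where $f\in S^m(\mathbb{I})$ and the $\epsilon_l$ are i.i.d. standard normal. Distributed estimator: with $N=s\times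 n$, for $j=1,\ldots,s$ the $j$th machine receives $(Y_{i,j},t_{i,j})$, $i=1,\ldots,n$, where $Y_{i,j}=y_{is-s+j-1}$ and $t_{i,j}=(is-s+j-1)/N$. For a smoothing parameter $\lambda>0$, the $j$th sub-estimate is $$\widehat f_j=\arg\min_{g\in S^m(\mathbb{I})}\ \frac1{2n}\sum_{i=1}^n\bigl(Y_{i,j}-g(t_{i,j})\bigr)^2+\frac{\lambda}{2}J(g),$$ and the averaged estimator is $\bar f=\frac1s\sum_{j=1}^s\widehat f_j$. Throughout $h=\lambda^{1/(2m)}$. Test statistic for $H_0:f=0$ versus $H_1:f\in S^m(\mathbb{I})\setminus\{0\}$: $T_{N,\lambda}=\|\bar f\|_2^2$, with $\mu_{N,\lambda}=E_{H_0}\{T_{N,\lambda}\}$ and $\sigma_{N,\lambda}^2=\mathrm{Var}_{H_0}\{T_{N,\lambda}\}$, $\sigma_{N,\lambda}>0$ (mean and variance computed when $f=0$). $\xrightarrow{d}$ denotes convergence in distribution. *)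

theory Defs
  imports "HOL-Probability.Probability"
begin

text \<open>The basis functions and eigenvalues are indexed by \<open>\<nu> \<ge> 1\<close>; the frequency of index
  \<open>\<nu>\<close> is \<open>(\<nu> + 1) div 2\<close>, i.e. \<open>k\<close> for both \<open>\<nu> = 2 * k - 1\<close> and \<open>\<nu> = 2 * k\<close>.\<close>

definition trig_basis :: "nat \<Rightarrow> real \<Rightarrow> real" where
  "trig_basis \<nu> t =
     (if odd \<nu> then sqrt 2 * cos (2 * pi * real ((\<nu> + 1) div 2) * t)
      else sqrt 2 * sin (2 * pi * real ((\<nu> + 1) div 2) * t))"

definition trig_eigenvalue :: "nat \<Rightarrow> nat \<Rightarrow> real" where
  "trig_eigenvalue m \<nu> = (2 * pi * real ((\<nu> + 1) div 2)) ^ (2 * m)"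

lemma trig_basis_odd: "k \<ge> 1 \<Longrightarrow> trig_basis (2 * k - 1) t = sqrt 2 * cos (2 * pi * real k * t)"
  by (simp add: trig_basis_def)

lemma trig_basis_even: "trig_basis (2 * k) t = sqrt 2 * sin (2 * pi * real k * t)"
  by (simp add: trig_basis_def)

lemma trig_eigenvalue_odd: "k \<ge> 1 \<Longrightarrow> trig_eigenvalue m (2 * k - 1) = (2 * pi * real k) ^ (2 * m)"
  by (simp add: trig_eigenvalue_def)

lemma trig_eigenvalue_even: "trig_eigenvalue m (2 * k) = (2 * pi * real k) ^ (2 * m)"
  by (simp add: trig_eigenvalue_def)

text \<open>Functions on the unit interval are represented as functions on the reals that are
  \<^term>\<open>undefined\<close> outside it, so that two elements of the space agreeing on the interval are
  equal. For \<open>m \<ge> 1\<close> the weighted summability of the squared coefficients makes the series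
  converge absolutely and uniformly.\<close>

definition periodic_sobolev :: "nat \<Rightarrow> (real \<Rightarrow> real) set" where
  "periodic_sobolev m =
     {f \<in> extensional {0..1}. \<exists>c :: nat \<Rightarrow> real.
        summable (\<lambda>\<nu>. (c (Suc \<nu>))\<^sup>2 * trig_eigenvalue m (Suc \<nu>)) \<and>
        (\<forall>t\<in>{0..1}. (\<lambda>\<nu>. c (Suc \<nu>) * trig_basis (Suc \<nu>) t) sums f t)}"

text \<open>\<open>f\<close> is absolutely continuous on the unit interval and \<open>g\<close> is (a version of) its almost
  everywhere derivative there.\<close>

definition ac_derivative :: "(real \<Rightarrow> real) \<Rightarrow> (real \<Rightarrow> real) \<Rightarrow> bool" where
  "ac_derivative f g \<longleftrightarrow>
     set_integrable lborel {0..1} g \<and>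
     (\<forall>t\<in>{0..1}. f t = f 0 + (LBINT u:{0..t}. g u))"

text \<open>The \<open>m\<close>-th derivative of an element of the Sobolev space exists in general only almost
  everywhere; the chosen version is irrelevant, since for \<open>m \<ge> 1\<close> it is unique up to null
  sets of the unit interval.\<close>

definition sobolev_deriv :: "nat \<Rightarrow> (real \<Rightarrow> real) \<Rightarrow> real \<Rightarrow> real" where
  "sobolev_deriv m f = (SOME g. (ac_derivative ^^ m) f g)"

definition roughness :: "nat \<Rightarrow> (real \<Rightarrow> real) \<Rightarrow> (real \<Rightarrow> real) \<Rightarrow> real" where
  "roughness m f g = (LBINT t:{0..1}. sobolev_deriv m f t * sobolev_deriv m g t)"

definition L2_unit_norm :: "(real \<Rightarrow> real) \<Rightarrow> real" where
  "L2_unit_norm f = sqrt (LBINT t:{0..1}. (f t)\<^sup>2)"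

definition observation :: "nat \<Rightarrow> (real \<Rightarrow> real) \<Rightarrow> (nat \<Rightarrow> real) \<Rightarrow> nat \<Rightarrow> real" where
  "observation N f e l = f (real l / real N) + e l"

text \<open>Position in the full sample of the \<open>i\<close>-th observation of machine \<open>j\<close>, for
  \<open>i, j \<ge> 1\<close> (so the natural number subtractions do not truncate).\<close>

definition sample_index :: "nat \<Rightarrow> nat \<Rightarrow> nat \<Rightarrow> nat" where
  "sample_index s i j = i * s - s + j - 1"

definition sub_objective ::
  "nat \<Rightarrow> real \<Rightarrow> nat \<Rightarrow> nat \<Rightarrow> (nat \<Rightarrow> real) \<Rightarrow> nat \<Rightarrow> (real \<Rightarrow> real) \<Rightarrow> real" where
  "sub_objective m lam n s y j g =
     1 / (2 * real n) *
       (\<Sum>i=1..n. (y (sample_index s i j) - g (real (sample_index s i j) / real (s * n)))\<^sup>2)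
     + lam / 2 * roughness m g g"

definition sub_estimate ::
  "nat \<Rightarrow> real \<Rightarrow> nat \<Rightarrow> nat \<Rightarrow> (nat \<Rightarrow> real) \<Rightarrow> nat \<Rightarrow> real \<Rightarrow> real" where
  "sub_estimate m lam n s y j = arg_min_on (sub_objective m lam n s y j) (periodic_sobolev m)"

definition avg_estimate ::
  "nat \<Rightarrow> real \<Rightarrow> nat \<Rightarrow> nat \<Rightarrow> (nat \<Rightarrow> real) \<Rightarrow> real \<Rightarrow> real" where
  "avg_estimate m lam n s y t = 1 / real s * (\<Sum>j=1..s. sub_estimate m lam n s y j t)"

definition test_stat :: "nat \<Rightarrow> real \<Rightarrow> nat \<Rightarrow> nat \<Rightarrow> (nat \<Rightarrow> real) \<Rightarrow> real" where
  "test_stat m lam n s y = (L2_unit_norm (avg_estimate m lam n s y))\<^sup>2"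

end

theory Submission imports Defs begin

text \<open>Write \<open>\<rho>\<^sub>k = (2 \<pi> k)\<^bsup>2m\<^esup>\<close>. Each machine observes \<open>n\<close> equally spaced points, so on its sample waves
of the frequencies \<open>k\<close> and \<open>q\<close> are confounded exactly when \<open>k \<equiv> \<plusminus>q (mod n)\<close>. The normal equations of the
penalised least squares problem therefore decouple over these aliasing classes and can be solved in
closed form: the fit multiplies the sample Fourier coefficient at frequency \<open>k\<close> by
\<open>w\<^sub>k = 1 / (\<rho>\<^sub>k (\<lambda> + S\<^sub>k))\<close>, where \<open>S\<^sub>k\<close> is the sum of \<open>1 / \<rho>\<^sub>l\<close> over the frequencies \<open>l\<close> aliased with \<open>k\<close>
(\<open>sub_estimate_eq_ridge_fit\<close>). Averaging over the machines replaces the coefficient of one machine by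
that of the full sample. By Parseval, and after folding the frequencies modulo \<open>N\<close>,
\<open>T = (1 / N) (\<Sum>q<N. W\<^sub>q X\<^sub>q\<^sup>2)\<close>. Here \<open>W\<^sub>q\<close> is the sum of \<open>w\<^sub>k\<^sup>2\<close> over the \<open>k \<ge> 1\<close> with \<open>k \<equiv> \<plusminus>q (mod N)\<close>, counted
once for each sign, and the \<open>X\<^sub>q\<close> are the coordinates of the data in the orthonormal Hartley basis
\<open>(cos + sin)(2 \<pi> q l / N) / sqrt N\<close> (\<open>test_stat_quadratic_form\<close>).

Under the null hypothesis the \<open>X\<^sub>q\<close> behave like independent standard normal variables, so the
normalised statistic is \<open>\<Sum> b\<^sub>q (X\<^sub>q\<^sup>2 - 1)\<close> with \<open>b\<^sub>q = W\<^sub>q / sqrt (2 \<Sum> W\<^sup>2)\<close>, and it is asymptotically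
normal as soon as \<open>max b\<^sub>q \<longlongrightarrow> 0\<close>. The weights are bounded, \<open>W\<^sub>q \<le> 1\<close>, because the
factors \<open>w\<^sub>k\<close> of an aliasing class modulo \<open>n\<close> add up to \<open>S / (\<lambda> + S)\<close> (\<open>spectral_weight_le_1\<close>). On the other hand \<open>W\<^sub>q\<close> stays above a positive constant for all
\<open>1 \<le> q \<le> min (n / 2) (1 / (2 \<pi> h))\<close>, because for such \<open>q\<close> the penalty \<open>\<lambda> \<rho>\<^sub>q\<close> is at most one and the
aliases of \<open>q\<close> contribute to \<open>S\<^sub>q\<close> no more than a constant times \<open>1 / \<rho>\<^sub>q\<close> (\<open>folded_sum_le\<close>). Since
\<open>n \<longlongrightarrow> \<infinity>\<close> and \<open>h \<longlongrightarrow> 0\<close>, the number of these \<open>q\<close> is unbounded, hence \<open>\<Sum> W\<^sup>2 \<longlongrightarrow> \<infinity>\<close> and \<open>max b\<^sub>q \<longlongrightarrow> 0\<close>.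

Two ingredients carry the analysis. The roughness is defined through some \<open>m\<close>-th almost everywhere
derivative; the Riesz-Fischer theorem on the unit interval produces one with the expected Fourier
coefficients, and iterated absolutely continuous derivatives are unique up to null sets, so the
roughness is the weighted sum of squared coefficients (\<open>roughness_sobolev_series\<close>). The passage from
the noise to its Hartley coordinates rests on a Gaussian linearisation of the squares: for small \<open>c\<^sub>q\<close>,
Fubini's theorem gives
\<open>E exp (\<Sum> c\<^sub>q X\<^sub>q\<^sup>2) = \<Prod> E exp (c\<^sub>q G\<^sup>2)\<close> for one standard normal \<open>G\<close> (\<open>exp_quadratic_form\<close>). This
identifies the characteristic function of the normalised statistic at every fixed argument once the
\<open>b\<^sub>q\<close> are small, and the continuity theorem of Levy concludes.\<close>

section \<open>Orthonormal series in mean square\<close>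

text \<open>This is the nonnegativity of the variance of \<open>\<bar>f\<bar>\<close>.\<close>

lemma (in prob_space) L1_le_L2:
  fixes f :: "'a \<Rightarrow> real"
  assumes [measurable]: "f \<in> borel_measurable M" and f2: "integrable M (\<lambda>x. (f x)\<^sup>2)"
  shows "(\<integral>x. \<bar>f x\<bar> \<partial>M) \<le> sqrt (\<integral>x. (f x)\<^sup>2 \<partial>M)"
proof -
  have i: "integrable M (\<lambda>x. \<bar>f x\<bar>)"
    using square_integrable_imp_integrable[OF _ f2] by simp
  have "0 \<le> variance (\<lambda>x. \<bar>f x\<bar>)" by (rule variance_positive)
  also have "\<dots> = (\<integral>x. (f x)\<^sup>2 \<partial>M) - (\<integral>x. \<bar>f x\<bar> \<partial>M)\<^sup>2"
    using variance_eq[OF i] f2 by simp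
  finally show ?thesis by (intro real_le_rsqrt) simp
qed

lemma suminf_shift_tendsto_0:
  fixes a :: "nat \<Rightarrow> real"
  assumes "summable a"
  shows "(\<lambda>n. \<Sum>k. a (k + n)) \<longlonglongrightarrow> 0"
proof -
  have "(\<lambda>n. (\<Sum>k. a k) - (\<Sum>k<n. a k)) \<longlonglongrightarrow> (\<Sum>k. a k) - (\<Sum>k. a k)"
    by (intro tendsto_intros summable_LIMSEQ assms)
  then show ?thesis using suminf_minus_initial_segment[OF assms] by simp
qed

text \<open>The uniform bound makes every finite combination square integrable on a probability space.\<close>

locale bounded_orthonormal = prob_space M for M :: "'a measure" +
  fixes e :: "nat \<Rightarrow> 'a \<Rightarrow> real" and B :: real
  assumes meas_e [measurable]: "\<And>k. e k \<in> borel_measurable M"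
    and bound_e: "\<And>k x. \<bar>e k x\<bar> \<le> B"
    and ortho_e: "\<And>j k. (\<integral>x. e j x * e k x \<partial>M) = (if j = k then 1 else 0)"
begin

lemma integrable_mult_e: "integrable M (\<lambda>x. e j x * e k x)"
proof (rule integrable_const_bound[of _ "B * B"])
  have "0 \<le> B" using bound_e[of 0 undefined] by simp
  then show "AE x in M. norm (e j x * e k x) \<le> B * B"
    by (auto simp: abs_mult intro!: mult_mono bound_e)
qed simp

lemma
  assumes "finite A"
  shows integrable_square_sum: "integrable M (\<lambda>x. (\<Sum>k\<in>A. b k * e k x)\<^sup>2)"
    and integral_square_sum: "(\<integral>x. (\<Sum>k\<in>A. b k * e k x)\<^sup>2 \<partial>M) = (\<Sum>k\<in>A. (b k)\<^sup>2)"
proof -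
  have eq: "(\<Sum>k\<in>A. b k * e k x)\<^sup>2 = (\<Sum>j\<in>A. \<Sum>k\<in>A. (b j * b k) * (e j x * e k x))" for x
    by (simp add: power2_eq_square sum_product mult_ac)
  show "integrable M (\<lambda>x. (\<Sum>k\<in>A. b k * e k x)\<^sup>2)"
    unfolding eq by (intro Bochner_Integration.integrable_sum integrable_mult_right integrable_mult_e)
  have "(\<integral>x. (\<Sum>k\<in>A. b k * e k x)\<^sup>2 \<partial>M) = (\<Sum>j\<in>A. \<Sum>k\<in>A. (b j * b k) * (if j = k then 1 else 0))"
    unfolding eq
    by (subst Bochner_Integration.integral_sum,
        (intro Bochner_Integration.integrable_sum integrable_mult_right integrable_mult_e)[1],
        subst Bochner_Integration.integral_sum,
        (intro integrable_mult_right integrable_mult_e)[1],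
        simp only: integral_mult_right_zero ortho_e)
  also have "\<dots> = (\<Sum>j\<in>A. \<Sum>k\<in>A. if j = k then b j * b k else 0)"
    by (intro sum.cong refl) auto
  also have "\<dots> = (\<Sum>k\<in>A. (b k)\<^sup>2)"
    using assms by (simp add: power2_eq_square)
  finally show "(\<integral>x. (\<Sum>k\<in>A. b k * e k x)\<^sup>2 \<partial>M) = (\<Sum>k\<in>A. (b k)\<^sup>2)" .
qed

text \<open>Completeness of the space of square integrable functions, in the only form needed: along a
subsequence whose consecutive differences have mean squares at most \<open>4\<^bsup>-j\<^esup>\<close>, the partial sums converge
almost everywhere, and Fatou's lemma carries the tail estimate over to the limit.\<close>

lemma Riesz_Fischer_approx:
  assumes b: "summable (\<lambda>k. (b k)\<^sup>2)"
  obtains G where "G \<in> borel_measurable M"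
    and "\<And>n. integrable M (\<lambda>x. (G x - (\<Sum>k<n. b k * e k x))\<^sup>2)"
    and "\<And>n. (\<integral>x. (G x - (\<Sum>k<n. b k * e k x))\<^sup>2 \<partial>M) \<le> (\<Sum>k. (b (k + n))\<^sup>2)"
proof -
  define S where "S n x = (\<Sum>k<n. b k * e k x)" for n x
  have [measurable]: "S n \<in> borel_measurable M" for n unfolding S_def by measurable
  have diff: "S n' x - S n x = (\<Sum>k\<in>{n..<n'}. b k * e k x)" if "n \<le> n'" for n n' x
  proof -
    have "{..<n'} = {..<n} \<union> {n..<n'}" using that by auto
    then have "S n' x = S n x + (\<Sum>k\<in>{n..<n'}. b k * e k x)"
      unfolding S_def by (simp add: sum.union_disjoint ivl_disj_int)
    then show ?thesis by simp
  qed
  have intd: "integrable M (\<lambda>x. (S n' x - S n x)\<^sup>2)"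
    and vald: "(\<integral>x. (S n' x - S n x)\<^sup>2 \<partial>M) = (\<Sum>k\<in>{n..<n'}. (b k)\<^sup>2)" if "n \<le> n'" for n n'
    unfolding diff[OF that] by (simp_all add: integrable_square_sum integral_square_sum)
  have "\<exists>N. \<forall>n\<ge>N. \<forall>n'. (\<Sum>k\<in>{n..<n'}. (b k)\<^sup>2) < (1/4) ^ j" for j :: nat
  proof -
    have "(0::real) < (1/4) ^ j" by simp
    then obtain N where N: "\<forall>n\<ge>N. \<forall>n'. norm (\<Sum>k\<in>{n..<n'}. (b k)\<^sup>2) < (1/4) ^ j"
      using b[unfolded summable_Cauchy] by blast
    have "(\<Sum>k\<in>{n..<n'}. (b k)\<^sup>2) < (1/4) ^ j" if "n \<ge> N" for n n'
      using N[rule_format, OF that, of n'] by (simp add: sum_nonneg)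
    then show ?thesis by blast
  qed
  then obtain N where N: "\<And>j n n'. n \<ge> N j \<Longrightarrow> (\<Sum>k\<in>{n..<n'}. (b k)\<^sup>2) < (1/4) ^ j"
    by metis
  \<comment> \<open>A subsequence along which consecutive differences are geometrically small in mean square.\<close>
  define r where "r j = j + (\<Sum>i\<le>j. N i)" for j :: nat
  have r_ge: "r j \<ge> j" "r j \<ge> N j" for j
    by (auto simp: r_def intro!: trans_le_add2 member_le_sum)
  have r_Suc: "r j \<le> r (Suc j)" for j by (simp add: r_def)
  define D where "D j x = S (r (Suc j)) x - S (r j) x" for j x
  have [measurable]: "D j \<in> borel_measurable M" for j unfolding D_def by measurable
  have D2: "(\<integral>x. (D j x)\<^sup>2 \<partial>M) \<le> (1/4) ^ j" for j
    unfolding D_def vald[OF r_Suc] using N[OF r_ge(2)] by (intro less_imp_le)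
  have "(\<integral>\<^sup>+x. (\<Sum>j. ennreal (2 ^ j * (D j x)\<^sup>2)) \<partial>M) = (\<Sum>j. \<integral>\<^sup>+x. ennreal (2 ^ j * (D j x)\<^sup>2) \<partial>M)"
    by (rule nn_integral_suminf) simp
  also have "\<dots> \<le> (\<Sum>j. ennreal ((1/2) ^ j))"
  proof (intro suminf_le allI)
    fix j
    have "(\<integral>\<^sup>+x. ennreal (2 ^ j * (D j x)\<^sup>2) \<partial>M) = ennreal (\<integral>x. 2 ^ j * (D j x)\<^sup>2 \<partial>M)"
      using intd[OF r_Suc] by (intro nn_integral_eq_integral integrable_mult_right) (auto simp: D_def)
    also have "(\<integral>x. 2 ^ j * (D j x)\<^sup>2 \<partial>M) \<le> 2 ^ j * (1/4) ^ j"
      using D2 by simp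
    also have "2 ^ j * (1/4) ^ j = (1/2 :: real) ^ j"
      by (simp flip: power_mult_distrib)
    finally show "(\<integral>\<^sup>+x. ennreal (2 ^ j * (D j x)\<^sup>2) \<partial>M) \<le> ennreal ((1/2) ^ j)"
      by (simp add: ennreal_leI)
  qed auto
  also have "\<dots> = ennreal 2"
    by (subst suminf_ennreal2) (auto simp: suminf_geometric)
  finally have "(\<integral>\<^sup>+x. (\<Sum>j. ennreal (2 ^ j * (D j x)\<^sup>2)) \<partial>M) \<noteq> \<infinity>"
    by (auto simp: top_unique)
  then have "AE x in M. (\<Sum>j. ennreal (2 ^ j * (D j x)\<^sup>2)) \<noteq> \<infinity>"
    by (intro nn_integral_PInf_AE) auto
  then have conv: "AE x in M. convergent (\<lambda>j. S (r j) x)"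
  proof eventually_elim
    case (elim x)
    have "summable (\<lambda>j. 2 ^ j * (D j x)\<^sup>2)"
      using elim by (intro summable_suminf_not_top) auto
    then have "summable (\<lambda>j. (1/2) ^ j + 2 ^ j * (D j x)\<^sup>2)"
      by (intro summable_add) auto
    then have "summable (\<lambda>j. D j x)"
    proof (rule summable_comparison_test'[where N = 0])
      fix j
      define y where "y = \<bar>D j x\<bar>"
      \<comment> \<open>Arithmetic-geometric mean inequality.\<close>
      have "0 \<le> (1 / 2 ^ j - y)\<^sup>2 * 2 ^ j" by simp
      also have "\<dots> = (1/2) ^ j - 2 * y + 2 ^ j * y\<^sup>2"
        by (simp add: power2_eq_square field_simps)
      finally have "2 * y \<le> (1/2) ^ j + 2 ^ j * y\<^sup>2" by simp
      moreover have "0 \<le> y" by (simp add: y_def)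
      ultimately show "norm (D j x) \<le> (1/2) ^ j + 2 ^ j * (D j x)\<^sup>2"
        by (simp add: y_def)
    qed
    then have "convergent (\<lambda>n. \<Sum>j<n. D j x)"
      by (simp add: summable_iff_convergent)
    moreover have "(\<Sum>j<n. D j x) = S (r n) x - S (r 0) x" for n
      unfolding D_def by (rule sum_lessThan_telescope)
    ultimately have "convergent (\<lambda>n. (S (r n) x - S (r 0) x) + S (r 0) x)"
      by (intro convergent_add convergent_const) simp
    then show ?case by simp
  qed
  define G where "G x = lim (\<lambda>j. S (r j) x)" for x
  have [measurable]: "G \<in> borel_measurable M" unfolding G_def by measurable
  have le: "(\<integral>\<^sup>+x. ennreal ((G x - S n x)\<^sup>2) \<partial>M) \<le> ennreal (\<Sum>k. (b (k + n))\<^sup>2)" for n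
  proof -
    have "(\<integral>\<^sup>+x. ennreal ((G x - S n x)\<^sup>2) \<partial>M)
        = (\<integral>\<^sup>+x. liminf (\<lambda>j. ennreal ((S (r j) x - S n x)\<^sup>2)) \<partial>M)"
    proof (rule nn_integral_cong_AE)
      from conv show "AE x in M. ennreal ((G x - S n x)\<^sup>2) = liminf (\<lambda>j. ennreal ((S (r j) x - S n x)\<^sup>2))"
      proof eventually_elim
        case (elim x)
        then have "(\<lambda>j. S (r j) x) \<longlonglongrightarrow> G x" by (simp add: G_def convergent_LIMSEQ_iff)
        then have "(\<lambda>j. ennreal ((S (r j) x - S n x)\<^sup>2)) \<longlonglongrightarrow> ennreal ((G x - S n x)\<^sup>2)"
          by (intro tendsto_intros)
        then show ?case by (intro lim_imp_Liminf[symmetric]) auto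
      qed
    qed
    also have "\<dots> \<le> liminf (\<lambda>j. \<integral>\<^sup>+x. ennreal ((S (r j) x - S n x)\<^sup>2) \<partial>M)"
      by (rule nn_integral_liminf) simp
    also have "\<dots> \<le> liminf (\<lambda>j::nat. ennreal (\<Sum>k. (b (k + n))\<^sup>2))"
    proof (rule Liminf_mono)
      show "\<forall>\<^sub>F j in sequentially. (\<integral>\<^sup>+x. ennreal ((S (r j) x - S n x)\<^sup>2) \<partial>M) \<le> ennreal (\<Sum>k. (b (k + n))\<^sup>2)"
        using eventually_ge_at_top[of n]
      proof eventually_elim
        case (elim j)
        then have rn: "n \<le> r j" using r_ge(1)[of j] by simp
        have "(\<integral>\<^sup>+x. ennreal ((S (r j) x - S n x)\<^sup>2) \<partial>M) = ennreal (\<integral>x. (S (r j) x - S n x)\<^sup>2 \<partial>M)"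
          using intd[OF rn] by (intro nn_integral_eq_integral) auto
        also have "\<dots> = ennreal (\<Sum>k\<in>{n..<r j}. (b k)\<^sup>2)" by (simp add: vald[OF rn])
        also have "(\<Sum>k\<in>{n..<r j}. (b k)\<^sup>2) = (\<Sum>k<r j - n. (b (k + n))\<^sup>2)"
          using rn by (intro sum.reindex_bij_witness[of _ "\<lambda>k. k + n" "\<lambda>k. k - n"]) auto
        also have "\<dots> \<le> (\<Sum>k. (b (k + n))\<^sup>2)"
          using b by (intro sum_le_suminf) (auto simp: summable_iff_shift[where f = "\<lambda>k. (b k)\<^sup>2"])
        finally show ?case by (simp add: ennreal_leI)
      qed
    qed
    also have "\<dots> = ennreal (\<Sum>k. (b (k + n))\<^sup>2)" by (simp add: Liminf_const)
    finally show ?thesis .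
  qed
  have tail_nonneg: "0 \<le> (\<Sum>k. (b (k + n))\<^sup>2)" for n
    using b by (intro suminf_nonneg) (auto simp: summable_iff_shift[where f = "\<lambda>k. (b k)\<^sup>2"])
  have int: "integrable M (\<lambda>x. (G x - S n x)\<^sup>2)" for n
    using le[of n] by (intro integrableI_nonneg) (auto intro: le_less_trans)
  show thesis
  proof (rule that[of G])
    show "integrable M (\<lambda>x. (G x - (\<Sum>k<n. b k * e k x))\<^sup>2)" for n
      using int[of n] by (simp add: S_def)
    have "ennreal (\<integral>x. (G x - S n x)\<^sup>2 \<partial>M) \<le> ennreal (\<Sum>k. (b (k + n))\<^sup>2)" for n
      using le[of n] int[of n] by (subst (asm) nn_integral_eq_integral) auto
    then show "(\<integral>x. (G x - (\<Sum>k<n. b k * e k x))\<^sup>2 \<partial>M) \<le> (\<Sum>k. (b (k + n))\<^sup>2)" for n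
      using tail_nonneg by (simp add: ennreal_le_iff S_def)
  qed simp
qed

text \<open>The norm identity needs the lower bound \<open>\<Sum> b\<^sub>k\<^sup>2 \<le> \<integral> G\<^sup>2\<close>. It follows from the inequality
\<open>s\<^sup>2 \<le> (1 + \<epsilon>) g\<^sup>2 + (1 + 1/\<epsilon>) (g - s)\<^sup>2\<close> by letting first \<open>n \<longlongrightarrow> \<infinity>\<close> and then \<open>\<epsilon> \<longlongrightarrow> 0\<close>.\<close>

theorem Riesz_Fischer:
  assumes b: "summable (\<lambda>k. (b k)\<^sup>2)"
  obtains G where "G \<in> borel_measurable M" "integrable M (\<lambda>x. (G x)\<^sup>2)"
    and "(\<integral>x. (G x)\<^sup>2 \<partial>M) = (\<Sum>k. (b k)\<^sup>2)"
    and "(\<lambda>n. \<integral>x. \<bar>G x - (\<Sum>k<n. b k * e k x)\<bar> \<partial>M) \<longlonglongrightarrow> 0"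
proof -
  define S where "S n x = (\<Sum>k<n. b k * e k x)" for n x
  have [measurable]: "S n \<in> borel_measurable M" for n unfolding S_def by measurable
  define tail where "tail n = (\<Sum>k. (b (k + n))\<^sup>2)" for n
  have tail: "tail \<longlonglongrightarrow> 0"
    unfolding tail_def using suminf_shift_tendsto_0[OF b] by simp
  obtain G where G [measurable]: "G \<in> borel_measurable M"
    and int: "\<And>n. integrable M (\<lambda>x. (G x - S n x)\<^sup>2)"
    and le: "\<And>n. (\<integral>x. (G x - S n x)\<^sup>2 \<partial>M) \<le> tail n"
    using Riesz_Fischer_approx[OF b, folded S_def tail_def] by blast
  have G2: "integrable M (\<lambda>x. (G x)\<^sup>2)" using int[of 0] by (simp add: S_def)
  have upper: "(\<integral>x. (G x)\<^sup>2 \<partial>M) \<le> (\<Sum>k. (b k)\<^sup>2)"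
    using le[of 0] by (simp add: S_def tail_def)
  have lower: "(\<Sum>k. (b k)\<^sup>2) \<le> (1 + \<epsilon>) * (\<integral>x. (G x)\<^sup>2 \<partial>M)" if "\<epsilon> > 0" for \<epsilon> :: real
  proof -
    have "(\<Sum>k<n. (b k)\<^sup>2) \<le> (1 + \<epsilon>) * (\<integral>x. (G x)\<^sup>2 \<partial>M) + (1 + 1 / \<epsilon>) * tail n" for n
    proof -
      have young: "s\<^sup>2 \<le> (1 + \<epsilon>) * g\<^sup>2 + (1 + 1 / \<epsilon>) * (g - s)\<^sup>2" for g s :: real
      proof -
        define d where "d = g - s"
        have "0 \<le> (sqrt \<epsilon> * g + d / sqrt \<epsilon>)\<^sup>2" by simp
        also have "\<dots> = \<epsilon> * g\<^sup>2 + 2 * g * d + d\<^sup>2 / \<epsilon>"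
          using that by (simp add: power2_sum power_mult_distrib power_divide)
        finally have "0 \<le> \<epsilon> * g\<^sup>2 + 2 * g * d + d\<^sup>2 / \<epsilon>" .
        moreover have "s\<^sup>2 = g\<^sup>2 - 2 * g * d + d\<^sup>2"
          by (simp add: d_def power2_eq_square algebra_simps)
        ultimately show ?thesis by (simp add: algebra_simps d_def[symmetric])
      qed
      have "(\<Sum>k<n. (b k)\<^sup>2) = (\<integral>x. (S n x)\<^sup>2 \<partial>M)"
        unfolding S_def by (simp add: integral_square_sum)
      also have "\<dots> \<le> (\<integral>x. (1 + \<epsilon>) * (G x)\<^sup>2 + (1 + 1 / \<epsilon>) * (G x - S n x)\<^sup>2 \<partial>M)"
        by (intro integral_mono Bochner_Integration.integrable_add integrable_mult_right G2 int young)
           (auto simp: S_def integrable_square_sum)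
      also have "\<dots> = (1 + \<epsilon>) * (\<integral>x. (G x)\<^sup>2 \<partial>M) + (1 + 1 / \<epsilon>) * (\<integral>x. (G x - S n x)\<^sup>2 \<partial>M)"
        by (subst Bochner_Integration.integral_add) (auto simp: G2 int)
      also have "\<dots> \<le> (1 + \<epsilon>) * (\<integral>x. (G x)\<^sup>2 \<partial>M) + (1 + 1 / \<epsilon>) * tail n"
        using that by (intro add_left_mono mult_left_mono le) simp
      finally show ?thesis .
    qed
    moreover have "(\<lambda>n. (1 + \<epsilon>) * (\<integral>x. (G x)\<^sup>2 \<partial>M) + (1 + 1 / \<epsilon>) * tail n)
        \<longlonglongrightarrow> (1 + \<epsilon>) * (\<integral>x. (G x)\<^sup>2 \<partial>M) + (1 + 1 / \<epsilon>) * 0"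
      by (intro tendsto_intros tail)
    ultimately show ?thesis
      using LIMSEQ_le[OF summable_LIMSEQ[OF b], of _ "(1 + \<epsilon>) * (\<integral>x. (G x)\<^sup>2 \<partial>M)"] by simp
  qed
  have "(\<Sum>k. (b k)\<^sup>2) \<le> (\<integral>x. (G x)\<^sup>2 \<partial>M)"
  proof (rule tendsto_lowerbound)
    have "((\<lambda>\<epsilon>. (1 + \<epsilon>) * (\<integral>x. (G x)\<^sup>2 \<partial>M)) \<longlongrightarrow> (1 + 0) * (\<integral>x. (G x)\<^sup>2 \<partial>M)) (at_right 0)"
      by (intro tendsto_intros)
    then show "((\<lambda>\<epsilon>. (1 + \<epsilon>) * (\<integral>x. (G x)\<^sup>2 \<partial>M)) \<longlongrightarrow> (\<integral>x. (G x)\<^sup>2 \<partial>M)) (at_right 0)"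
      by simp
    show "\<forall>\<^sub>F \<epsilon> in at_right 0. (\<Sum>k. (b k)\<^sup>2) \<le> (1 + \<epsilon>) * (\<integral>x. (G x)\<^sup>2 \<partial>M)"
      using lower by (auto simp: eventually_at_right_field intro: exI[of _ 1])
  qed simp
  moreover have "(\<lambda>n. \<integral>x. \<bar>G x - S n x\<bar> \<partial>M) \<longlonglongrightarrow> 0"
  proof (rule tendsto_sandwich[of "\<lambda>_. 0" _ _ "\<lambda>n. sqrt (tail n)"])
    show "(\<lambda>n. sqrt (tail n)) \<longlonglongrightarrow> 0" using tendsto_real_sqrt[OF tail] by simp
    show "\<forall>\<^sub>F n in sequentially. (\<integral>x. \<bar>G x - S n x\<bar> \<partial>M) \<le> sqrt (tail n)"
    proof (intro always_eventually allI)
      fix n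
      have "(\<integral>x. \<bar>G x - S n x\<bar> \<partial>M) \<le> sqrt (\<integral>x. (G x - S n x)\<^sup>2 \<partial>M)"
        by (rule L1_le_L2) (use int in auto)
      also have "\<dots> \<le> sqrt (tail n)" using le by simp
      finally show "(\<integral>x. \<bar>G x - S n x\<bar> \<partial>M) \<le> sqrt (tail n)" .
    qed
  qed auto
  ultimately show thesis
    using that[of G] G G2 upper by (simp add: S_def)
qed

end

section \<open>The shifted trigonometric system\<close>

lemma summable_inverse_Suc_square: "summable (\<lambda>j. 1 / (real (Suc j))\<^sup>2)"
  using inverse_power_summable[of 2, where 'a = real]
  by (subst summable_Suc_iff) (simp add: divide_inverse)

definition angular_freq :: "nat \<Rightarrow> real" where
  "angular_freq \<nu> = 2 * pi * real ((\<nu> + 1) div 2)"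

lemma trig_eigenvalue_eq: "trig_eigenvalue m \<nu> = angular_freq \<nu> ^ (2 * m)"
  by (simp add: trig_eigenvalue_def angular_freq_def)

lemma angular_freq_Suc_ge: "real (Suc \<nu>) \<le> angular_freq (Suc \<nu>)"
proof -
  have "real (Suc \<nu>) \<le> real (2 * ((Suc \<nu> + 1) div 2))" by (simp only: of_nat_le_iff)
  also have "\<dots> = 2 * 1 * real ((Suc \<nu> + 1) div 2)" by simp
  also have "\<dots> \<le> angular_freq (Suc \<nu>)"
    unfolding angular_freq_def using pi_gt3 by (intro mult_right_mono mult_left_mono) auto
  finally show ?thesis .
qed

lemma angular_freq_Suc_ge_1: "1 \<le> angular_freq (Suc \<nu>)"
  using angular_freq_Suc_ge[of \<nu>] by simp

lemma summable_inverse_angular_freq: "summable (\<lambda>\<nu>. 1 / (angular_freq (Suc \<nu>))\<^sup>2)"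
proof (rule summable_comparison_test'[where N = 0])
  show "summable (\<lambda>\<nu>. 1 / (real (Suc \<nu>))\<^sup>2)"
    by (rule summable_inverse_Suc_square)
  show "norm (1 / (angular_freq (Suc \<nu>))\<^sup>2) \<le> 1 / (real (Suc \<nu>))\<^sup>2" for \<nu>
    using angular_freq_Suc_ge[of \<nu>] angular_freq_Suc_ge_1[of \<nu>]
    by (auto intro!: divide_left_mono power_mono simp del: of_nat_Suc)
qed

text \<open>Differentiating a cosine advances its phase by a quarter turn. With a sine written as a cosine delayed
by a quarter turn, the \<open>j\<close>-th derivatives of all basis functions are, up to powers of the frequency,
cosines with the phase below; \<open>j = 0\<close> gives back the basis itself.\<close>

definition trig_phase :: "nat \<Rightarrow> nat \<Rightarrow> real" where
  "trig_phase j \<nu> = (real j - of_bool (even \<nu>)) * (pi / 2)"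

definition trig_shift :: "nat \<Rightarrow> nat \<Rightarrow> real \<Rightarrow> real" where
  "trig_shift j \<nu> t = sqrt 2 * cos (angular_freq \<nu> * t + trig_phase j \<nu>)"

lemma trig_shift_0: "trig_shift 0 \<nu> t = trig_basis \<nu> t"
  by (simp add: trig_shift_def trig_phase_def trig_basis_def angular_freq_def cos_diff)

lemma abs_trig_shift_le: "\<bar>trig_shift j \<nu> t\<bar> \<le> sqrt 2"
  by (simp add: trig_shift_def abs_mult)

lemma continuous_on_trig_shift [continuous_intros]: "continuous_on A (trig_shift j \<nu>)"
  unfolding trig_shift_def by (intro continuous_intros)

lemma borel_measurable_trig_shift [measurable]: "trig_shift j \<nu> \<in> borel_measurable borel"
  by (intro borel_measurable_continuous_onI continuous_intros)

lemma has_derivative_trig_shift: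
  "(trig_shift j \<nu> has_real_derivative angular_freq \<nu> * trig_shift (Suc j) \<nu> t) (at t)"
proof -
  have "trig_phase (Suc j) \<nu> = trig_phase j \<nu> + pi / 2"
    by (simp add: trig_phase_def algebra_simps)
  then have "trig_shift (Suc j) \<nu> t = - (sqrt 2 * sin (angular_freq \<nu> * t + trig_phase j \<nu>))"
    by (simp only: trig_shift_def minus_sin_cos_eq add.assoc of_real_eq_id id_apply flip: mult_minus_right)
  then show ?thesis
    unfolding trig_shift_def by (auto intro!: derivative_eq_intros)
qed

section \<open>Integration over the unit interval\<close>

lemma LBINT_derivative:
  fixes F f :: "real \<Rightarrow> real"
  assumes "t \<ge> 0" and F: "\<And>x. (F has_real_derivative f x) (at x)" and f: "continuous_on UNIV f"
  shows "(LBINT u:{0..t}. f u) = F t - F 0"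
proof -
  have "(LBINT u=0..t. f u) = F t - F 0"
  proof (subst zero_ereal_def, rule interval_integral_FTC_finite)
    show "continuous_on {min 0 t..max 0 t} f"
      using f by (rule continuous_on_subset) simp
    show "(F has_vector_derivative f x) (at x within {min 0 t..max 0 t})" for x
      using has_field_derivative_at_within[OF F, of x]
      by (simp add: has_real_derivative_iff_has_vector_derivative)
  qed
  then show ?thesis
    using assms(1) interval_integral_Icc[of 0 t f] by (simp add: zero_ereal_def)
qed

definition unit_measure :: "real measure" where
  "unit_measure = restrict_space lborel {0..1}"

lemma prob_space_unit_measure: "prob_space unit_measure"
  by standard (simp add: unit_measure_def emeasure_restrict_space space_restrict_space)

lemma measurable_unit_measureI [measurable (raw)]:
  "f \<in> borel_measurable borel \<Longrightarrow> f \<in> borel_measurable unit_measure"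
  unfolding unit_measure_def by (rule measurable_restrict_space1) simp

lemma integral_unit_measure:
  fixes f :: "real \<Rightarrow> real"
  shows "(LBINT t:{0..1}. f t) = (\<integral>t. f t \<partial>unit_measure)"
  by (simp add: unit_measure_def set_lebesgue_integral_def integral_restrict_space)

lemma integrable_unit_measure:
  fixes f :: "real \<Rightarrow> real"
  shows "set_integrable lborel {0..1} f \<longleftrightarrow> integrable unit_measure f"
  by (simp add: unit_measure_def set_integrable_def integrable_restrict_space)

lemma integral_cos_unit:
  fixes L :: int
  shows "(\<integral>t. cos (2 * pi * of_int L * t + \<theta>) \<partial>unit_measure) = (if L = 0 then cos \<theta> else 0)"
proof (cases "L = 0")
  case True
  interpret prob_space unit_measure by (rule prob_space_unit_measure)
  show ?thesis using True prob_space by simp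
next
  case False
  define F where "F t = sin (2 * pi * of_int L * t + \<theta>) / (2 * pi * of_int L)" for t
  have "(LBINT t:{0..1}. cos (2 * pi * of_int L * t + \<theta>)) = F 1 - F 0"
  proof (rule LBINT_derivative)
    show "(F has_real_derivative cos (2 * pi * of_int L * x + \<theta>)) (at x)" for x
      unfolding F_def using False by (auto intro!: derivative_eq_intros)
  qed (auto intro!: continuous_intros)
  also have "\<dots> = 0"
    using sin_int_2pin[of L] cos_int_2pin[of L] by (simp add: F_def sin_add mult_ac)
  finally show ?thesis using False by (simp add: integral_unit_measure)
qed

text \<open>Two indices with the same frequency but different parity have phases a quarter turn apart, so the
constant part of the product of the two cosines vanishes.\<close>

lemma trig_shift_orthonormal:
  "(\<integral>t. trig_shift j (Suc \<mu>) t * trig_shift j (Suc \<nu>) t \<partial>unit_measure) = (if \<mu> = \<nu> then 1 else 0)"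
proof -
  interpret prob_space unit_measure by (rule prob_space_unit_measure)
  define k l where "k = (Suc \<mu> + 1) div 2" and "l = (Suc \<nu> + 1) div 2"
  define a b where "a = trig_phase j (Suc \<mu>)" and "b = trig_phase j (Suc \<nu>)"
  have int: "integrable unit_measure (\<lambda>t. cos (x * t + y))" for x y
    by (rule integrable_const_bound[of _ 1]) auto
  have "trig_shift j (Suc \<mu>) t * trig_shift j (Suc \<nu>) t =
     cos (2 * pi * of_int (int k - int l) * t + (a - b)) + cos (2 * pi * of_int (int k + int l) * t + (a + b))" for t
  proof -
    define x y where "x = 2 * pi * real k * t + a" and "y = 2 * pi * real l * t + b"
    have "trig_shift j (Suc \<mu>) t * trig_shift j (Suc \<nu>) t = (sqrt 2 * sqrt 2) * (cos x * cos y)"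
      unfolding trig_shift_def angular_freq_def k_def[symmetric] l_def[symmetric]
        a_def[symmetric] b_def[symmetric] x_def[symmetric] y_def[symmetric] by (simp only: mult_ac)
    also have "\<dots> = cos (x - y) + cos (x + y)"
      by (simp add: cos_times_cos)
    also have "x - y = 2 * pi * of_int (int k - int l) * t + (a - b)"
      by (simp add: x_def y_def algebra_simps)
    also have "x + y = 2 * pi * of_int (int k + int l) * t + (a + b)"
      by (simp add: x_def y_def algebra_simps)
    finally show ?thesis .
  qed
  then have "(\<integral>t. trig_shift j (Suc \<mu>) t * trig_shift j (Suc \<nu>) t \<partial>unit_measure) =
     (if int k - int l = 0 then cos (a - b) else 0) + (if int k + int l = 0 then cos (a + b) else 0)"
    by (simp only: Bochner_Integration.integral_add[OF int int] integral_cos_unit)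
  also have "\<dots> = (if k = l then cos (a - b) else 0)"
    by (simp add: k_def)
  also have "\<dots> = (if \<mu> = \<nu> then 1 else 0)"
  proof (cases "k = l")
    case True
    then show ?thesis
    proof (cases "\<mu> = \<nu>")
      case False
      have "even \<mu> \<noteq> even \<nu>" using True False unfolding k_def l_def by presburger
      then have "a - b = pi / 2 \<or> a - b = - (pi / 2)"
        by (auto simp: a_def b_def trig_phase_def algebra_simps)
      then have "cos (a - b) = 0" by (elim disjE) (simp_all only: cos_pi_half cos_minus)
      then show ?thesis using False by simp
    qed (simp add: a_def b_def)
  qed (auto simp: k_def l_def)
  finally show ?thesis .
qed

lemma bounded_orthonormal_trig_shift:
  "bounded_orthonormal unit_measure (\<lambda>\<nu>. trig_shift j (Suc \<nu>)) (sqrt 2)"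
proof -
  interpret prob_space unit_measure by (rule prob_space_unit_measure)
  show ?thesis
    by unfold_locales (auto simp: abs_trig_shift_le trig_shift_orthonormal)
qed

section \<open>Absolutely continuous derivatives of trigonometric series\<close>

text \<open>Integration from \<open>0\<close> to \<open>t\<close> is continuous for the mean distance, so the fundamental theorem of calculus for
the partial sums survives in the limit. Convergence of the differentiated series is measured in the mean
because at the highest order it can fail at some points.\<close>

lemma ac_derivative_trig_series:
  assumes f: "\<And>t. t \<in> {0..1} \<Longrightarrow> (\<lambda>\<nu>. a \<nu> * trig_shift j (Suc \<nu>) t) sums f t"
    and G: "integrable unit_measure G"
    and L1: "(\<lambda>n. \<integral>t. \<bar>G t - (\<Sum>\<nu><n. (a \<nu> * angular_freq (Suc \<nu>)) * trig_shift (Suc j) (Suc \<nu>) t)\<bar> \<partial>unit_measure) \<longlonglongrightarrow> 0"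
  shows "ac_derivative f G"
  unfolding ac_derivative_def
proof (intro conjI ballI)
  show G': "set_integrable lborel {0..1} G"
    using G by (simp add: integrable_unit_measure)
  fix t :: real assume t: "t \<in> {0..1}"
  define P where "P n u = (\<Sum>\<nu><n. a \<nu> * trig_shift j (Suc \<nu>) u)" for n u
  define S where "S n u = (\<Sum>\<nu><n. (a \<nu> * angular_freq (Suc \<nu>)) * trig_shift (Suc j) (Suc \<nu>) u)" for n u
  have contS: "continuous_on A (S n)" for A n unfolding S_def by (intro continuous_intros)
  have S_int: "set_integrable lborel {0..1} (S n)" for n
    by (rule borel_integrable_atLeastAtMost'[OF contS])
  have sub: "{0..t} \<in> sets lborel" "{0..t} \<subseteq> {0..1}" using t by auto
  have FTC: "(LBINT u:{0..t}. S n u) = P n t - P n 0" for n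
  proof (rule LBINT_derivative)
    show "(P n has_real_derivative S n x) (at x)" for x
      unfolding P_def[abs_def] S_def
      by (intro DERIV_sum) (auto intro!: derivative_eq_intros has_derivative_trig_shift)
  qed (use t contS in auto)
  have bound: "\<bar>(LBINT u:{0..t}. G u) - (LBINT u:{0..t}. S n u)\<bar> \<le> (\<integral>u. \<bar>G u - S n u\<bar> \<partial>unit_measure)" for n
  proof -
    have iG: "set_integrable lborel {0..t} G" and iS: "set_integrable lborel {0..t} (S n)"
      using set_integrable_subset[OF G' sub] set_integrable_subset[OF S_int sub] by auto
    have iD: "set_integrable lborel {0..1} (\<lambda>u. \<bar>G u - S n u\<bar>)"
      by (intro set_integrable_abs set_integral_diff(1) G' S_int)
    have "(LBINT u:{0..t}. G u) - (LBINT u:{0..t}. S n u) = (LBINT u:{0..t}. G u - S n u)"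
      by (rule set_integral_diff(2)[OF iG iS, symmetric])
    also have "\<bar>\<dots>\<bar> \<le> (LBINT u:{0..t}. \<bar>G u - S n u\<bar>)"
      using set_integral_norm_bound[OF set_integral_diff(1)[OF iG iS]] by simp
    also have "\<dots> \<le> (LBINT u:{0..1}. \<bar>G u - S n u\<bar>)"
      using iD set_integrable_subset[OF iD sub] sub
      unfolding set_lebesgue_integral_def set_integrable_def
      by (intro integral_mono) (auto split: split_indicator)
    finally show ?thesis by (simp add: integral_unit_measure)
  qed
  have "(\<lambda>n. (LBINT u:{0..t}. G u) - (LBINT u:{0..t}. S n u)) \<longlonglongrightarrow> 0"
  proof (rule Lim_null_comparison)
    show "(\<lambda>n. \<integral>u. \<bar>G u - S n u\<bar> \<partial>unit_measure) \<longlonglongrightarrow> 0" using L1 by (simp add: S_def)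
  qed (use bound in auto)
  then have "(\<lambda>n. (LBINT u:{0..t}. G u) - (P n t - P n 0)) \<longlonglongrightarrow> 0" by (simp add: FTC)
  moreover have "(\<lambda>n. (LBINT u:{0..t}. G u) - (P n t - P n 0)) \<longlonglongrightarrow> (LBINT u:{0..t}. G u) - (f t - f 0)"
    using f[OF t] f[of 0] unfolding P_def sums_def by (intro tendsto_intros) auto
  ultimately have "0 = (LBINT u:{0..t}. G u) - (f t - f 0)"
    by (rule LIMSEQ_unique)
  then show "f t = f 0 + (LBINT u:{0..t}. G u)" by simp
qed

lemma summable_trig_shift_series:
  "summable (\<lambda>\<nu>. \<bar>a \<nu>\<bar>) \<Longrightarrow> summable (\<lambda>\<nu>. a \<nu> * trig_shift j (Suc \<nu>) t)"
  by (rule summable_comparison_test'[of "\<lambda>\<nu>. \<bar>a \<nu>\<bar> * sqrt 2" 0])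
     (auto intro!: summable_mult2 mult_left_mono abs_trig_shift_le simp: abs_mult)

text \<open>Below the highest order the differentiated series converges uniformly. The derivative can then be taken
to be its pointwise sum, which is what the next differentiation requires.\<close>

lemma ac_derivative_trig_series_abs:
  assumes f: "\<And>t. t \<in> {0..1} \<Longrightarrow> (\<lambda>\<nu>. a \<nu> * trig_shift j (Suc \<nu>) t) sums f t"
    and a: "summable (\<lambda>\<nu>. \<bar>a \<nu> * angular_freq (Suc \<nu>)\<bar>)"
  shows "ac_derivative f (\<lambda>t. \<Sum>\<nu>. (a \<nu> * angular_freq (Suc \<nu>)) * trig_shift (Suc j) (Suc \<nu>) t)"
    (is "ac_derivative f ?G")
proof -
  interpret prob_space unit_measure by (rule prob_space_unit_measure)
  define b where "b \<nu> = a \<nu> * angular_freq (Suc \<nu>)" for \<nu>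
  have b: "summable (\<lambda>\<nu>. \<bar>b \<nu>\<bar>)" using a by (simp add: b_def)
  define D where "D n t = ?G t - (\<Sum>\<nu><n. b \<nu> * trig_shift (Suc j) (Suc \<nu>) t)" for n t
  have [measurable]: "D n \<in> borel_measurable unit_measure" for n unfolding D_def by measurable
  have bound: "\<bar>D n t\<bar> \<le> (\<Sum>\<nu>. \<bar>b (\<nu> + n)\<bar>) * sqrt 2" for n t
  proof -
    have s: "summable (\<lambda>\<nu>. \<bar>b (\<nu> + n)\<bar>)"
      using b by (simp add: summable_iff_shift[where f = "\<lambda>\<nu>. \<bar>b \<nu>\<bar>"])
    have "D n t = (\<Sum>\<nu>. b (\<nu> + n) * trig_shift (Suc j) (Suc (\<nu> + n)) t)"
      using suminf_minus_initial_segment[OF summable_trig_shift_series[OF b, of "Suc j" t], of n]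
      by (simp add: D_def b_def)
    also have "\<bar>\<dots>\<bar> \<le> (\<Sum>\<nu>. \<bar>b (\<nu> + n)\<bar> * sqrt 2)"
      using norm_suminf_le[of "\<lambda>\<nu>. b (\<nu> + n) * trig_shift (Suc j) (Suc (\<nu> + n)) t", OF _ summable_mult2[OF s]]
      by (simp add: abs_mult mult_left_mono abs_trig_shift_le)
    finally show ?thesis using s by (simp add: suminf_mult2)
  qed
  have intD: "integrable unit_measure (D n)" for n
    by (rule integrable_const_bound[of _ "(\<Sum>\<nu>. \<bar>b (\<nu> + n)\<bar>) * sqrt 2"]) (auto simp: bound)
  show ?thesis
  proof (rule ac_derivative_trig_series[OF f])
    show "integrable unit_measure ?G" using intD[of 0] by (simp add: D_def[abs_def] b_def)
    have "(\<lambda>n. \<integral>t. \<bar>D n t\<bar> \<partial>unit_measure) \<longlonglongrightarrow> 0"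
    proof (rule Lim_null_comparison)
      have "(\<lambda>n. (\<Sum>\<nu>. \<bar>b (\<nu> + n)\<bar>) * sqrt 2) \<longlonglongrightarrow> 0 * sqrt 2"
        by (intro tendsto_intros suminf_shift_tendsto_0[OF b])
      then show "(\<lambda>n. (\<Sum>\<nu>. \<bar>b (\<nu> + n)\<bar>) * sqrt 2) \<longlonglongrightarrow> 0" by simp
      show "\<forall>\<^sub>F n in sequentially. norm (\<integral>t. \<bar>D n t\<bar> \<partial>unit_measure) \<le> (\<Sum>\<nu>. \<bar>b (\<nu> + n)\<bar>) * sqrt 2"
      proof (intro always_eventually allI)
        fix n
        have "(\<integral>t. \<bar>D n t\<bar> \<partial>unit_measure) \<le> (\<integral>t. (\<Sum>\<nu>. \<bar>b (\<nu> + n)\<bar>) * sqrt 2 \<partial>unit_measure)"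
          using intD by (intro integral_mono bound) auto
        then show "norm (\<integral>t. \<bar>D n t\<bar> \<partial>unit_measure) \<le> (\<Sum>\<nu>. \<bar>b (\<nu> + n)\<bar>) * sqrt 2"
          using prob_space by simp
      qed
    qed
    then show "(\<lambda>n. \<integral>t. \<bar>?G t - (\<Sum>\<nu><n. (a \<nu> * angular_freq (Suc \<nu>)) * trig_shift (Suc j) (Suc \<nu>) t)\<bar> \<partial>unit_measure) \<longlonglongrightarrow> 0"
      by (simp add: D_def b_def)
  qed auto
qed

section \<open>Uniqueness of the derivative\<close>

text \<open>The positive and the negative part of \<open>g\<close> are densities of two measures that agree on all half-lines,
hence on all Borel sets.\<close>

lemma AE_zero_of_indefinite_integral_zero:
  fixes g :: "real \<Rightarrow> real"
  assumes g: "set_integrable lborel {0..1} g"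
    and zero: "\<And>t. t \<in> {0..1} \<Longrightarrow> (LBINT u:{0..t}. g u) = 0"
  shows "AE t in lborel. t \<in> {0..1} \<longrightarrow> g t = 0"
proof -
  define k where "k u = indicator {0..1} u * g u" for u
  have k: "integrable lborel k" using g by (simp add: set_integrable_def k_def[abs_def])
  then have [measurable]: "k \<in> borel_measurable lborel" by simp
  have kr: "(\<integral>u. indicator {x<..} u * k u \<partial>lborel) = 0" for x :: real
  proof -
    have total: "(\<integral>u. k u \<partial>lborel) = 0"
      using zero[of 1] by (simp add: set_lebesgue_integral_def k_def)
    have left: "(\<integral>u. indicator {..x} u * k u \<partial>lborel) = 0"
    proof (cases "x < 0")
      case True
      then have "(\<lambda>u. indicator {..x} u * k u) = (\<lambda>u. 0)" by (auto simp: k_def indicator_def)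
      then show ?thesis by simp
    next
      case False
      then have "(\<integral>u. indicator {..x} u * k u \<partial>lborel) = (LBINT u:{0..min x 1}. g u)"
        unfolding set_lebesgue_integral_def
        by (intro Bochner_Integration.integral_cong refl) (auto simp: k_def indicator_def)
      then show ?thesis using False by (simp add: zero)
    qed
    have "integrable lborel (\<lambda>u. indicator {..x} u * k u)"
      using integrable_mult_indicator[OF _ k, of "{..x}"] by simp
    moreover have "indicator {x<..} u * k u = k u - indicator {..x} u * k u" for u
      by (auto simp: indicator_def)
    ultimately show ?thesis using k total left by simp
  qed
  define p q where "p u = ennreal (max 0 (k u))" and "q u = ennreal (max 0 (- k u))" for u
  have [measurable]: "p \<in> borel_measurable lborel" "q \<in> borel_measurable lborel"
    unfolding p_def[abs_def] q_def[abs_def] by measurable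
  have tailp: "emeasure (density lborel p) {x<..} = ennreal (\<integral>u. indicator {x<..} u * max 0 (k u) \<partial>lborel)"
    and tailq: "emeasure (density lborel q) {x<..} = ennreal (\<integral>u. indicator {x<..} u * max 0 (- k u) \<partial>lborel)"
    and int: "integrable lborel (\<lambda>u. indicator {x<..} u * max 0 (k u))"
      "integrable lborel (\<lambda>u. indicator {x<..} u * max 0 (- k u))" for x
  proof -
    show ip: "integrable lborel (\<lambda>u. indicator {x<..} u * max 0 (k u))"
      by (rule Bochner_Integration.integrable_bound[OF k]) (auto simp: indicator_def)
    show iq: "integrable lborel (\<lambda>u. indicator {x<..} u * max 0 (- k u))"
      by (rule Bochner_Integration.integrable_bound[OF k]) (auto simp: indicator_def)
    show "emeasure (density lborel p) {x<..} = ennreal (\<integral>u. indicator {x<..} u * max 0 (k u) \<partial>lborel)"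
      using ip by (subst emeasure_density, simp, simp, subst nn_integral_eq_integral[symmetric])
        (auto simp: p_def indicator_def intro!: nn_integral_cong)
    show "emeasure (density lborel q) {x<..} = ennreal (\<integral>u. indicator {x<..} u * max 0 (- k u) \<partial>lborel)"
      using iq by (subst emeasure_density, simp, simp, subst nn_integral_eq_integral[symmetric])
        (auto simp: q_def indicator_def intro!: nn_integral_cong)
  qed
  have "density lborel p = density lborel q"
  proof (rule measure_eqI_lessThan)
    fix x :: real
    have "(\<integral>u. indicator {x<..} u * max 0 (k u) \<partial>lborel) - (\<integral>u. indicator {x<..} u * max 0 (- k u) \<partial>lborel)
       = (\<integral>u. indicator {x<..} u * k u \<partial>lborel)"
      by (subst Bochner_Integration.integral_diff[OF int, symmetric], rule Bochner_Integration.integral_cong)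
         (auto simp: max_def)
    then show "emeasure (density lborel p) {x<..} = emeasure (density lborel q) {x<..}"
      unfolding tailp tailq kr by simp
    show "emeasure (density lborel p) {x<..} < \<infinity>" unfolding tailp by simp
  qed simp_all
  then have "AE u in lborel. p u = q u"
    by (intro sigma_finite_measure.density_unique[OF sigma_finite_lborel]) auto
  then show ?thesis
  proof eventually_elim
    case (elim u)
    then have "max 0 (k u) = max 0 (- k u)"
      unfolding p_def q_def by (subst (asm) ennreal_inj) simp_all
    then have "k u = 0" by (simp add: max_def split: if_splits)
    then show ?case by (auto simp: k_def)
  qed
qed

lemma ac_derivative_continuous:
  assumes "ac_derivative f g"
  shows "continuous_on {0..1} f"
proof -
  from assms have g: "set_integrable lborel {0..1} g"
    and f: "\<And>t. t \<in> {0..1} \<Longrightarrow> f t = f 0 + (LBINT u:{0..t}. g u)"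
    unfolding ac_derivative_def by blast+
  have "continuous_on {0..1} (\<lambda>t. f 0 + integral {0..t} g)"
    by (rule continuous_on_add[OF continuous_on_const indefinite_integral_continuous_1])
       (rule set_borel_integral_eq_integral(1)[OF g])
  moreover have "f 0 + integral {0..t} g = f t" if "t \<in> {0..1}" for t
  proof -
    have "set_integrable lborel {0..t} g"
      by (rule set_integrable_subset[OF g]) (use that in auto)
    from set_borel_integral_eq_integral(2)[OF this] f[OF that] show ?thesis by simp
  qed
  ultimately show ?thesis by (rule continuous_on_eq)
qed

lemma continuous_AE_zero:
  fixes d :: "real \<Rightarrow> real"
  assumes d: "continuous_on {0..1} d" and ae: "AE t in lborel. t \<in> {0..1} \<longrightarrow> d t = 0"
    and t: "t \<in> {0..1}"
  shows "d t = 0"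
proof -
  have c: "continuous_on {0..1} (\<lambda>t. (d t)\<^sup>2)" by (intro continuous_intros d)
  have "integral {0..1} (\<lambda>t. (d t)\<^sup>2) = (LBINT t:{0..1}. (d t)\<^sup>2)"
    by (rule set_borel_integral_eq_integral(2)[OF borel_integrable_atLeastAtMost'[OF c], symmetric])
  also have "\<dots> = 0"
    unfolding set_lebesgue_integral_def
    by (rule integral_eq_zero_AE) (use ae in \<open>auto simp: indicator_def elim!: eventually_mono\<close>)
  finally have z: "integral {0..1} (\<lambda>t. (d t)\<^sup>2) = 0" .
  have "((\<lambda>t. (d t)\<^sup>2) has_integral 0) (cbox 0 1)"
    using integrable_integral[OF integrable_continuous_real[OF c]] z by simp
  from has_integral_0_cbox_imp_0[OF _ _ this, of t] have "(d t)\<^sup>2 = 0"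
    using c t by simp
  then show ?thesis by simp
qed

text \<open>Almost everywhere equality of the intermediate derivatives improves to equality on the whole interval,
because they are continuous; this makes the next derivative unique almost everywhere.\<close>

lemma iterated_ac_derivative_unique:
  assumes "(ac_derivative ^^ j) f g" "(ac_derivative ^^ j) f g'"
  shows "AE t in lborel. t \<in> {0..1} \<longrightarrow> g t = g' t"
  using assms
proof (induction j arbitrary: g g')
  case (Suc j)
  obtain h where h: "(ac_derivative ^^ j) f h" "ac_derivative h g"
    using Suc.prems(1) by (auto elim: relpowp_Suc_E)
  obtain h' where h': "(ac_derivative ^^ j) f h'" "ac_derivative h' g'"
    using Suc.prems(2) by (auto elim: relpowp_Suc_E)
  have "AE t in lborel. t \<in> {0..1} \<longrightarrow> h t - h' t = 0"
    using Suc.IH[OF h(1) h'(1)] by simp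
  moreover have "continuous_on {0..1} (\<lambda>t. h t - h' t)"
    using ac_derivative_continuous[OF h(2)] ac_derivative_continuous[OF h'(2)] by (intro continuous_intros)
  ultimately have eq: "h t - h' t = 0" if "t \<in> {0..1}" for t
    using continuous_AE_zero that by blast
  have i: "set_integrable lborel {0..1} g" "set_integrable lborel {0..1} g'"
    using h(2) h'(2) unfolding ac_derivative_def by blast+
  have "AE t in lborel. t \<in> {0..1} \<longrightarrow> g t - g' t = 0"
  proof (rule AE_zero_of_indefinite_integral_zero)
    show "set_integrable lborel {0..1} (\<lambda>t. g t - g' t)" by (rule set_integral_diff(1)[OF i])
    fix t :: real assume t: "t \<in> {0..1}"
    have it: "set_integrable lborel {0..t} g" "set_integrable lborel {0..t} g'"
      using t by (intro set_integrable_subset[OF i(1)] set_integrable_subset[OF i(2)]; simp)+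
    have "h t = h 0 + (LBINT u:{0..t}. g u)" "h' t = h' 0 + (LBINT u:{0..t}. g' u)"
      using h(2) h'(2) t unfolding ac_derivative_def by blast+
    then have "(LBINT u:{0..t}. g u - g' u) = (h t - h 0) - (h' t - h' 0)"
      unfolding set_integral_diff(2)[OF it] by simp
    also have "\<dots> = 0" using eq[OF t] eq[of 0] by simp
    finally show "(LBINT u:{0..t}. g u - g' u) = 0" .
  qed
  then show ?case by simp
qed simp

section \<open>The roughness of a trigonometric series\<close>

text \<open>The coefficient sequence is indexed from \<open>0\<close>, so \<open>a \<nu>\<close> belongs to the basis function \<open>Suc \<nu>\<close>, whose
frequency is \<open>\<nu> div 2 + 1\<close>.\<close>

definition sobolev_series :: "nat \<Rightarrow> (nat \<Rightarrow> real) \<Rightarrow> (real \<Rightarrow> real) \<Rightarrow> bool" where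
  "sobolev_series m a f \<longleftrightarrow>
     summable (\<lambda>\<nu>. (a \<nu>)\<^sup>2 * trig_eigenvalue m (Suc \<nu>)) \<and>
     (\<forall>t\<in>{0..1}. (\<lambda>\<nu>. a \<nu> * trig_basis (Suc \<nu>) t) sums f t)"

lemma periodic_sobolev_iff:
  "f \<in> periodic_sobolev m \<longleftrightarrow> f \<in> extensional {0..1} \<and> (\<exists>a. sobolev_series m a f)"
proof
  assume "f \<in> periodic_sobolev m"
  then show "f \<in> extensional {0..1} \<and> (\<exists>a. sobolev_series m a f)"
    unfolding periodic_sobolev_def sobolev_series_def by auto
next
  assume "f \<in> extensional {0..1} \<and> (\<exists>a. sobolev_series m a f)"
  then obtain a where "f \<in> extensional {0..1}" "sobolev_series m a f" by blast
  then show "f \<in> periodic_sobolev m"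
    unfolding periodic_sobolev_def sobolev_series_def by (auto intro!: exI[of _ "\<lambda>\<nu>. a (\<nu> - 1)"])
qed

text \<open>For \<open>j < m\<close> the term is at most \<open>\<bar>a\<bar> \<omega>\<^bsup>m\<^esup> \<cdot> \<omega>\<^bsup>-1\<^esup>\<close>, a product of two square summable sequences.\<close>

lemma sobolev_coefficients_summable:
  assumes a: "summable (\<lambda>\<nu>. (a \<nu>)\<^sup>2 * trig_eigenvalue m (Suc \<nu>))" and j: "j < m"
  shows "summable (\<lambda>\<nu>. \<bar>a \<nu> * angular_freq (Suc \<nu>) ^ j\<bar>)"
proof (rule summable_comparison_test'[where N = 0])
  show "summable (\<lambda>\<nu>. (a \<nu>)\<^sup>2 * trig_eigenvalue m (Suc \<nu>) + 1 / (angular_freq (Suc \<nu>))\<^sup>2)"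
    by (intro summable_add a summable_inverse_angular_freq)
  fix \<nu>
  define w where "w = angular_freq (Suc \<nu>)"
  have w: "w \<ge> 1" unfolding w_def by (rule angular_freq_Suc_ge_1)
  define x y where "x = \<bar>a \<nu>\<bar> * w ^ m" and "y = 1 / w"
  have "\<bar>a \<nu>\<bar> * w ^ j \<le> \<bar>a \<nu>\<bar> * w ^ (m - 1)"
    using w j by (intro mult_left_mono power_increasing) auto
  also have "\<dots> = x * y"
    using w j by (cases m) (auto simp: x_def y_def)
  also have "x * y \<le> x\<^sup>2 + y\<^sup>2"
  proof -
    have "0 \<le> x * y" using w by (simp add: x_def y_def)
    then show ?thesis using sum_squares_bound[of x y] by simp
  qed
  finally have "\<bar>a \<nu>\<bar> * w ^ j \<le> x\<^sup>2 + y\<^sup>2" .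
  then show "norm \<bar>a \<nu> * angular_freq (Suc \<nu>) ^ j\<bar> \<le>
      (a \<nu>)\<^sup>2 * trig_eigenvalue m (Suc \<nu>) + 1 / (angular_freq (Suc \<nu>))\<^sup>2"
    using w by (simp add: x_def y_def w_def[symmetric] trig_eigenvalue_eq abs_mult power_mult_distrib power_divide power_even_eq)
qed

lemma sobolev_series_lower_derivative:
  assumes f: "sobolev_series m a f" and j: "j < m"
  shows "\<exists>g. (ac_derivative ^^ j) f g \<and>
    (\<forall>t\<in>{0..1}. (\<lambda>\<nu>. (a \<nu> * angular_freq (Suc \<nu>) ^ j) * trig_shift j (Suc \<nu>) t) sums g t)"
  using j
proof (induction j)
  case 0
  then show ?case using f by (simp add: sobolev_series_def trig_shift_0)
next
  case (Suc j)
  then obtain g where g: "(ac_derivative ^^ j) f g"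
    "\<And>t. t \<in> {0..1} \<Longrightarrow> (\<lambda>\<nu>. (a \<nu> * angular_freq (Suc \<nu>) ^ j) * trig_shift j (Suc \<nu>) t) sums g t"
    by auto
  have s: "summable (\<lambda>\<nu>. \<bar>a \<nu> * angular_freq (Suc \<nu>) ^ j * angular_freq (Suc \<nu>)\<bar>)"
    using sobolev_coefficients_summable[of a m "Suc j"] f Suc.prems
    by (simp add: sobolev_series_def mult_ac)
  have "ac_derivative g (\<lambda>t. \<Sum>\<nu>. (a \<nu> * angular_freq (Suc \<nu>) ^ j * angular_freq (Suc \<nu>)) * trig_shift (Suc j) (Suc \<nu>) t)"
    by (rule ac_derivative_trig_series_abs[OF g(2) s])
  then have "(ac_derivative ^^ Suc j) f (\<lambda>t. \<Sum>\<nu>. (a \<nu> * angular_freq (Suc \<nu>) ^ Suc j) * trig_shift (Suc j) (Suc \<nu>) t)"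
    using relpowp_Suc_I[OF g(1)] by (simp add: mult_ac)
  moreover have "(\<lambda>\<nu>. (a \<nu> * angular_freq (Suc \<nu>) ^ Suc j) * trig_shift (Suc j) (Suc \<nu>) t) sums
      (\<Sum>\<nu>. (a \<nu> * angular_freq (Suc \<nu>) ^ Suc j) * trig_shift (Suc j) (Suc \<nu>) t)" for t
    using summable_trig_shift_series[of "\<lambda>\<nu>. a \<nu> * angular_freq (Suc \<nu>) ^ Suc j" "Suc j" t] s
    by (intro summable_sums) (simp add: mult_ac)
  ultimately show ?case by blast
qed

text \<open>The chosen \<open>m\<close>-th derivative agrees almost everywhere with the Riesz-Fischer limit of the \<open>m\<close> times
differentiated series, whose norm is known.\<close>

theorem roughness_sobolev_series:
  assumes m: "m \<ge> 1" and f: "sobolev_series m a f"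
  shows "roughness m f f = (\<Sum>\<nu>. (a \<nu>)\<^sup>2 * trig_eigenvalue m (Suc \<nu>))"
proof -
  obtain j where j: "m = Suc j" using m by (cases m) auto
  interpret e: bounded_orthonormal unit_measure "\<lambda>\<nu>. trig_shift (Suc j) (Suc \<nu>)" "sqrt 2"
    by (rule bounded_orthonormal_trig_shift)
  obtain g where g: "(ac_derivative ^^ j) f g"
    "\<And>t. t \<in> {0..1} \<Longrightarrow> (\<lambda>\<nu>. (a \<nu> * angular_freq (Suc \<nu>) ^ j) * trig_shift j (Suc \<nu>) t) sums g t"
    using sobolev_series_lower_derivative[OF f, of j] j by auto
  define b where "b \<nu> = a \<nu> * angular_freq (Suc \<nu>) ^ j * angular_freq (Suc \<nu>)" for \<nu>
  have b2: "(b \<nu>)\<^sup>2 = (a \<nu>)\<^sup>2 * trig_eigenvalue m (Suc \<nu>)" for \<nu>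
    by (simp add: b_def trig_eigenvalue_eq j power_mult_distrib power_even_eq mult.assoc power2_eq_square)
  have "summable (\<lambda>\<nu>. (b \<nu>)\<^sup>2)" using f by (simp add: b2 sobolev_series_def)
  then obtain G where G: "G \<in> borel_measurable unit_measure" "integrable unit_measure (\<lambda>t. (G t)\<^sup>2)"
    "(\<integral>t. (G t)\<^sup>2 \<partial>unit_measure) = (\<Sum>\<nu>. (b \<nu>)\<^sup>2)"
    "(\<lambda>n. \<integral>t. \<bar>G t - (\<Sum>\<nu><n. b \<nu> * trig_shift (Suc j) (Suc \<nu>) t)\<bar> \<partial>unit_measure) \<longlonglongrightarrow> 0"
    by (rule e.Riesz_Fischer)
  have "ac_derivative g G"
    by (rule ac_derivative_trig_series[OF g(2)])
       (use G e.square_integrable_imp_integrable in \<open>auto simp: b_def\<close>)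
  then have deriv: "(ac_derivative ^^ m) f G"
    unfolding j by (rule relpowp_Suc_I[OF g(1)])
  define H where "H = sobolev_deriv m f"
  have "(ac_derivative ^^ m) f H"
    unfolding H_def sobolev_deriv_def by (rule someI[of "(ac_derivative ^^ m) f" G, OF deriv])
  then have ae: "AE t in lborel. t \<in> {0..1} \<longrightarrow> H t = G t"
    using deriv by (rule iterated_ac_derivative_unique)
  have "\<exists>h. ac_derivative h H"
    using \<open>(ac_derivative ^^ m) f H\<close> unfolding j by (auto elim: relpowp_Suc_E)
  then have H: "H \<in> borel_measurable unit_measure"
    unfolding ac_derivative_def integrable_unit_measure by (blast intro: borel_measurable_integrable)
  have "roughness m f f = (\<integral>t. H t * H t \<partial>unit_measure)"
    by (simp add: roughness_def H_def integral_unit_measure)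
  also have "\<dots> = (\<integral>t. (G t)\<^sup>2 \<partial>unit_measure)"
  proof (rule Bochner_Integration.integral_cong_AE)
    have "AE t in unit_measure. H t = G t"
      unfolding unit_measure_def by (subst AE_restrict_space_iff) (use ae in auto)
    then show "AE t in unit_measure. H t * H t = (G t)\<^sup>2"
      by eventually_elim (simp add: power2_eq_square)
  qed (use H G in auto)
  finally show ?thesis by (simp add: G b2)
qed

section \<open>Aliasing\<close>

lemma cos_add_int_2pi: "cos (x + 2 * pi * of_int L) = cos (x::real)"
  using cos_int_2pin[of L] sin_int_2pin[of L] by (simp add: cos_add)

text \<open>The real part of a geometric series of powers of an \<open>n\<close>-th root of unity.\<close>

lemma sum_cos_progression:
  fixes L :: int
  assumes n: "n \<ge> 1"
  shows "(\<Sum>i<n. cos (2 * pi * of_int L * (real i / real n) + \<theta>)) = (if int n dvd L then real n * cos \<theta> else 0)"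
proof (cases "int n dvd L")
  case True
  then obtain k where k: "L = int n * k" by blast
  have "cos (2 * pi * of_int L * (real i / real n) + \<theta>) = cos \<theta>" for i
  proof -
    have "2 * pi * of_int L * (real i / real n) + \<theta> = \<theta> + 2 * pi * of_int (k * int i)"
      using n by (simp add: k field_simps)
    then show ?thesis by (simp only: cos_add_int_2pi)
  qed
  then show ?thesis using True by simp
next
  case False
  define x where "x = 2 * pi * of_int L / real n"
  define z where "z = cis x"
  have "z \<noteq> 1"
  proof
    assume "z = 1"
    then have "cos x = 1" by (simp add: z_def complex_eq_iff)
    then obtain k :: int where "x = of_int k * 2 * pi" using cos_one_2pi_int by auto
    then have "real_of_int L = real_of_int (int n * k)" using n by (simp add: x_def field_simps)
    then have "L = int n * k" by (simp only: of_int_eq_iff)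
    then show False using False by simp
  qed
  moreover have "z ^ n = 1"
  proof -
    have "z ^ n = cis (real n * x)" by (simp add: z_def Complex.DeMoivre)
    also have "real n * x = 2 * pi * of_int L" using n by (simp add: x_def)
    finally have "z ^ n = cis (2 * pi * of_int L)" .
    then show ?thesis
      using cos_int_2pin[of L] sin_int_2pin[of L] by (simp add: complex_eq_iff)
  qed
  ultimately have "(\<Sum>i<n. z ^ i) = 0" by (simp add: geometric_sum)
  then have "(\<Sum>i<n. cis \<theta> * z ^ i) = 0" by (simp flip: sum_distrib_left)
  then have "Re (\<Sum>i<n. cis \<theta> * z ^ i) = 0" by simp
  moreover have "Re (cis \<theta> * z ^ i) = cos (2 * pi * of_int L * (real i / real n) + \<theta>)" for i
    by (simp add: z_def Complex.DeMoivre cis_mult x_def mult_ac add_ac)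
  ultimately show ?thesis using False by simp
qed

text \<open>On a shifted grid the surviving terms are all equal, so any grid point \<open>i'\<close> may represent them. This
removes the offset of the machine from the formulas.\<close>

lemma sum_cos_progression_at:
  fixes L :: int
  assumes n: "n \<ge> 1"
  shows "(\<Sum>i<n. cos (2 * pi * of_int L * (real i / real n + \<delta>) + \<theta>)) =
     (if int n dvd L then real n * cos (2 * pi * of_int L * (real i' / real n + \<delta>) + \<theta>) else 0)"
proof -
  have "(\<Sum>i<n. cos (2 * pi * of_int L * (real i / real n + \<delta>) + \<theta>)) =
     (if int n dvd L then real n * cos (2 * pi * of_int L * \<delta> + \<theta>) else 0)"
    using sum_cos_progression[OF n, of L "2 * pi * of_int L * \<delta> + \<theta>"]
    by (simp add: algebra_simps)
  moreover have "cos (2 * pi * of_int L * (real i' / real n + \<delta>) + \<theta>) = cos (2 * pi * of_int L * \<delta> + \<theta>)"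
    if "int n dvd L"
  proof -
    from that obtain k where k: "L = int n * k" by blast
    have "2 * pi * of_int L * (real i' / real n + \<delta>) + \<theta> =
        (2 * pi * of_int L * \<delta> + \<theta>) + 2 * pi * of_int (k * int i')"
      using n by (simp add: k field_simps)
    then show ?thesis by (simp only: cos_add_int_2pi)
  qed
  ultimately show ?thesis by simp
qed

text \<open>Counts the signs for which \<open>k \<equiv> \<plusminus>q (mod n)\<close>, that is, how often the frequency \<open>k\<close> appears as \<open>q\<close> on a grid
of \<open>n\<close> points.\<close>

definition alias_count :: "nat \<Rightarrow> nat \<Rightarrow> nat \<Rightarrow> real" where
  "alias_count n k q = of_bool (int n dvd int k - int q) + of_bool (int n dvd int k + int q)"

lemma alias_nonneg: "0 \<le> alias_count n k q" and alias_le_2: "alias_count n k q \<le> 2"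
  by (simp_all add: alias_count_def)

lemma alias_refl: "1 \<le> alias_count n k k"
  by (simp add: alias_count_def)

lemma alias_dvd_mono: "n dvd N \<Longrightarrow> alias_count N k q \<le> alias_count n k q"
  unfolding alias_count_def by (intro add_mono) (auto simp: of_bool_def intro: dvd_trans[of "int n" "int N"])

text \<open>A cosine kernel of frequency \<open>k\<close>, averaged over the grid against a wave of frequency \<open>q\<close>, reproduces the wave
or annihilates it. This is the diagonalisation of circulant matrices, phrased so that the phase of the
wave and the offset of the grid are arbitrary.\<close>

lemma alias_average:
  assumes n: "n \<ge> 1"
  shows "(\<Sum>i<n. 2 * cos (2 * pi * real k * ((real i / real n + \<delta>) - (real i' / real n + \<delta>))) *
      cos (2 * pi * real q * (real i / real n + \<delta>) + \<theta>)) =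
    real n * (alias_count n k q * cos (2 * pi * real q * (real i' / real n + \<delta>) + \<theta>))"
proof -
  define t where "t i = real i / real n + \<delta>" for i
  define \<theta>1 \<theta>2 where "\<theta>1 = \<theta> - 2 * pi * real k * t i'" and "\<theta>2 = 2 * pi * real k * t i' + \<theta>"
  have split: "2 * cos (2 * pi * real k * (t i - t i')) * cos (2 * pi * real q * t i + \<theta>) =
      cos (2 * pi * of_int (int k + int q) * t i + \<theta>1) + cos (2 * pi * of_int (int q - int k) * t i + \<theta>2)" for i
  proof -
    define x y where "x = 2 * pi * real q * t i + \<theta>" and "y = 2 * pi * real k * (t i - t i')"
    have "2 * cos y * cos x = cos (x + y) + cos (x - y)"
      by (simp add: cos_add cos_diff)
    also have "x + y = 2 * pi * of_int (int k + int q) * t i + \<theta>1"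
      by (simp add: x_def y_def \<theta>1_def algebra_simps)
    also have "x - y = 2 * pi * of_int (int q - int k) * t i + \<theta>2"
      by (simp add: x_def y_def \<theta>2_def algebra_simps)
    finally show ?thesis by (simp add: x_def y_def)
  qed
  have "(\<Sum>i<n. 2 * cos (2 * pi * real k * (t i - t i')) * cos (2 * pi * real q * t i + \<theta>)) =
      (\<Sum>i<n. cos (2 * pi * of_int (int k + int q) * t i + \<theta>1)) +
      (\<Sum>i<n. cos (2 * pi * of_int (int q - int k) * t i + \<theta>2))"
    by (simp only: split sum.distrib)
  also have "(\<Sum>i<n. cos (2 * pi * of_int (int k + int q) * t i + \<theta>1)) =
      (if int n dvd int k + int q then real n * cos (2 * pi * of_int (int k + int q) * t i' + \<theta>1) else 0)"
    unfolding t_def by (rule sum_cos_progression_at[OF n])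
  also have "(\<Sum>i<n. cos (2 * pi * of_int (int q - int k) * t i + \<theta>2)) =
      (if int n dvd int q - int k then real n * cos (2 * pi * of_int (int q - int k) * t i' + \<theta>2) else 0)"
    unfolding t_def by (rule sum_cos_progression_at[OF n])
  also have "2 * pi * of_int (int k + int q) * t i' + \<theta>1 = 2 * pi * real q * t i' + \<theta>"
    by (simp add: \<theta>1_def algebra_simps)
  also have "2 * pi * of_int (int q - int k) * t i' + \<theta>2 = 2 * pi * real q * t i' + \<theta>"
    by (simp add: \<theta>2_def algebra_simps)
  also have "int n dvd int q - int k \<longleftrightarrow> int n dvd int k - int q"
    by (rule dvd_diff_commute)
  finally show ?thesis by (simp add: t_def alias_count_def distrib_left distrib_right)
qed

lemma trig_basis_cos:
  "trig_basis (Suc \<nu>) t = sqrt 2 * cos (2 * pi * real (Suc (\<nu> div 2)) * t + trig_phase 0 (Suc \<nu>))"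
proof -
  have "(Suc \<nu> + 1) div 2 = Suc (\<nu> div 2)" by simp
  then show ?thesis
    by (simp only: trig_shift_0[symmetric] trig_shift_def angular_freq_def)
qed

lemma alias_average_trig_basis:
  assumes n: "n \<ge> 1"
  shows "(\<Sum>i<n. 2 * cos (2 * pi * real k * ((real i / real n + \<delta>) - (real i' / real n + \<delta>))) *
      trig_basis (Suc \<nu>) (real i / real n + \<delta>)) =
    real n * (alias_count n k (Suc (\<nu> div 2)) * trig_basis (Suc \<nu>) (real i' / real n + \<delta>))"
  using alias_average[OF n, of k \<delta> i' "Suc (\<nu> div 2)" "trig_phase 0 (Suc \<nu>)"]
  by (simp add: trig_basis_cos mult.left_commute[of _ "sqrt 2"] flip: sum_distrib_left del: of_nat_Suc)

section \<open>Expansion of translation-invariant kernels\<close>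

lemma trig_basis_pair:
  "trig_basis (Suc (2 * k)) s * trig_basis (Suc (2 * k)) t
     + trig_basis (Suc (2 * k + 1)) s * trig_basis (Suc (2 * k + 1)) t
   = 2 * cos (2 * pi * real (Suc k) * (s - t))"
proof -
  define x y where "x = 2 * pi * real (Suc k) * s" and "y = 2 * pi * real (Suc k) * t"
  have "trig_basis (Suc (2 * k)) u = sqrt 2 * cos (2 * pi * real (Suc k) * u)"
    and "trig_basis (Suc (2 * k + 1)) u = sqrt 2 * sin (2 * pi * real (Suc k) * u)" for u
    by (simp_all add: trig_basis_def)
  then have "trig_basis (Suc (2 * k)) s * trig_basis (Suc (2 * k)) t
     + trig_basis (Suc (2 * k + 1)) s * trig_basis (Suc (2 * k + 1)) t
     = (sqrt 2 * sqrt 2) * (cos x * cos y + sin x * sin y)"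
    by (simp only: x_def y_def) (simp only: algebra_simps)
  also have "\<dots> = 2 * cos (x - y)" by (simp add: cos_diff)
  also have "x - y = 2 * pi * real (Suc k) * (s - t)" by (simp only: x_def y_def right_diff_distrib)
  finally show ?thesis .
qed

lemma summable_doubled:
  fixes x :: "nat \<Rightarrow> real"
  assumes "summable x" "\<And>k. 0 \<le> x k"
  shows "summable (\<lambda>\<nu>. x (\<nu> div 2))"
proof (rule bounded_imp_summable)
  show "0 \<le> x (\<nu> div 2)" for \<nu> by (rule assms)
  fix n
  have "(\<Sum>\<nu>\<le>n. x (\<nu> div 2)) \<le> (\<Sum>\<nu><Suc n * 2. x (\<nu> div 2))"
    by (intro sum_mono2) (auto simp: assms)
  also have "\<dots> = (\<Sum>k<Suc n. \<Sum>\<nu>\<in>{k * 2..<k * 2 + 2}. x (\<nu> div 2))"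
    by (rule sum.nat_group[symmetric])
  also have "\<dots> = (\<Sum>k<Suc n. 2 * x k)"
  proof (intro sum.cong refl)
    fix k :: nat
    have "{k * 2..<k * 2 + 2} = {2 * k, 2 * k + 1}" by auto
    then show "(\<Sum>\<nu>\<in>{k * 2..<k * 2 + 2}. x (\<nu> div 2)) = 2 * x k" by simp
  qed
  also have "\<dots> \<le> (\<Sum>k. 2 * x k)"
    using assms by (intro sum_le_suminf summable_mult) auto
  finally show "(\<Sum>\<nu>\<le>n. x (\<nu> div 2)) \<le> (\<Sum>k. 2 * x k)" .
qed

lemma suminf_pairs:
  fixes f :: "nat \<Rightarrow> real"
  assumes "summable f"
  shows "(\<lambda>k. f (2 * k) + f (2 * k + 1)) sums (\<Sum>\<nu>. f \<nu>)"
proof -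
  have "(\<lambda>k. sum f {k * 2..<k * 2 + 2}) sums (\<Sum>\<nu>. f \<nu>)"
    by (rule sums_group[OF summable_sums[OF assms]]) simp
  moreover have "sum f {k * 2..<k * 2 + 2} = f (2 * k) + f (2 * k + 1)" for k
  proof -
    have "{k * 2..<k * 2 + 2} = {2 * k, 2 * k + 1}" by auto
    then show ?thesis by simp
  qed
  ultimately show ?thesis by simp
qed

lemma abs_trig_basis_le: "\<bar>trig_basis \<nu> t\<bar> \<le> sqrt 2"
  using abs_trig_shift_le[of 0 \<nu> t] by (simp add: trig_shift_0)

text \<open>Only the sum over a sine-cosine pair depends on \<open>s - t\<close> alone, hence the grouping of consecutive indices.\<close>

lemma kernel_expansion:
  fixes x :: "nat \<Rightarrow> real"
  assumes x: "summable x" "\<And>k. 0 \<le> x k"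
  shows "summable (\<lambda>\<nu>. x (\<nu> div 2) * (trig_basis (Suc \<nu>) s * trig_basis (Suc \<nu>) t))"
    and "(\<Sum>\<nu>. x (\<nu> div 2) * (trig_basis (Suc \<nu>) s * trig_basis (Suc \<nu>) t)) =
      (\<Sum>k. x k * (2 * cos (2 * pi * real (Suc k) * (s - t))))"
proof -
  show s: "summable (\<lambda>\<nu>. x (\<nu> div 2) * (trig_basis (Suc \<nu>) s * trig_basis (Suc \<nu>) t))"
  proof (rule summable_comparison_test'[where N = 0])
    show "summable (\<lambda>\<nu>. x (\<nu> div 2) * 2)"
      by (intro summable_mult2 summable_doubled x)
    fix \<nu>
    have "\<bar>trig_basis (Suc \<nu>) s * trig_basis (Suc \<nu>) t\<bar> \<le> sqrt 2 * sqrt 2"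
      unfolding abs_mult by (intro mult_mono abs_trig_basis_le) auto
    then show "norm (x (\<nu> div 2) * (trig_basis (Suc \<nu>) s * trig_basis (Suc \<nu>) t)) \<le> x (\<nu> div 2) * 2"
      using x(2)[of "\<nu> div 2"] by (simp add: abs_mult[of "x _"] mult_left_mono)
  qed
  show "(\<Sum>\<nu>. x (\<nu> div 2) * (trig_basis (Suc \<nu>) s * trig_basis (Suc \<nu>) t)) =
      (\<Sum>k. x k * (2 * cos (2 * pi * real (Suc k) * (s - t))))"
    using sums_unique[OF suminf_pairs[OF s]] trig_basis_pair[of _ s t]
    by (simp flip: distrib_left del: of_nat_Suc mult_Suc_right)
qed

section \<open>The penalised least squares problem\<close>

definition eigenval :: "nat \<Rightarrow> nat \<Rightarrow> real" where
  "eigenval m k = (2 * pi * real (Suc k)) ^ (2 * m)"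

lemma trig_eigenvalue_Suc: "trig_eigenvalue m (Suc \<nu>) = eigenval m (\<nu> div 2)"
proof -
  have "(Suc \<nu> + 1) div 2 = Suc (\<nu> div 2)" by simp
  then show ?thesis by (simp only: trig_eigenvalue_def eigenval_def)
qed

lemma eigenval_pos: "0 < eigenval m k"
  by (simp add: eigenval_def)

lemma summable_inverse_eigenval:
  assumes "m \<ge> 1"
  shows "summable (\<lambda>k. 1 / eigenval m k)"
proof (rule summable_comparison_test'[where N = 0])
  show "summable (\<lambda>k. 1 / (real (Suc k))\<^sup>2)"
    by (rule summable_inverse_Suc_square)
  fix k
  have a: "real (Suc k) \<le> 2 * pi * real (Suc k)"
    using mult_right_mono[of 1 "2 * pi" "real (Suc k)"] pi_gt3 by simp
  have "(real (Suc k))\<^sup>2 \<le> (2 * pi * real (Suc k))\<^sup>2"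
    by (intro power_mono a) auto
  also have "\<dots> \<le> eigenval m k"
    unfolding eigenval_def
  proof (rule power_increasing)
    show "1 \<le> 2 * pi * real (Suc k)" using a by (rule order_trans[rotated]) simp
  qed (use assms in auto)
  finally show "norm (1 / eigenval m k) \<le> 1 / (real (Suc k))\<^sup>2"
    using eigenval_pos[of m k] by (simp add: frac_le del: of_nat_Suc)
qed

text \<open>The eigenvalue, at frequency \<open>q\<close>, of the reproducing kernel matrix of \<open>n\<close> equally spaced points, divided
by \<open>n\<close>.\<close>

definition folded_sum :: "nat \<Rightarrow> nat \<Rightarrow> nat \<Rightarrow> real" where
  "folded_sum m n q = (\<Sum>k. alias_count n (Suc k) q / eigenval m k)"

definition shrinkage :: "nat \<Rightarrow> real \<Rightarrow> nat \<Rightarrow> nat \<Rightarrow> real" where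
  "shrinkage m lam n k = 1 / (eigenval m k * (lam + folded_sum m n (Suc k)))"

lemma summable_folded:
  assumes "m \<ge> 1"
  shows "summable (\<lambda>k. alias_count n (Suc k) q / eigenval m k)"
  by (rule summable_comparison_test'[OF summable_mult[OF summable_inverse_eigenval[OF assms], of 2], where N = 0])
     (use alias_nonneg alias_le_2 eigenval_pos in \<open>auto simp: abs_of_pos divide_right_mono less_imp_le\<close>)

lemma folded_sum_nonneg: "m \<ge> 1 \<Longrightarrow> 0 \<le> folded_sum m n q"
  unfolding folded_sum_def
  by (intro suminf_nonneg summable_folded divide_nonneg_pos alias_nonneg eigenval_pos)

lemma folded_sum_ge_term:
  assumes "m \<ge> 1"
  shows "alias_count n (Suc k) q / eigenval m k \<le> folded_sum m n q"
proof -
  have "(\<Sum>j\<in>{k}. alias_count n (Suc j) q / eigenval m j) \<le> folded_sum m n q"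
    unfolding folded_sum_def
    by (rule sum_le_suminf[OF summable_folded[OF assms]])
       (auto simp: alias_nonneg eigenval_pos less_imp_le)
  then show ?thesis by simp
qed

lemma folded_sum_alias:
  assumes "alias_count n p q \<noteq> 0"
  shows "folded_sum m n p = folded_sum m n q"
proof -
  have pq: "int n dvd int p - int q \<or> int n dvd int p + int q"
    using assms by (auto simp: alias_count_def)
  have "alias_count n k p = alias_count n k q" for k
    using pq
  proof
    assume "int n dvd int p - int q"
    then obtain c where "int p = int q + int n * c" by (auto simp: dvd_def algebra_simps)
    then have "int k - int p = (int k - int q) + int n * (- c)" "int k + int p = (int k + int q) + int n * c" by simp_all
    then show ?thesis unfolding alias_count_def by (simp only: dvd_add_times_triv_right_iff mult.commute[of "int n"])
  next
    assume "int n dvd int p + int q"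
    then obtain c where "int p = - int q + int n * c" by (auto simp: dvd_def algebra_simps)
    then have "int k - int p = (int k + int q) + int n * (- c)" "int k + int p = (int k - int q) + int n * c" by simp_all
    then show ?thesis unfolding alias_count_def
      by (simp only: dvd_add_times_triv_right_iff mult.commute[of "int n"])
  qed
  then show ?thesis by (simp add: folded_sum_def)
qed

context
  fixes m n :: nat and lam :: real
  assumes m: "m \<ge> 1" and lam: "lam > 0"
begin

lemma denom_pos: "0 < lam + folded_sum m n q"
  using lam folded_sum_nonneg[OF m, of n q] by linarith

lemma shrinkage_pos: "0 < shrinkage m lam n k"
  unfolding shrinkage_def using denom_pos eigenval_pos by simp

text \<open>The class of \<open>k\<close> contains \<open>k\<close> itself, so \<open>\<rho>\<^sub>k S\<^sub>k \<ge> 1\<close>.\<close>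

lemma shrinkage_le_1: "shrinkage m lam n k \<le> 1"
proof -
  have "1 / eigenval m k \<le> alias_count n (Suc k) (Suc k) / eigenval m k"
    using alias_refl eigenval_pos by (intro divide_right_mono) (auto intro: less_imp_le)
  also have "\<dots> \<le> folded_sum m n (Suc k)" by (rule folded_sum_ge_term[OF m])
  finally have "1 \<le> eigenval m k * (lam + folded_sum m n (Suc k))"
    using lam eigenval_pos[of m k] by (simp add: field_simps add_increasing)
  then show ?thesis by (simp add: shrinkage_def)
qed

lemma shrinkage_le: "shrinkage m lam n k \<le> (1 / lam) * (1 / eigenval m k)"
  unfolding shrinkage_def
  using lam eigenval_pos[of m k] folded_sum_nonneg[OF m, of n "Suc k"]
  by (simp add: frac_le mult_left_mono mult.commute)

lemma summable_shrinkage: "summable (shrinkage m lam n)"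
  by (rule summable_comparison_test'[OF summable_mult[OF summable_inverse_eigenval[OF m], of "1 / lam"], where N = 0])
     (use shrinkage_le shrinkage_pos in \<open>auto simp: abs_of_pos\<close>)

text \<open>The denominator is constant on an aliasing class; this is why the normal equations decouple.\<close>

lemma shrinkage_alias:
  "shrinkage m lam n k * alias_count n (Suc k) q = (alias_count n (Suc k) q / eigenval m k) / (lam + folded_sum m n q)"
  using folded_sum_alias[of n "Suc k" q m] by (cases "alias_count n (Suc k) q = 0") (simp_all add: shrinkage_def)

lemma
  shows summable_shrinkage_alias: "summable (\<lambda>k. shrinkage m lam n k * alias_count n (Suc k) q)"
    and suminf_shrinkage_alias:
      "(\<Sum>k. shrinkage m lam n k * alias_count n (Suc k) q) = folded_sum m n q / (lam + folded_sum m n q)"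
proof -
  show "summable (\<lambda>k. shrinkage m lam n k * alias_count n (Suc k) q)"
    unfolding shrinkage_alias by (rule summable_divide[OF summable_folded[OF m]])
  show "(\<Sum>k. shrinkage m lam n k * alias_count n (Suc k) q) = folded_sum m n q / (lam + folded_sum m n q)"
    unfolding shrinkage_alias suminf_divide[OF summable_folded[OF m]] folded_sum_def ..
qed

end

lemma variation_identity:
  fixes l :: real
  assumes "l * X = 2 * c * V" "ZG = ZF - 2 * V + DD" "RG = RB" "RF = RA" "2 * X = RB - RA - RD"
  shows "c * ZG + l / 2 * RG = c * ZF + l / 2 * RF + c * DD + l / 2 * RD"
proof -
  have "RB = RA + RD + 2 * X" using assms(5) by simp
  then have "l / 2 * RB = l / 2 * RA + l / 2 * RD + l * X" by (simp add: algebra_simps)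
  then show ?thesis unfolding assms(1-4) by (simp add: algebra_simps)
qed

text \<open>The objective is a quadratic functional. If its first variation at \<open>f\<close> vanishes on each basis function, then
the increment from \<open>f\<close> to \<open>g\<close> is a sum of squares, which is positive unless all coefficients of \<open>g - f\<close>
vanish.\<close>

lemma strict_minimiser:
  assumes m: "m \<ge> 1" and lam: "lam > 0" and n: "n \<ge> 1"
    and f: "sobolev_series m a f" "f \<in> extensional {0..1}"
    and pts: "\<And>i. i \<in> {1..n} \<Longrightarrow> real (sample_index s i j) / real (s * n) \<in> {0..1}"
    and normal_eq: "\<And>\<nu>. lam * trig_eigenvalue m (Suc \<nu>) * a \<nu> =
       1 / real n * (\<Sum>i=1..n. (y (sample_index s i j) - f (real (sample_index s i j) / real (s * n)))
          * trig_basis (Suc \<nu>) (real (sample_index s i j) / real (s * n)))"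
    and g: "g \<in> periodic_sobolev m" "g \<noteq> f"
  shows "sub_objective m lam n s y j f < sub_objective m lam n s y j g"
proof -
  define t where "t i = real (sample_index s i j) / real (s * n)" for i
  define z where "z i = y (sample_index s i j)" for i
  define r where "r i = z i - f (t i)" for i
  define \<gamma> where "\<gamma> \<nu> = trig_eigenvalue m (Suc \<nu>)" for \<nu>
  have \<gamma>: "0 < \<gamma> \<nu>" for \<nu> by (simp add: \<gamma>_def trig_eigenvalue_Suc eigenval_pos)
  have tI: "t i \<in> {0..1}" if "i \<in> {1..n}" for i using pts[OF that] by (simp add: t_def)
  obtain b where b: "sobolev_series m b g" and gext: "g \<in> extensional {0..1}"
    using g(1) by (auto simp: periodic_sobolev_iff)
  define d where "d \<nu> = b \<nu> - a \<nu>" for \<nu>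
  have sa: "summable (\<lambda>\<nu>. (a \<nu>)\<^sup>2 * \<gamma> \<nu>)" and sb: "summable (\<lambda>\<nu>. (b \<nu>)\<^sup>2 * \<gamma> \<nu>)"
    using f(1) b by (simp_all add: sobolev_series_def \<gamma>_def)
  have sd: "summable (\<lambda>\<nu>. (d \<nu>)\<^sup>2 * \<gamma> \<nu>)"
  proof (rule summable_comparison_test'[where N = 0])
    show "summable (\<lambda>\<nu>. 2 * ((a \<nu>)\<^sup>2 * \<gamma> \<nu>) + 2 * ((b \<nu>)\<^sup>2 * \<gamma> \<nu>))"
      by (intro summable_add summable_mult sa sb)
    fix \<nu>
    have "2 * (a \<nu>)\<^sup>2 + 2 * (b \<nu>)\<^sup>2 - (d \<nu>)\<^sup>2 = (a \<nu> + b \<nu>)\<^sup>2"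
      by (simp add: d_def power2_eq_square algebra_simps)
    then have "(d \<nu>)\<^sup>2 \<le> 2 * (a \<nu>)\<^sup>2 + 2 * (b \<nu>)\<^sup>2"
      using zero_le_power2[of "a \<nu> + b \<nu>"] by linarith
    from mult_right_mono[OF this, of "\<gamma> \<nu>"] \<gamma>[of \<nu>]
    show "norm ((d \<nu>)\<^sup>2 * \<gamma> \<nu>) \<le> 2 * ((a \<nu>)\<^sup>2 * \<gamma> \<nu>) + 2 * ((b \<nu>)\<^sup>2 * \<gamma> \<nu>)"
      by (simp add: algebra_simps)
  qed
  have cross_term: "a \<nu> * d \<nu> * \<gamma> \<nu> = ((b \<nu>)\<^sup>2 * \<gamma> \<nu> - (a \<nu>)\<^sup>2 * \<gamma> \<nu> - (d \<nu>)\<^sup>2 * \<gamma> \<nu>) / 2" for \<nu>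
    by (simp add: d_def power2_eq_square algebra_simps)
  have sx: "summable (\<lambda>\<nu>. a \<nu> * d \<nu> * \<gamma> \<nu>)"
    unfolding cross_term by (intro summable_divide summable_diff sa sb sd)
  have cross: "2 * (\<Sum>\<nu>. a \<nu> * d \<nu> * \<gamma> \<nu>) =
      (\<Sum>\<nu>. (b \<nu>)\<^sup>2 * \<gamma> \<nu>) - (\<Sum>\<nu>. (a \<nu>)\<^sup>2 * \<gamma> \<nu>) - (\<Sum>\<nu>. (d \<nu>)\<^sup>2 * \<gamma> \<nu>)"
    unfolding cross_term suminf_divide[OF summable_diff[OF summable_diff[OF sb sa] sd]]
      suminf_diff[OF summable_diff[OF sb sa] sd, symmetric] suminf_diff[OF sb sa, symmetric] by simp
  have D: "(\<lambda>\<nu>. d \<nu> * trig_basis (Suc \<nu>) x) sums (g x - f x)" if "x \<in> {0..1}" for x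
    using sums_diff[of _ "g x" _ "f x"] b f(1) that
    by (simp add: sobolev_series_def d_def left_diff_distrib)
  \<comment> \<open>The normal equations say that the first variation of the objective vanishes.\<close>
  have first_variation: "lam * (\<Sum>\<nu>. a \<nu> * d \<nu> * \<gamma> \<nu>) = 2 * (1 / (2 * real n)) * (\<Sum>i=1..n. r i * (g (t i) - f (t i)))"
  proof -
    have "(\<lambda>\<nu>. lam * (a \<nu> * d \<nu> * \<gamma> \<nu>)) sums (lam * (\<Sum>\<nu>. a \<nu> * d \<nu> * \<gamma> \<nu>))"
      by (intro sums_mult summable_sums sx)
    moreover have "(\<lambda>\<nu>. 1 / real n * (\<Sum>i=1..n. r i * (d \<nu> * trig_basis (Suc \<nu>) (t i)))) sums
       (1 / real n * (\<Sum>i=1..n. r i * (g (t i) - f (t i))))"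
      by (intro sums_mult sums_sum D tI)
    moreover have "lam * (a \<nu> * d \<nu> * \<gamma> \<nu>) = 1 / real n * (\<Sum>i=1..n. r i * (d \<nu> * trig_basis (Suc \<nu>) (t i)))" for \<nu>
    proof -
      have "lam * (a \<nu> * d \<nu> * \<gamma> \<nu>) = (lam * \<gamma> \<nu> * a \<nu>) * d \<nu>" by (simp add: mult_ac)
      also have "lam * \<gamma> \<nu> * a \<nu> = 1 / real n * (\<Sum>i=1..n. r i * trig_basis (Suc \<nu>) (t i))"
        using normal_eq[of \<nu>] by (simp add: \<gamma>_def r_def z_def t_def)
      finally show ?thesis by (simp only: sum_distrib_left sum_distrib_right mult_ac)
    qed
    ultimately show ?thesis by (simp add: sums_unique2)
  qed
  have residuals: "(\<Sum>i=1..n. (z i - g (t i))\<^sup>2) = (\<Sum>i=1..n. (z i - f (t i))\<^sup>2)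
      - 2 * (\<Sum>i=1..n. r i * (g (t i) - f (t i))) + (\<Sum>i=1..n. (g (t i) - f (t i))\<^sup>2)"
    unfolding sum_distrib_left sum_subtractf[symmetric] sum.distrib[symmetric]
    by (intro sum.cong refl) (simp add: r_def power2_eq_square algebra_simps)
  have rough: "roughness m g g = (\<Sum>\<nu>. (b \<nu>)\<^sup>2 * \<gamma> \<nu>)" "roughness m f f = (\<Sum>\<nu>. (a \<nu>)\<^sup>2 * \<gamma> \<nu>)"
    unfolding \<gamma>_def by (rule roughness_sobolev_series[OF m], fact)+
  have diff: "sub_objective m lam n s y j g = sub_objective m lam n s y j f
     + 1 / (2 * real n) * (\<Sum>i=1..n. (g (t i) - f (t i))\<^sup>2) + lam / 2 * (\<Sum>\<nu>. (d \<nu>)\<^sup>2 * \<gamma> \<nu>)"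
    unfolding sub_objective_def t_def[symmetric] z_def[symmetric]
    by (rule variation_identity[OF first_variation residuals rough cross])
  have "\<exists>\<nu>. d \<nu> \<noteq> 0"
  proof (rule ccontr)
    assume "\<not> ?thesis"
    then have "(\<lambda>\<nu>. 0) sums (g x - f x)" if "x \<in> {0..1}" for x
      using D[OF that] by simp
    then have "g x - f x = 0" if "x \<in> {0..1}" for x
      using that sums_unique2[OF _ sums_zero] by blast
    then have "g = f" using gext f(2) by (intro extensionalityI[of _ "{0..1}"]) auto
    with g(2) show False by simp
  qed
  then obtain \<nu> where "d \<nu> \<noteq> 0" by blast
  then have "0 < (\<Sum>\<nu>. (d \<nu>)\<^sup>2 * \<gamma> \<nu>)"
    using \<gamma> by (intro suminf_pos2[OF sd, of \<nu>]) (simp_all add: less_imp_le)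
  then have "0 < lam / 2 * (\<Sum>\<nu>. (d \<nu>)\<^sup>2 * \<gamma> \<nu>)" using lam by simp
  moreover have "0 \<le> 1 / (2 * real n) * (\<Sum>i=1..n. (g (t i) - f (t i))\<^sup>2)" by (intro mult_nonneg_nonneg sum_nonneg) auto
  ultimately show ?thesis unfolding diff by linarith
qed

definition local_fourier :: "nat \<Rightarrow> nat \<Rightarrow> (nat \<Rightarrow> real) \<Rightarrow> nat \<Rightarrow> nat \<Rightarrow> real" where
  "local_fourier n s y j \<nu> = 1 / real n *
     (\<Sum>i=1..n. y (sample_index s i j) * trig_basis (Suc \<nu>) (real (sample_index s i j) / real (s * n)))"

definition ridge_coeff :: "nat \<Rightarrow> real \<Rightarrow> nat \<Rightarrow> nat \<Rightarrow> (nat \<Rightarrow> real) \<Rightarrow> nat \<Rightarrow> nat \<Rightarrow> real" where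
  "ridge_coeff m lam n s y j \<nu> = shrinkage m lam n (\<nu> div 2) * local_fourier n s y j \<nu>"

definition ridge_fit :: "nat \<Rightarrow> real \<Rightarrow> nat \<Rightarrow> nat \<Rightarrow> (nat \<Rightarrow> real) \<Rightarrow> nat \<Rightarrow> real \<Rightarrow> real" where
  "ridge_fit m lam n s y j = (\<lambda>t\<in>{0..1}. \<Sum>\<nu>. ridge_coeff m lam n s y j \<nu> * trig_basis (Suc \<nu>) t)"

lemma sample_point:
  assumes "n \<ge> 1" "s \<ge> 1" "j \<ge> 1"
  shows "real (sample_index s (Suc i) j) / real (s * n) = real i / real n + real (j - 1) / real (s * n)"
proof -
  have "sample_index s (Suc i) j = i * s + (j - 1)" using assms by (simp add: sample_index_def)
  then show ?thesis using assms by (simp add: field_simps)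
qed

lemma sample_index_less:
  assumes "i < n" "j \<ge> 1" "j \<le> s"
  shows "sample_index s (Suc i) j < s * n"
proof -
  have "sample_index s (Suc i) j = i * s + (j - 1)" using assms by (simp add: sample_index_def)
  also have "\<dots> < Suc i * s" using assms by simp
  also have "\<dots> \<le> n * s" using assms by (intro mult_right_mono) auto
  finally show ?thesis by (simp add: mult.commute)
qed

lemma summable_abs_bounded_mult:
  fixes x c :: "nat \<Rightarrow> real"
  assumes "summable x" "\<And>\<nu>. 0 \<le> x \<nu>" "\<And>\<nu>. \<bar>c \<nu>\<bar> \<le> C"
  shows "summable (\<lambda>\<nu>. \<bar>x \<nu> * c \<nu>\<bar>)"
  by (rule summable_comparison_test'[OF summable_mult2[OF assms(1), of C], where N = 0])
     (use assms in \<open>auto simp: abs_mult intro!: mult_left_mono\<close>)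

lemma local_fourier_bounded: "\<exists>C. \<forall>\<nu>. \<bar>local_fourier n s y j \<nu>\<bar> \<le> C"
proof (intro exI allI)
  fix \<nu>
  have "\<bar>\<Sum>i=1..n. y (sample_index s i j) * trig_basis (Suc \<nu>) (real (sample_index s i j) / real (s * n))\<bar>
     \<le> (\<Sum>i=1..n. \<bar>y (sample_index s i j)\<bar> * sqrt 2)"
    by (rule order_trans[OF sum_abs]) (auto intro!: sum_mono mult_left_mono abs_trig_basis_le simp: abs_mult)
  then show "\<bar>local_fourier n s y j \<nu>\<bar> \<le> 1 / real n * (\<Sum>i=1..n. \<bar>y (sample_index s i j)\<bar> * sqrt 2)"
    unfolding local_fourier_def abs_mult by (intro mult_mono) auto
qed

context
  fixes m n s :: nat and lam :: real and y :: "nat \<Rightarrow> real" and j :: nat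
  assumes m: "m \<ge> 1" and lam: "lam > 0" and n: "n \<ge> 1" and s: "s \<ge> 1" and j: "1 \<le> j" "j \<le> s"
begin

lemma sample_point_unit: "i \<in> {1..n} \<Longrightarrow> real (sample_index s i j) / real (s * n) \<in> {0..1}"
  using sample_index_less[of "i - 1" n j s] j n s
  by (auto simp: field_simps simp flip: of_nat_mult intro: less_imp_le)

lemma summable_ridge_coeff: "summable (\<lambda>\<nu>. \<bar>ridge_coeff m lam n s y j \<nu>\<bar>)"
proof -
  obtain C where "\<And>\<nu>. \<bar>local_fourier n s y j \<nu>\<bar> \<le> C" using local_fourier_bounded by blast
  then show ?thesis
    unfolding ridge_coeff_def
    by (intro summable_abs_bounded_mult summable_doubled summable_shrinkage[OF m lam])
       (auto intro: less_imp_le shrinkage_pos[OF m lam])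
qed

lemma ridge_fit_series:
  "sobolev_series m (ridge_coeff m lam n s y j) (ridge_fit m lam n s y j)"
  unfolding sobolev_series_def
proof (intro conjI ballI)
  obtain C where C: "\<And>\<nu>. \<bar>local_fourier n s y j \<nu>\<bar> \<le> C" using local_fourier_bounded by blast
  show "summable (\<lambda>\<nu>. (ridge_coeff m lam n s y j \<nu>)\<^sup>2 * trig_eigenvalue m (Suc \<nu>))"
  proof (rule summable_comparison_test'[where N = 0])
    show "summable (\<lambda>\<nu>. shrinkage m lam n (\<nu> div 2) * (C\<^sup>2 / lam))"
      by (intro summable_mult2 summable_doubled summable_shrinkage[OF m lam])
         (auto intro: less_imp_le shrinkage_pos[OF m lam])
    fix \<nu>
    define w where "w = shrinkage m lam n (\<nu> div 2)"
    have w: "0 < w" "w * eigenval m (\<nu> div 2) \<le> 1 / lam"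
      using shrinkage_pos[OF m lam] eigenval_pos[of m "\<nu> div 2"]
        mult_right_mono[OF shrinkage_le[OF m lam, of n "\<nu> div 2"], of "eigenval m (\<nu> div 2)"]
      by (simp_all add: w_def)
    have "(ridge_coeff m lam n s y j \<nu>)\<^sup>2 * trig_eigenvalue m (Suc \<nu>)
        = w * ((w * eigenval m (\<nu> div 2)) * (local_fourier n s y j \<nu>)\<^sup>2)"
      by (simp add: ridge_coeff_def w_def trig_eigenvalue_Suc power2_eq_square mult_ac)
    also have "\<dots> \<le> w * (1 / lam * C\<^sup>2)"
      using w C[of \<nu>] lam eigenval_pos[of m "\<nu> div 2"]
      by (intro mult_left_mono mult_mono abs_le_square_iff[THEN iffD1]) auto
    finally show "norm ((ridge_coeff m lam n s y j \<nu>)\<^sup>2 * trig_eigenvalue m (Suc \<nu>))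
        \<le> shrinkage m lam n (\<nu> div 2) * (C\<^sup>2 / lam)"
      using eigenval_pos[of m "\<nu> div 2"] by (simp add: w_def trig_eigenvalue_Suc)
  qed
  fix t :: real assume t: "t \<in> {0..1}"
  have "summable (\<lambda>\<nu>. ridge_coeff m lam n s y j \<nu> * trig_basis (Suc \<nu>) t)"
    using summable_trig_shift_series[OF summable_ridge_coeff, of 0 t] by (simp add: trig_shift_0)
  then show "(\<lambda>\<nu>. ridge_coeff m lam n s y j \<nu> * trig_basis (Suc \<nu>) t) sums ridge_fit m lam n s y j t"
    using t by (simp add: ridge_fit_def summable_sums)
qed

text \<open>The fit at \<open>t\<close> as a combination of translates of one even kernel, to which the averaging of cosine kernels
over the grid applies.\<close>

lemma ridge_fit_kernel:
  assumes t: "t \<in> {0..1}"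
  shows "(\<lambda>k. 1 / real n * (\<Sum>i=1..n. y (sample_index s i j) *
       (shrinkage m lam n k * (2 * cos (2 * pi * real (Suc k) * (t - real (sample_index s i j) / real (s * n)))))))
     sums ridge_fit m lam n s y j t"
proof -
  note w = summable_shrinkage[OF m lam, of n] less_imp_le[OF shrinkage_pos[OF m lam, of n]]
  define p where "p i = real (sample_index s i j) / real (s * n)" for i
  define K where "K u = (\<Sum>k. shrinkage m lam n k * (2 * cos (2 * pi * real (Suc k) * (t - u))))" for u
  have sK: "(\<lambda>k. shrinkage m lam n k * (2 * cos (2 * pi * real (Suc k) * (t - u)))) sums K u" for u
  proof -
    have "summable (\<lambda>k. shrinkage m lam n k * (2 * cos (2 * pi * real (Suc k) * (t - u))))"
      by (rule summable_rabs_cancel, rule summable_abs_bounded_mult[OF w, where C = 2]) (simp add: abs_mult)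
    then show ?thesis by (simp add: K_def summable_sums)
  qed
  have "(\<lambda>\<nu>. shrinkage m lam n (\<nu> div 2) * (trig_basis (Suc \<nu>) t * trig_basis (Suc \<nu>) u)) sums K u" for u
    using summable_sums[OF kernel_expansion(1)[OF w, of t u]] kernel_expansion(2)[OF w, of t u] by (simp only: K_def)
  then have "(\<lambda>\<nu>. 1 / real n * (\<Sum>i=1..n. y (sample_index s i j) *
      (shrinkage m lam n (\<nu> div 2) * (trig_basis (Suc \<nu>) t * trig_basis (Suc \<nu>) (p i)))))
      sums (1 / real n * (\<Sum>i=1..n. y (sample_index s i j) * K (p i)))"
    by (intro sums_mult sums_sum)
  moreover have "1 / real n * (\<Sum>i=1..n. y (sample_index s i j) *
      (shrinkage m lam n (\<nu> div 2) * (trig_basis (Suc \<nu>) t * trig_basis (Suc \<nu>) (p i))))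
      = ridge_coeff m lam n s y j \<nu> * trig_basis (Suc \<nu>) t" for \<nu>
    by (simp add: ridge_coeff_def local_fourier_def p_def sum_distrib_left sum_distrib_right mult_ac)
  ultimately have "(\<lambda>\<nu>. ridge_coeff m lam n s y j \<nu> * trig_basis (Suc \<nu>) t) sums
     (1 / real n * (\<Sum>i=1..n. y (sample_index s i j) * K (p i)))" by simp
  then have eq: "ridge_fit m lam n s y j t = 1 / real n * (\<Sum>i=1..n. y (sample_index s i j) * K (p i))"
    using ridge_fit_series t unfolding sobolev_series_def by (blast intro: sums_unique2)
  show ?thesis
    unfolding eq p_def[symmetric] by (intro sums_mult sums_sum sK)
qed

text \<open>Averaging the fit against a basis function of frequency \<open>q\<close> keeps the aliases of \<open>q\<close> only and multiplies the
sample coefficient by \<open>S\<^sub>q / (\<lambda> + S\<^sub>q)\<close>; the residual keeps the remaining fraction \<open>\<lambda> / (\<lambda> + S\<^sub>q)\<close>, which is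
what the penalty demands.\<close>

lemma ridge_fit_normal_equations:
  "lam * trig_eigenvalue m (Suc \<nu>) * ridge_coeff m lam n s y j \<nu> =
     1 / real n * (\<Sum>i=1..n. (y (sample_index s i j) - ridge_fit m lam n s y j (real (sample_index s i j) / real (s * n)))
        * trig_basis (Suc \<nu>) (real (sample_index s i j) / real (s * n)))"
proof -
  define q where "q = Suc (\<nu> div 2)"
  define p where "p i = real (sample_index s i j) / real (s * n)" for i
  define z where "z i = y (sample_index s i j)" for i
  define S where "S = folded_sum m n q"
  have pI: "p i \<in> {0..1}" if "i \<in> {1..n}" for i using sample_point_unit[OF that] by (simp add: p_def)
  have shift: "(\<Sum>i=1..n. F i) = (\<Sum>i<n. F (Suc i))" for F :: "nat \<Rightarrow> real"
    by (simp add: sum.atLeast1_atMost_eq)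
  have key: "(\<Sum>i=1..n. 2 * cos (2 * pi * real k * (p i - p i')) * trig_basis (Suc \<nu>) (p i))
      = real n * (alias_count n k q * trig_basis (Suc \<nu>) (p i'))" if i': "i' \<in> {1..n}" for k i'
  proof -
    obtain l where l: "i' = Suc l" using i' by (cases i') auto
    show ?thesis
      unfolding shift l p_def sample_point[OF n s j(1)] q_def by (rule alias_average_trig_basis[OF n])
  qed
  have "(\<lambda>k. 1 / real n * (\<Sum>i=1..n. (1 / real n * (\<Sum>i'=1..n. z i' *
       (shrinkage m lam n k * (2 * cos (2 * pi * real (Suc k) * (p i - p i')))))) * trig_basis (Suc \<nu>) (p i)))
     sums (1 / real n * (\<Sum>i=1..n. ridge_fit m lam n s y j (p i) * trig_basis (Suc \<nu>) (p i)))"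
    unfolding p_def z_def by (intro sums_mult sums_sum sums_mult2 ridge_fit_kernel sample_point_unit)
  moreover have "1 / real n * (\<Sum>i=1..n. (1 / real n * (\<Sum>i'=1..n. z i' *
       (shrinkage m lam n k * (2 * cos (2 * pi * real (Suc k) * (p i - p i')))))) * trig_basis (Suc \<nu>) (p i))
     = shrinkage m lam n k * alias_count n (Suc k) q * local_fourier n s y j \<nu>" for k
  proof -
    have "(\<Sum>i=1..n. (1 / real n * (\<Sum>i'=1..n. z i' *
       (shrinkage m lam n k * (2 * cos (2 * pi * real (Suc k) * (p i - p i')))))) * trig_basis (Suc \<nu>) (p i))
      = (\<Sum>i=1..n. \<Sum>i'=1..n. 1 / real n * z i' * shrinkage m lam n k *
          (2 * cos (2 * pi * real (Suc k) * (p i - p i')) * trig_basis (Suc \<nu>) (p i)))"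
      by (simp only: sum_distrib_left sum_distrib_right mult_ac)
    also have "\<dots> = (\<Sum>i'=1..n. \<Sum>i=1..n. 1 / real n * z i' * shrinkage m lam n k *
          (2 * cos (2 * pi * real (Suc k) * (p i - p i')) * trig_basis (Suc \<nu>) (p i)))"
      by (rule sum.swap)
    also have "\<dots> = (\<Sum>i'=1..n. 1 / real n * z i' * shrinkage m lam n k *
          (real n * (alias_count n (Suc k) q * trig_basis (Suc \<nu>) (p i'))))"
      unfolding sum_distrib_left[symmetric] by (intro sum.cong refl) (simp only: key)
    also have "\<dots> = (\<Sum>i'=1..n. shrinkage m lam n k * alias_count n (Suc k) q * (z i' * trig_basis (Suc \<nu>) (p i')))"
      using n by (intro sum.cong refl) simp
    finally show ?thesis
      by (simp add: local_fourier_def z_def p_def mult_ac flip: sum_distrib_left)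
  qed
  moreover have "(\<lambda>k. shrinkage m lam n k * alias_count n (Suc k) q * local_fourier n s y j \<nu>) sums
      (S / (lam + S) * local_fourier n s y j \<nu>)"
    unfolding S_def suminf_shrinkage_alias[OF m lam, symmetric]
    by (intro sums_mult2 summable_sums summable_shrinkage_alias[OF m lam])
  ultimately have fit: "1 / real n * (\<Sum>i=1..n. ridge_fit m lam n s y j (p i) * trig_basis (Suc \<nu>) (p i)) =
      S / (lam + S) * local_fourier n s y j \<nu>"
    by (simp add: sums_unique2)
  have dp: "0 < lam + S" unfolding S_def by (rule denom_pos[OF m lam])
  have "lam * trig_eigenvalue m (Suc \<nu>) * ridge_coeff m lam n s y j \<nu> = lam / (lam + S) * local_fourier n s y j \<nu>"
    using eigenval_pos[of m "\<nu> div 2"] dp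
    by (simp add: trig_eigenvalue_Suc ridge_coeff_def shrinkage_def S_def q_def)
  also have "\<dots> = local_fourier n s y j \<nu> - S / (lam + S) * local_fourier n s y j \<nu>"
    using dp by (simp add: field_simps)
  also have "\<dots> = 1 / real n * (\<Sum>i=1..n. (z i - ridge_fit m lam n s y j (p i)) * trig_basis (Suc \<nu>) (p i))"
  proof -
    have "local_fourier n s y j \<nu> = 1 / real n * (\<Sum>i=1..n. z i * trig_basis (Suc \<nu>) (p i))"
      by (simp only: local_fourier_def p_def z_def)
    then show ?thesis
      unfolding fit[symmetric] by (simp only: left_diff_distrib sum_subtractf right_diff_distrib)
  qed
  finally show ?thesis by (simp only: z_def p_def)
qed

theorem sub_estimate_eq_ridge_fit: "sub_estimate m lam n s y j = ridge_fit m lam n s y j"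
proof -
  let ?f = "ridge_fit m lam n s y j"
  have ext: "?f \<in> extensional {0..1}" by (simp add: ridge_fit_def)
  then have mem: "?f \<in> periodic_sobolev m"
    using ridge_fit_series by (auto simp: periodic_sobolev_iff)
  have less: "sub_objective m lam n s y j ?f < sub_objective m lam n s y j g"
    if "g \<in> periodic_sobolev m" "g \<noteq> ?f" for g
    by (rule strict_minimiser[OF m lam n ridge_fit_series ext sample_point_unit ridge_fit_normal_equations that])
  show ?thesis
    unfolding sub_estimate_def arg_min_on_def arg_min_def
  proof (rule some_equality)
    show "is_arg_min (sub_objective m lam n s y j) (\<lambda>x. x \<in> periodic_sobolev m) ?f"
      unfolding is_arg_min_def using mem less by (metis order.asym)
    show "g = ?f" if "is_arg_min (sub_objective m lam n s y j) (\<lambda>x. x \<in> periodic_sobolev m) g" for g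
      using that mem less unfolding is_arg_min_def by blast
  qed
qed

end

section \<open>The test statistic as a diagonal quadratic form\<close>

text \<open>Parseval's identity for an absolutely convergent trigonometric series, by dominated convergence.\<close>

lemma L2_unit_norm_trig_series:
  assumes a: "summable (\<lambda>\<nu>. \<bar>a \<nu>\<bar>)"
    and f: "\<And>t. t \<in> {0..1} \<Longrightarrow> (\<lambda>\<nu>. a \<nu> * trig_basis (Suc \<nu>) t) sums f t"
  shows "(\<lambda>\<nu>. (a \<nu>)\<^sup>2) sums (L2_unit_norm f)\<^sup>2"
proof -
  interpret e: bounded_orthonormal unit_measure "\<lambda>\<nu>. trig_shift 0 (Suc \<nu>)" "sqrt 2"
    by (rule bounded_orthonormal_trig_shift)
  define S where "S n t = (\<Sum>\<nu><n. a \<nu> * trig_shift 0 (Suc \<nu>) t)" for n t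
  define B where "B = (\<Sum>\<nu>. \<bar>a \<nu>\<bar>) * sqrt 2"
  have [measurable]: "S n \<in> borel_measurable unit_measure" for n unfolding S_def by measurable
  have space: "space unit_measure = {0..1}" by (simp add: unit_measure_def space_restrict_space)
  have SB: "\<bar>S n t\<bar> \<le> B" for n t
  proof -
    have "\<bar>S n t\<bar> \<le> (\<Sum>\<nu><n. \<bar>a \<nu>\<bar> * sqrt 2)"
      unfolding S_def
      by (rule order_trans[OF sum_abs]) (auto intro!: sum_mono mult_left_mono abs_trig_shift_le simp: abs_mult)
    also have "\<dots> \<le> (\<Sum>\<nu>. \<bar>a \<nu>\<bar> * sqrt 2)"
      by (intro sum_le_suminf summable_mult2 a) auto
    finally show ?thesis by (simp add: B_def suminf_mult2[OF a])
  qed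
  have lim: "(\<lambda>n. S n t) \<longlonglongrightarrow> f t" if "t \<in> {0..1}" for t
    using f[OF that] by (simp add: S_def sums_def trig_shift_0)
  have f_meas: "f \<in> borel_measurable unit_measure"
    by (rule borel_measurable_LIMSEQ_real[where u = S]) (auto simp: space lim)
  have "(\<lambda>n. \<integral>t. (S n t)\<^sup>2 \<partial>unit_measure) \<longlonglongrightarrow> (\<integral>t. (f t)\<^sup>2 \<partial>unit_measure)"
  proof (rule integral_dominated_convergence[where w = "\<lambda>_. B\<^sup>2"])
    show "AE t in unit_measure. (\<lambda>n. (S n t)\<^sup>2) \<longlonglongrightarrow> (f t)\<^sup>2"
      by (rule AE_I2) (auto simp: space intro!: tendsto_intros lim)
    show "AE t in unit_measure. norm ((S n t)\<^sup>2) \<le> B\<^sup>2" for n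
    proof (rule AE_I2)
      fix t
      have "(S n t)\<^sup>2 \<le> B\<^sup>2"
        using SB[of n t] by (intro abs_le_square_iff[THEN iffD1]) linarith
      then show "norm ((S n t)\<^sup>2) \<le> B\<^sup>2" by simp
    qed
  qed (use f_meas in auto)
  moreover have "(\<integral>t. (S n t)\<^sup>2 \<partial>unit_measure) = (\<Sum>\<nu><n. (a \<nu>)\<^sup>2)" for n
    unfolding S_def by (rule e.integral_square_sum) simp
  moreover have "(L2_unit_norm f)\<^sup>2 = (\<integral>t. (f t)\<^sup>2 \<partial>unit_measure)"
    by (simp add: L2_unit_norm_def integral_unit_measure)
  ultimately show ?thesis by (simp add: sums_def)
qed

text \<open>The discrete Hartley transform: a real substitute for the discrete Fourier transform, whose basis is
orthonormal without a case distinction for the frequencies \<open>0\<close> and \<open>N / 2\<close>.\<close>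

definition hartley :: "nat \<Rightarrow> (nat \<Rightarrow> real) \<Rightarrow> int \<Rightarrow> real" where
  "hartley N y q = (\<Sum>l<N. y l * (cos (2 * pi * of_int q * (real l / real N)) + sin (2 * pi * of_int q * (real l / real N))))"

lemma hartley_mod:
  assumes "N \<ge> 1" "int N dvd p - q"
  shows "hartley N y p = hartley N y q"
proof -
  obtain c where "p - q = int N * c" using assms(2) by (rule dvdE)
  then have c: "p = q + int N * c" by simp
  have "2 * pi * of_int p * (real l / real N) = 2 * pi * of_int q * (real l / real N) + 2 * pi * of_int (c * int l)" for l
    using assms(1) unfolding c by (simp add: field_simps)
  moreover have "sin (x + 2 * pi * of_int L) = sin x" for x :: real and L
    using cos_int_2pin[of L] sin_int_2pin[of L] by (simp add: sin_add)
  ultimately have "cos (2 * pi * of_int p * (real l / real N)) = cos (2 * pi * of_int q * (real l / real N))"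
    "sin (2 * pi * of_int p * (real l / real N)) = sin (2 * pi * of_int q * (real l / real N))" for l
    by (metis cos_add_int_2pi)+
  then show ?thesis unfolding hartley_def by presburger
qed

lemma sum_alias_hartley:
  assumes N: "N \<ge> 1"
  shows "(\<Sum>q<N. alias_count N k q * (hartley N y (int q))\<^sup>2) = (hartley N y (int k))\<^sup>2 + (hartley N y (- int k))\<^sup>2"
proof -
  have pick: "(\<Sum>q<N. of_bool (int N dvd p - int q) * (hartley N y (int q))\<^sup>2) = (hartley N y p)\<^sup>2" for p :: int
  proof -
    define r where "r = nat (p mod int N)"
    have r: "r < N" "int r = p mod int N" using N by (simp_all add: r_def nat_less_iff)
    have iff: "int N dvd p - int q \<longleftrightarrow> q = r" if "q < N" for q
    proof -
      have "int N dvd p - int q \<longleftrightarrow> p mod int N = int q mod int N" by (simp add: mod_eq_dvd_iff)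
      also have "\<dots> \<longleftrightarrow> int r = int q" using that by (simp add: r)
      finally show ?thesis by auto
    qed
    have "(\<Sum>q<N. of_bool (int N dvd p - int q) * (hartley N y (int q))\<^sup>2) = (\<Sum>q<N. if q = r then (hartley N y (int r))\<^sup>2 else 0)"
      by (intro sum.cong refl) (auto simp: iff)
    also have "\<dots> = (hartley N y (int r))\<^sup>2" using r by simp
    also have "hartley N y (int r) = hartley N y p"
      by (rule hartley_mod[OF N]) (simp add: r mod_eq_dvd_iff[symmetric])
    finally show ?thesis .
  qed
  have "- int k - int q = - (int k + int q)" for q by simp
  then have "int N dvd - int k - int q \<longleftrightarrow> int N dvd int k + int q" for q
    by (simp only: dvd_minus_iff)
  then show ?thesis
    using pick[of "int k"] pick[of "- int k"] by (simp add: alias_count_def distrib_right sum.distrib)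
qed

definition full_fourier :: "nat \<Rightarrow> (nat \<Rightarrow> real) \<Rightarrow> nat \<Rightarrow> real" where
  "full_fourier N y \<nu> = 1 / real N * (\<Sum>l<N. y l * trig_basis (Suc \<nu>) (real l / real N))"

text \<open>With \<open>C\<close> and \<open>S\<close> the cosine and sine sums, the Hartley transforms at \<open>k\<close> and \<open>- k\<close> are \<open>C + S\<close> and \<open>C - S\<close>, so
their squares add up to \<open>2 C\<^sup>2 + 2 S\<^sup>2\<close>.\<close>

lemma full_fourier_pair:
  "(full_fourier N y (2 * k))\<^sup>2 + (full_fourier N y (2 * k + 1))\<^sup>2 =
     ((hartley N y (int (Suc k)))\<^sup>2 + (hartley N y (- int (Suc k)))\<^sup>2) / (real N)\<^sup>2"
proof -
  define C where "C = (\<Sum>l<N. y l * cos (2 * pi * real (Suc k) * (real l / real N)))"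
  define S where "S = (\<Sum>l<N. y l * sin (2 * pi * real (Suc k) * (real l / real N)))"
  have b: "trig_basis (Suc (2 * k)) u = sqrt 2 * cos (2 * pi * real (Suc k) * u)"
    "trig_basis (Suc (2 * k + 1)) u = sqrt 2 * sin (2 * pi * real (Suc k) * u)" for u
    by (simp_all add: trig_basis_def)
  have pull: "(\<Sum>l<N. y l * (sqrt 2 * g l)) = sqrt 2 * (\<Sum>l<N. y l * g l)" for g :: "nat \<Rightarrow> real"
    unfolding sum_distrib_left by (intro sum.cong refl) (rule mult.left_commute)
  have 1: "full_fourier N y (2 * k) = sqrt 2 * C / real N" "full_fourier N y (2 * k + 1) = sqrt 2 * S / real N"
    by (simp_all only: full_fourier_def b pull C_def S_def times_divide_eq_left mult_1_left)
  have neg1: "real_of_int (- int (Suc k)) = - real (Suc k)"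
    by simp
  have neg2: "real_of_int (int (Suc k)) = real (Suc k)"
    by simp
  have "hartley N y (int (Suc k)) = C + S"
    unfolding hartley_def neg2 distrib_left sum.distrib C_def S_def by (rule refl)
  moreover have "hartley N y (- int (Suc k)) = C - S"
    unfolding hartley_def neg1 mult_minus_right mult_minus_left cos_minus sin_minus distrib_left sum.distrib mult_minus_right sum_negf C_def S_def
    by (rule diff_conv_add_uminus[symmetric])
  ultimately have 2: "hartley N y (int (Suc k)) = C + S" "hartley N y (- int (Suc k)) = C - S" .
  have 3: "(C + S)\<^sup>2 + (C - S)\<^sup>2 = 2 * C\<^sup>2 + 2 * S\<^sup>2"
    by (simp add: power2_eq_square algebra_simps)
  show ?thesis
    unfolding 1 2 3 by (simp add: power_divide power_mult_distrib add_divide_distrib)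
qed

definition spectral_weight :: "nat \<Rightarrow> real \<Rightarrow> nat \<Rightarrow> nat \<Rightarrow> nat \<Rightarrow> real" where
  "spectral_weight m lam n N q = (\<Sum>k. (shrinkage m lam n k)\<^sup>2 * alias_count N (Suc k) q)"

context
  fixes m n s :: nat and lam :: real
  assumes m: "m \<ge> 1" and lam: "lam > 0" and n: "n \<ge> 1" and s: "s \<ge> 1"
begin

lemma summable_shrinkage_square: "summable (\<lambda>k. (shrinkage m lam n k)\<^sup>2)"
  by (rule summable_comparison_test'[OF summable_shrinkage[OF m lam, of n], where N = 0])
     (use shrinkage_pos[OF m lam] shrinkage_le_1[OF m lam]
      in \<open>auto simp: power2_eq_square abs_of_pos less_imp_le intro: mult_left_le\<close>)

lemma summable_spectral_weight: "summable (\<lambda>k. (shrinkage m lam n k)\<^sup>2 * alias_count N (Suc k) q)"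
  by (rule summable_comparison_test'[OF summable_mult2[OF summable_shrinkage_square, of 2], where N = 0])
     (simp add: abs_of_nonneg alias_nonneg alias_le_2 mult_left_mono)

lemma spectral_weight_nonneg: "0 \<le> spectral_weight m lam n N q"
  unfolding spectral_weight_def
  by (intro suminf_nonneg summable_spectral_weight mult_nonneg_nonneg alias_nonneg) simp

text \<open>Since \<open>n\<close> divides \<open>s n\<close>, aliases modulo the full sample size are aliases modulo \<open>n\<close>; over a whole class
modulo \<open>n\<close> the factors \<open>w\<^sub>k\<close> add up to \<open>S / (\<lambda> + S)\<close>.\<close>

lemma spectral_weight_le_1: "spectral_weight m lam n (s * n) q \<le> 1"
proof -
  have "spectral_weight m lam n (s * n) q \<le> (\<Sum>k. shrinkage m lam n k * alias_count n (Suc k) q)"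
    unfolding spectral_weight_def
  proof (rule suminf_le[OF _ summable_spectral_weight summable_shrinkage_alias[OF m lam]])
    fix k
    have "(shrinkage m lam n k)\<^sup>2 \<le> shrinkage m lam n k"
      using shrinkage_pos[OF m lam, of n k] shrinkage_le_1[OF m lam, of n k]
      by (simp add: power2_eq_square mult_left_le)
    then show "(shrinkage m lam n k)\<^sup>2 * alias_count (s * n) (Suc k) q \<le> shrinkage m lam n k * alias_count n (Suc k) q"
      using shrinkage_pos[OF m lam, of n k]
      by (intro mult_mono alias_dvd_mono alias_nonneg) auto
  qed
  also have "\<dots> = folded_sum m n q / (lam + folded_sum m n q)"
    by (rule suminf_shrinkage_alias[OF m lam])
  also have "\<dots> \<le> 1"
    using denom_pos[OF m lam, of n q] lam by simp
  finally show ?thesis .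
qed

lemma spectral_weight_ge: "(shrinkage m lam n k)\<^sup>2 \<le> spectral_weight m lam n N (Suc k)"
proof -
  have "(shrinkage m lam n k)\<^sup>2 \<le> (shrinkage m lam n k)\<^sup>2 * alias_count N (Suc k) (Suc k)"
    using mult_left_mono[OF alias_refl[of N "Suc k"], of "(shrinkage m lam n k)\<^sup>2"] by simp
  also have "\<dots> = (\<Sum>j\<in>{k}. (shrinkage m lam n j)\<^sup>2 * alias_count N (Suc j) (Suc k))" by simp
  also have "\<dots> \<le> spectral_weight m lam n N (Suc k)"
    unfolding spectral_weight_def by (intro sum_le_suminf summable_spectral_weight) (auto simp: alias_nonneg)
  finally show ?thesis .
qed

text \<open>The shrinkage factor is the same for all machines, so averaging acts on the Fourier coefficients alone,
and the grids of the machines together make up the full grid.\<close>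

lemma avg_estimate_series:
  assumes t: "t \<in> {0..1}"
  shows "(\<lambda>\<nu>. (shrinkage m lam n (\<nu> div 2) * full_fourier (s * n) y \<nu>) * trig_basis (Suc \<nu>) t) sums avg_estimate m lam n s y t"
proof -
  have "(\<lambda>\<nu>. 1 / real s * (\<Sum>j=1..s. ridge_coeff m lam n s y j \<nu> * trig_basis (Suc \<nu>) t)) sums
      (1 / real s * (\<Sum>j=1..s. ridge_fit m lam n s y j t))"
    using ridge_fit_series[OF m lam n s] t unfolding sobolev_series_def by (intro sums_mult sums_sum) auto
  moreover have "avg_estimate m lam n s y t = 1 / real s * (\<Sum>j=1..s. ridge_fit m lam n s y j t)"
    unfolding avg_estimate_def using sub_estimate_eq_ridge_fit[OF m lam n s] by simp
  moreover have "1 / real s * (\<Sum>j=1..s. ridge_coeff m lam n s y j \<nu> * trig_basis (Suc \<nu>) t) =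
      (shrinkage m lam n (\<nu> div 2) * full_fourier (s * n) y \<nu>) * trig_basis (Suc \<nu>) t" for \<nu>
  proof -
    define F where "F l = y l * trig_basis (Suc \<nu>) (real l / real (s * n))" for l
    have "(\<Sum>j=1..s. local_fourier n s y j \<nu>) = 1 / real n * (\<Sum>j=1..s. \<Sum>i=1..n. F (sample_index s i j))"
      by (simp add: local_fourier_def F_def sum_distrib_left)
    also have "(\<Sum>j=1..s. \<Sum>i=1..n. F (sample_index s i j)) = (\<Sum>i=1..n. \<Sum>j=1..s. F (sample_index s i j))"
      by (rule sum.swap)
    also have "\<dots> = (\<Sum>i<n. \<Sum>j=1..s. F (sample_index s (Suc i) j))"
      by (simp add: sum.atLeast1_atMost_eq)
    also have "\<dots> = (\<Sum>i<n. sum F {i * s..<i * s + s})"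
    proof (rule sum.cong[OF refl])
      fix i
      show "(\<Sum>j=1..s. F (sample_index s (Suc i) j)) = sum F {i * s..<i * s + s}"
        by (rule sum.reindex_bij_witness[of _ "\<lambda>l. l - i * s + 1" "\<lambda>j. i * s + (j - 1)"])
           (auto simp: sample_index_def)
    qed
    also have "\<dots> = sum F {..<n * s}" by (rule sum.nat_group)
    finally have "1 / real s * (\<Sum>j=1..s. local_fourier n s y j \<nu>) = full_fourier (s * n) y \<nu>"
      by (simp add: full_fourier_def F_def mult.commute)
    then have "(shrinkage m lam n (\<nu> div 2) * trig_basis (Suc \<nu>) t) * (1 / real s * (\<Sum>j=1..s. local_fourier n s y j \<nu>))
        = (shrinkage m lam n (\<nu> div 2) * full_fourier (s * n) y \<nu>) * trig_basis (Suc \<nu>) t"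
      by (simp only: mult_ac)
    then show ?thesis by (simp only: ridge_coeff_def sum_distrib_left mult_ac)
  qed
  ultimately show ?thesis by simp
qed

text \<open>Parseval expresses the statistic through all frequencies; each frequency sees the data only through its
class modulo \<open>s n\<close>, so the squared factors accumulate there.\<close>

theorem test_stat_quadratic_form:
  "test_stat m lam n s y =
     1 / (real (s * n))\<^sup>2 * (\<Sum>q<s * n. spectral_weight m lam n (s * n) q * (hartley (s * n) y (int q))\<^sup>2)"
proof -
  define N where "N = s * n"
  have N: "N \<ge> 1" using n s by (simp add: N_def)
  define a where "a \<nu> = shrinkage m lam n (\<nu> div 2) * full_fourier N y \<nu>" for \<nu>
  have "\<bar>full_fourier N y \<nu>\<bar> \<le> 1 / real N * (\<Sum>l<N. \<bar>y l\<bar> * sqrt 2)" for \<nu>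
  proof -
    have "\<bar>\<Sum>l<N. y l * trig_basis (Suc \<nu>) (real l / real N)\<bar> \<le> (\<Sum>l<N. \<bar>y l\<bar> * sqrt 2)"
      by (rule order_trans[OF sum_abs]) (auto intro!: sum_mono mult_left_mono abs_trig_basis_le simp: abs_mult)
    then show ?thesis
      unfolding full_fourier_def abs_mult by (intro mult_mono) auto
  qed
  then have abs_a: "summable (\<lambda>\<nu>. \<bar>a \<nu>\<bar>)"
    unfolding a_def
    by (intro summable_abs_bounded_mult summable_doubled summable_shrinkage[OF m lam])
       (auto intro: less_imp_le shrinkage_pos[OF m lam])
  have "(\<lambda>\<nu>. (a \<nu>)\<^sup>2) sums test_stat m lam n s y"
    unfolding test_stat_def
    by (rule L2_unit_norm_trig_series[OF abs_a]) (use avg_estimate_series in \<open>auto simp: a_def N_def\<close>)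
  then have "(\<lambda>k. (a (2 * k))\<^sup>2 + (a (2 * k + 1))\<^sup>2) sums test_stat m lam n s y"
    using suminf_pairs[of "\<lambda>\<nu>. (a \<nu>)\<^sup>2"] by (auto simp: sums_iff)
  moreover have "(a (2 * k))\<^sup>2 + (a (2 * k + 1))\<^sup>2 =
     1 / (real N)\<^sup>2 * (\<Sum>q<N. (shrinkage m lam n k)\<^sup>2 * alias_count N (Suc k) q * (hartley N y (int q))\<^sup>2)" for k
  proof -
    have "(a (2 * k))\<^sup>2 + (a (2 * k + 1))\<^sup>2 =
       (shrinkage m lam n k)\<^sup>2 * ((full_fourier N y (2 * k))\<^sup>2 + (full_fourier N y (2 * k + 1))\<^sup>2)"
      by (simp add: a_def power_mult_distrib distrib_left)
    also have "\<dots> = (shrinkage m lam n k)\<^sup>2 * ((\<Sum>q<N. alias_count N (Suc k) q * (hartley N y (int q))\<^sup>2) / (real N)\<^sup>2)"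
      by (simp only: full_fourier_pair sum_alias_hartley[OF N])
    finally show ?thesis by (simp add: sum_distrib_left sum_divide_distrib mult_ac)
  qed
  moreover have "(\<lambda>k. 1 / (real N)\<^sup>2 * (\<Sum>q<N. (shrinkage m lam n k)\<^sup>2 * alias_count N (Suc k) q * (hartley N y (int q))\<^sup>2))
     sums (1 / (real N)\<^sup>2 * (\<Sum>q<N. spectral_weight m lam n N q * (hartley N y (int q))\<^sup>2))"
    unfolding spectral_weight_def
    by (intro sums_mult sums_sum sums_mult2 summable_sums summable_spectral_weight)
  ultimately show ?thesis by (simp add: sums_unique2 N_def)
qed

end

lemma hartley_orthonormal:
  assumes N: "N \<ge> 1" and pq: "p < N" "q < N"
  shows "(\<Sum>l<N. (cos (2 * pi * real p * (real l / real N)) + sin (2 * pi * real p * (real l / real N))) / sqrt (real N) *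
      ((cos (2 * pi * real q * (real l / real N)) + sin (2 * pi * real q * (real l / real N))) / sqrt (real N)))
    = (if p = q then 1 else 0)"
proof -
  have "(cos (2 * pi * real p * u) + sin (2 * pi * real p * u)) / sqrt (real N) *
      ((cos (2 * pi * real q * u) + sin (2 * pi * real q * u)) / sqrt (real N)) =
    (cos (2 * pi * of_int (int p - int q) * u + 0) + cos (2 * pi * of_int (int p + int q) * u + (- pi / 2))) / real N" for u
  proof -
    define x y where "x = 2 * pi * real p * u" and "y = 2 * pi * real q * u"
    have "cos (2 * pi * of_int (int p + int q) * u + (- pi / 2)) = sin (x + y)"
      by (simp add: cos_diff x_def y_def algebra_simps)
    moreover have "cos (2 * pi * of_int (int p - int q) * u + 0) = cos (x - y)"
      by (simp add: x_def y_def algebra_simps)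
    moreover have "(cos x + sin x) * (cos y + sin y) = cos (x - y) + sin (x + y)"
      by (simp add: cos_diff sin_add algebra_simps)
    ultimately show ?thesis unfolding x_def y_def by simp
  qed
  then have "(\<Sum>l<N. (cos (2 * pi * real p * (real l / real N)) + sin (2 * pi * real p * (real l / real N))) / sqrt (real N) *
      ((cos (2 * pi * real q * (real l / real N)) + sin (2 * pi * real q * (real l / real N))) / sqrt (real N))) =
    ((\<Sum>l<N. cos (2 * pi * of_int (int p - int q) * (real l / real N) + 0)) +
     (\<Sum>l<N. cos (2 * pi * of_int (int p + int q) * (real l / real N) + (- pi / 2)))) / real N"
    by (simp only: sum.distrib sum_divide_distrib[symmetric])
  also have "\<dots> = (if int N dvd int p - int q then 1 else 0)"
    unfolding sum_cos_progression[OF N] using N by simp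
  also have "int N dvd int p - int q \<longleftrightarrow> p = q"
    using pq by (simp add: mod_eq_dvd_iff[symmetric])
  finally show ?thesis .
qed

section \<open>The number of large weights\<close>

lemma power_ratio_le_inverse_square:
  fixes j :: nat and x :: real
  assumes "m \<ge> 1" "0 \<le> x" "x \<le> 1 / real (Suc j)"
  shows "x ^ (2 * m) \<le> 1 / (real (Suc j))\<^sup>2"
proof -
  have "x ^ (2 * m) \<le> (1 / real (Suc j)) ^ (2 * m)" using assms by (intro power_mono) auto
  also have "\<dots> \<le> (1 / real (Suc j)) ^ 2" using assms by (intro power_decreasing) auto
  finally show ?thesis by (simp add: power_divide)
qed

definition zeta2 :: real where "zeta2 = (\<Sum>j. 1 / (real (Suc j))\<^sup>2)"

text \<open>For \<open>q \<le> n / 2\<close> the smallest positive frequency aliased with \<open>q\<close> is \<open>q\<close> itself, and the others lie so far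
away that the sum of \<open>\<rho>\<^sub>q / \<rho>\<^sub>k\<close> is dominated by two copies of \<open>\<Sum> 1 / j\<^sup>2\<close>.\<close>

lemma folded_sum_le:
  assumes m: "m \<ge> 1" and q: "2 * Suc k \<le> n"
  shows "folded_sum m n (Suc k) \<le> 2 * zeta2 / eigenval m k"
proof -
  define q where "q = Suc k"
  have qn: "1 \<le> q" "2 * q \<le> n" using assms by (auto simp: q_def)
  define g where "g k' = eigenval m k / eigenval m k'" for k'
  have g: "g k' = (real q / real (Suc k')) ^ (2 * m)" for k'
    by (simp add: g_def eigenval_def q_def flip: power_divide del: of_nat_Suc)
  have g0: "0 \<le> g k'" for k' using eigenval_pos[of m] by (simp add: g_def less_imp_le)
  have part: "(\<Sum>k'<K. of_bool (P k') * g k') \<le> zeta2"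
    if P: "\<And>k'. P k' \<Longrightarrow> \<exists>j. real (Suc j) * real q \<le> real (Suc k') \<and> Suc k' = h j" for P h K
  proof -
    have "\<exists>j. P k' \<longrightarrow> real (Suc j) * real q \<le> real (Suc k') \<and> Suc k' = h j" for k' using P by blast
    then obtain J where J: "\<And>k'. P k' \<Longrightarrow> real (Suc (J k')) * real q \<le> real (Suc k') \<and> Suc k' = h (J k')" by metis
    have inj: "inj_on J {k'. k' < K \<and> P k'}"
      by (rule inj_onI) (metis (no_types, lifting) J mem_Collect_eq nat.inject)
    have "(\<Sum>k'<K. of_bool (P k') * g k') = (\<Sum>k'\<in>{k'. k' < K \<and> P k'}. g k')"
      by (rule sum.mono_neutral_cong_right) auto
    also have "\<dots> \<le> (\<Sum>k'\<in>{k'. k' < K \<and> P k'}. 1 / (real (Suc (J k')))\<^sup>2)"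
    proof (rule sum_mono)
      fix k' assume "k' \<in> {k'. k' < K \<and> P k'}"
      then have "real (Suc (J k')) * real q \<le> real (Suc k')" using J by blast
      then have "real q / real (Suc k') \<le> 1 / real (Suc (J k'))" by (simp add: field_simps)
      then show "g k' \<le> 1 / (real (Suc (J k')))\<^sup>2"
        unfolding g by (intro power_ratio_le_inverse_square m) auto
    qed
    also have "\<dots> = (\<Sum>j\<in>J ` {k'. k' < K \<and> P k'}. 1 / (real (Suc j))\<^sup>2)"
      by (simp add: sum.reindex[OF inj])
    also have "\<dots> \<le> zeta2"
      unfolding zeta2_def by (intro sum_le_suminf summable_inverse_Suc_square) auto
    finally show ?thesis .
  qed
  \<comment> \<open>The frequencies congruent to \<open>q\<close> are \<open>q + j n\<close>, those congruent to \<open>- q\<close> are \<open>(j + 1) n - q\<close>,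
    with \<open>j \<ge> 0\<close>; as \<open>n \<ge> 2 q\<close>, both are at least \<open>(j + 1) q\<close>.\<close>
  have minus: "(\<Sum>k'<K. of_bool (int n dvd int (Suc k') - int q) * g k') \<le> zeta2" for K
  proof (rule part[where h = "\<lambda>j. q + j * n"])
    fix k' assume "int n dvd int (Suc k') - int q"
    then obtain c where c: "int (Suc k') - int q = int n * c" by blast
    have "0 \<le> c"
    proof (rule ccontr)
      assume "\<not> 0 \<le> c"
      then have "int n * c \<le> int n * (-1)" by (intro mult_left_mono) auto
      then show False using c qn by simp
    qed
    define j where "j = nat c"
    have "int (Suc k') = int (q + j * n)" using c \<open>0 \<le> c\<close> by (simp add: j_def mult.commute)
    then have e: "Suc k' = q + j * n" by (simp only: of_nat_eq_iff)
    have "j * q \<le> j * n" using qn by (intro mult_left_mono) auto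
    then have "Suc j * q \<le> Suc k'" unfolding e by simp
    then show "\<exists>j. real (Suc j) * real q \<le> real (Suc k') \<and> Suc k' = q + j * n"
      using e by (intro exI[of _ j]) (simp only: of_nat_mult[symmetric] of_nat_le_iff)
  qed
  have plus: "(\<Sum>k'<K. of_bool (int n dvd int (Suc k') + int q) * g k') \<le> zeta2" for K
  proof (rule part[where h = "\<lambda>j. Suc j * n - q"])
    fix k' assume "int n dvd int (Suc k') + int q"
    then have "n dvd Suc k' + q" by (metis of_nat_add of_nat_dvd_iff)
    then obtain c where c: "Suc k' + q = n * c" by blast
    then have "c \<noteq> 0" by (intro notI) simp
    then obtain j where j: "c = Suc j" by (cases c) auto
    have e: "Suc k' = Suc j * n - q" using c j by (simp add: mult.commute)
    have "Suc j * (2 * q) \<le> Suc j * n" using qn by (intro mult_left_mono) auto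
    moreover have "q \<le> Suc j * q" by simp
    ultimately have "Suc j * q + q \<le> Suc k' + q" unfolding c j by (simp add: mult.commute)
    then have "Suc j * q \<le> Suc k'" by simp
    then show "\<exists>j. real (Suc j) * real q \<le> real (Suc k') \<and> Suc k' = Suc j * n - q"
      using e by (intro exI[of _ j]) (simp only: of_nat_mult[symmetric] of_nat_le_iff)
  qed
  have "(\<Sum>k'<K. alias_count n (Suc k') (Suc k) / eigenval m k') \<le> 2 * zeta2 / eigenval m k" for K
  proof -
    have "(\<Sum>k'<K. alias_count n (Suc k') (Suc k) / eigenval m k') * eigenval m k =
      (\<Sum>k'<K. of_bool (int n dvd int (Suc k') - int q) * g k') + (\<Sum>k'<K. of_bool (int n dvd int (Suc k') + int q) * g k')"
      unfolding sum_distrib_right sum.distrib[symmetric]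
      by (intro sum.cong refl) (simp only: alias_count_def q_def g_def, simp add: add_divide_distrib distrib_right)
    also have "\<dots> \<le> 2 * zeta2" using minus[of K] plus[of K] by linarith
    finally show ?thesis using eigenval_pos[of m k] by (simp add: field_simps)
  qed
  then show ?thesis
    unfolding folded_sum_def by (intro suminf_le_const summable_folded[OF m])
qed

lemma shrinkage_lower_bound:
  assumes m: "m \<ge> 1" and h: "h > 0" and lam: "lam = h ^ (2 * m)"
    and q: "2 * Suc k \<le> n" "2 * pi * real (Suc k) * h \<le> 1"
  shows "1 / (1 + 2 * zeta2) \<le> shrinkage m lam n k"
proof -
  have lam0: "lam > 0" using h by (simp add: lam)
  have z0: "0 \<le> zeta2" unfolding zeta2_def by (intro suminf_nonneg summable_inverse_Suc_square) simp
  have "eigenval m k * lam = (2 * pi * real (Suc k) * h) ^ (2 * m)"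
    by (simp add: eigenval_def lam power_mult_distrib)
  also have "\<dots> \<le> 1" using q h by (intro power_le_one) auto
  finally have "eigenval m k * lam \<le> 1" .
  moreover have "eigenval m k * folded_sum m n (Suc k) \<le> 2 * zeta2"
    using folded_sum_le[OF m q(1)] eigenval_pos[of m k] by (simp add: field_simps)
  ultimately have "eigenval m k * (lam + folded_sum m n (Suc k)) \<le> 1 + 2 * zeta2"
    by (simp add: distrib_left)
  moreover have "0 < eigenval m k * (lam + folded_sum m n (Suc k))"
    using eigenval_pos denom_pos[OF m lam0] by (intro mult_pos_pos)
  ultimately show ?thesis unfolding shrinkage_def by (intro divide_left_mono) (use z0 in auto)
qed

section \<open>Quadratic forms in independent standard normal variables\<close>

text \<open>The characteristic function gives imaginary \<open>w\<close>; a real part of \<open>w\<close> merely translates the density.\<close>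

lemma std_normal_exp_complex:
  fixes w :: complex
  shows integrable_std_normal_exp: "integrable std_normal_distribution (\<lambda>x. exp (w * complex_of_real x))"
    and integral_std_normal_exp:
      "(LINT x|std_normal_distribution. exp (w * complex_of_real x)) = exp (w\<^sup>2 / 2)"
proof -
  define a b where "a = Re w" and "b = Im w"
  have w: "w = complex_of_real a + \<i> * complex_of_real b"
    by (simp add: a_def b_def complex_eq_iff)
  define f where "f x = std_normal_density x *\<^sub>R iexp (b * x)" for x
  have fi: "integrable lborel f"
    unfolding f_def
    by (rule Bochner_Integration.integrable_bound[OF integrable_normal_density[of 1 0]])
       (auto simp: normal_density_nonneg)
  have fI: "integral\<^sup>L lborel f = complex_of_real (exp (- b\<^sup>2 / 2))"
  proof -
    have "char std_normal_distribution b = integral\<^sup>L lborel f"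
      unfolding char_def f_def by (subst integral_density) (auto simp: normal_density_nonneg)
    then show ?thesis by (simp add: char_std_normal_distribution)
  qed
  define c where "c = complex_of_real (exp (a\<^sup>2 / 2)) * iexp (b * a)"
  \<comment> \<open>Completing the square: the real part of the exponent only shifts the density.\<close>
  have eq: "std_normal_density x *\<^sub>R exp (w * complex_of_real x) = c * f (- a + 1 * x)" for x
  proof -
    have "std_normal_density x *\<^sub>R exp (w * complex_of_real x)
       = complex_of_real (1 / sqrt (2 * pi)) * (complex_of_real (exp (- x\<^sup>2 / 2)) * exp (w * complex_of_real x))"
      by (simp add: std_normal_density_def scaleR_conv_of_real)
    also have "complex_of_real (exp (- x\<^sup>2 / 2)) * exp (w * complex_of_real x)
       = exp (complex_of_real (- x\<^sup>2 / 2) + w * complex_of_real x)"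
      by (simp only: exp_add exp_of_real)
    also have "complex_of_real (- x\<^sup>2 / 2) + w * complex_of_real x =
       complex_of_real (a\<^sup>2 / 2) + \<i> * complex_of_real (b * a)
         + complex_of_real (- (x - a)\<^sup>2 / 2) + \<i> * complex_of_real (b * (x - a))"
      by (simp add: w complex_eq_iff power2_eq_square algebra_simps) (simp add: field_simps)
    also have "exp \<dots> = c * (complex_of_real (exp (- (x - a)\<^sup>2 / 2)) * iexp (b * (x - a)))"
      by (simp only: exp_add exp_of_real c_def mult_ac)
    finally show ?thesis
      by (simp add: f_def std_normal_density_def scaleR_conv_of_real ac_simps)
  qed
  have shift: "integrable lborel (\<lambda>x. c * f (- a + 1 * x))"
    by (intro integrable_mult_right lborel_integrable_real_affine[OF fi]) simp
  show "integrable std_normal_distribution (\<lambda>x. exp (w * complex_of_real x))"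
    by (subst integrable_density) (auto simp: normal_density_nonneg eq[simplified] shift[simplified])
  have "(LINT x|std_normal_distribution. exp (w * complex_of_real x))
      = (LINT x|lborel. c * f (- a + 1 * x))"
    by (subst integral_density) (auto simp: normal_density_nonneg eq[simplified])
  also have "\<dots> = c * (LINT x|lborel. f x)"
    using lborel_integral_real_affine[of 1 f "- a"] by simp
  also have "\<dots> = exp (complex_of_real (a\<^sup>2 / 2) + \<i> * complex_of_real (b * a) + complex_of_real (- b\<^sup>2 / 2))"
    by (simp only: fI c_def exp_add exp_of_real)
  also have "complex_of_real (a\<^sup>2 / 2) + \<i> * complex_of_real (b * a) + complex_of_real (- b\<^sup>2 / 2) = w\<^sup>2 / 2"
    by (simp add: w complex_eq_iff power2_eq_square algebra_simps)
  finally show "(LINT x|std_normal_distribution. exp (w * complex_of_real x)) = exp (w\<^sup>2 / 2)" .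
qed

lemma integrable_std_normal_exp_square:
  fixes a :: real
  assumes "a < 1"
  shows "integrable std_normal_distribution (\<lambda>x. exp (a * x\<^sup>2 / 2))"
proof -
  define \<tau> where "\<tau> = 1 / sqrt (1 - a)"
  have \<tau>: "\<tau> > 0" "\<tau>\<^sup>2 = 1 / (1 - a)"
    using assms by (auto simp: \<tau>_def power_divide)
  have eq: "std_normal_density x * exp (a * x\<^sup>2 / 2) = \<tau> * normal_density 0 \<tau> x" for x
  proof -
    have "std_normal_density x * exp (a * x\<^sup>2 / 2) = 1 / sqrt (2 * pi) * exp (- (1 - a) * x\<^sup>2 / 2)"
      by (simp add: std_normal_density_def mult_exp_exp) (simp add: field_simps)
    also have "- (1 - a) * x\<^sup>2 / 2 = - (x - 0)\<^sup>2 / (2 * \<tau>\<^sup>2)"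
      using assms by (simp add: \<tau>(2) field_simps)
    also have "1 / sqrt (2 * pi) * exp \<dots> = \<tau> * normal_density 0 \<tau> x"
      using \<tau>(1) by (simp add: normal_density_def real_sqrt_mult)
    finally show ?thesis .
  qed
  show ?thesis
    using \<tau>(1) by (subst integrable_density) (auto simp: normal_density_nonneg eq)
qed

locale std_gaussian_family = prob_space M for M :: "'a measure" +
  fixes I :: "'i set" and X :: "'i \<Rightarrow> 'a \<Rightarrow> real"
  assumes finite_I: "finite I"
    and indep_X: "indep_vars (\<lambda>_. borel) X I"
    and distributed_X: "\<And>i. i \<in> I \<Longrightarrow> distributed M lborel (X i) std_normal_density"
begin

definition lin :: "('i \<Rightarrow> real) \<Rightarrow> 'a \<Rightarrow> real" where
  "lin v \<omega> = (\<Sum>l\<in>I. v l * X l \<omega>)"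

lemma measurable_X: "i \<in> I \<Longrightarrow> X i \<in> borel_measurable M"
  using indep_X by (auto simp: indep_vars_def)

lemma measurable_lin [measurable]: "lin v \<in> borel_measurable M"
  unfolding lin_def[abs_def] by (intro borel_measurable_sum borel_measurable_times measurable_X) auto

lemma distr_X: "i \<in> I \<Longrightarrow> distr M borel (X i) = std_normal_distribution"
  using distributed_distr_eq_density[OF distributed_X, of i]
  by (metis distr_cong sets_lborel)

lemma
  fixes g :: "real \<Rightarrow> 'b :: {banach, second_countable_topology}"
  assumes i: "i \<in> I" and g [measurable]: "g \<in> borel_measurable borel"
  shows integrable_X_iff: "integrable M (\<lambda>\<omega>. g (X i \<omega>)) \<longleftrightarrow> integrable std_normal_distribution g"
    and integral_X: "(LINT \<omega>|M. g (X i \<omega>)) = (LINT x|std_normal_distribution. g x)"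
  using measurable_X[OF i]
  by (simp_all flip: distr_X[OF i] add: integrable_distr_eq integral_distr)

lemma
  fixes g :: "'i \<Rightarrow> real \<Rightarrow> 'b :: {real_normed_field, banach, second_countable_topology}"
  assumes g: "\<And>i. i \<in> I \<Longrightarrow> g i \<in> borel_measurable borel"
    and int: "\<And>i. i \<in> I \<Longrightarrow> integrable std_normal_distribution (g i)"
  shows integrable_prod_X: "integrable M (\<lambda>\<omega>. \<Prod>i\<in>I. g i (X i \<omega>))"
    and integral_prod_X:
      "(LINT \<omega>|M. (\<Prod>i\<in>I. g i (X i \<omega>))) = (\<Prod>i\<in>I. LINT x|std_normal_distribution. g i x)"
proof -
  have ind: "indep_vars (\<lambda>_. borel) (\<lambda>i \<omega>. g i (X i \<omega>)) I"
    by (rule indep_vars_compose2[OF indep_X]) (use g in auto)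
  have i: "integrable M (\<lambda>\<omega>. g i (X i \<omega>))" if "i \<in> I" for i
    using integrable_X_iff[OF that g[OF that]] int[OF that] by simp
  show "integrable M (\<lambda>\<omega>. \<Prod>i\<in>I. g i (X i \<omega>))"
    by (rule indep_vars_integrable[OF finite_I ind i])
  show "(LINT \<omega>|M. (\<Prod>i\<in>I. g i (X i \<omega>))) = (\<Prod>i\<in>I. LINT x|std_normal_distribution. g i x)"
    by (subst indep_vars_lebesgue_integral[OF finite_I ind i])
       (auto intro!: prod.cong integral_X g)
qed

lemma
  fixes v :: "'i \<Rightarrow> complex"
  shows integrable_exp_lin: "integrable M (\<lambda>\<omega>. exp (\<Sum>l\<in>I. v l * complex_of_real (X l \<omega>)))"
    and integral_exp_lin:
      "(LINT \<omega>|M. exp (\<Sum>l\<in>I. v l * complex_of_real (X l \<omega>))) = exp ((\<Sum>l\<in>I. (v l)\<^sup>2) / 2)"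
proof -
  have "integrable M (\<lambda>\<omega>. \<Prod>l\<in>I. exp (v l * complex_of_real (X l \<omega>)))"
    by (rule integrable_prod_X) (auto intro: integrable_std_normal_exp)
  then show "integrable M (\<lambda>\<omega>. exp (\<Sum>l\<in>I. v l * complex_of_real (X l \<omega>)))"
    by (simp add: exp_sum finite_I)
  have "(LINT \<omega>|M. (\<Prod>l\<in>I. exp (v l * complex_of_real (X l \<omega>))))
      = (\<Prod>l\<in>I. LINT x|std_normal_distribution. exp (v l * complex_of_real x))"
    by (rule integral_prod_X) (auto intro: integrable_std_normal_exp)
  then show "(LINT \<omega>|M. exp (\<Sum>l\<in>I. v l * complex_of_real (X l \<omega>))) = exp ((\<Sum>l\<in>I. (v l)\<^sup>2) / 2)"
    by (simp add: exp_sum finite_I integral_std_normal_exp sum_divide_distrib)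
qed

text \<open>Identified by its characteristic function, so that vanishing coefficients need no separate treatment.\<close>

lemma distr_lin_unit:
  assumes "(\<Sum>l\<in>I. (v l)\<^sup>2) = 1"
  shows "distr M borel (lin v) = std_normal_distribution"
proof (rule Levy_uniqueness)
  show "real_distribution (distr M borel (lin v))"
    by (rule real_distribution_distr) simp
  show "real_distribution std_normal_distribution" by (rule real_dist_normal_dist)
  show "char (distr M borel (lin v)) = char std_normal_distribution"
  proof
    fix t
    have "char (distr M borel (lin v)) t = (LINT \<omega>|M. iexp (t * lin v \<omega>))"
      unfolding char_def by (subst integral_distr) auto
    also have "\<dots> = (LINT \<omega>|M. exp (\<Sum>l\<in>I. (\<i> * t * v l) * complex_of_real (X l \<omega>)))"
      by (intro Bochner_Integration.integral_cong refl)
         (simp add: lin_def sum_distrib_left mult_ac)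
    also have "\<dots> = exp ((\<Sum>l\<in>I. (\<i> * t * v l)\<^sup>2) / 2)"
      by (rule integral_exp_lin)
    also have "(\<Sum>l\<in>I. (\<i> * t * v l)\<^sup>2) = - (complex_of_real t)\<^sup>2 * complex_of_real (\<Sum>l\<in>I. (v l)\<^sup>2)"
      by (simp add: power_mult_distrib sum_negf flip: sum_distrib_left)
    finally show "char (distr M borel (lin v)) t = char std_normal_distribution t"
      by (simp add: assms char_std_normal_distribution flip: exp_of_real)
  qed
qed

lemma
  assumes v: "(\<Sum>l\<in>I. (v l)\<^sup>2) = 1"
  shows integrable_lin_pow: "integrable M (\<lambda>\<omega>. lin v \<omega> ^ k)"
    and integral_lin_square: "(LINT \<omega>|M. (lin v \<omega>)\<^sup>2) = 1"
    and integral_lin_fourth: "(LINT \<omega>|M. lin v \<omega> ^ 4) = 3"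
proof -
  have i: "(LINT \<omega>|M. lin v \<omega> ^ k) = (LINT x|std_normal_distribution. x ^ k)" for k
    by (subst distr_lin_unit[OF v, symmetric], subst integral_distr) auto
  have "integrable (distr M borel (lin v)) (\<lambda>x. x ^ k)"
    by (simp add: distr_lin_unit[OF v] integrable_std_normal_distribution_moment)
  then show "integrable M (\<lambda>\<omega>. lin v \<omega> ^ k)"
    by (subst (asm) integrable_distr_eq) auto
  show "(LINT \<omega>|M. (lin v \<omega>)\<^sup>2) = 1"
    using std_normal_distribution_even_moments(1)[of 1] by (simp add: i fact_numeral)
  show "(LINT \<omega>|M. lin v \<omega> ^ 4) = 3"
    using std_normal_distribution_even_moments(1)[of 2] by (simp add: i fact_numeral)
qed

lemma
  assumes u: "(\<Sum>l\<in>I. (u l)\<^sup>2) = 1" and v: "(\<Sum>l\<in>I. (v l)\<^sup>2) = 1" and uv: "(\<Sum>l\<in>I. u l * v l) = 0"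
  shows integrable_lin_squares: "integrable M (\<lambda>\<omega>. (lin u \<omega>)\<^sup>2 * (lin v \<omega>)\<^sup>2)"
    and integral_lin_squares: "(LINT \<omega>|M. (lin u \<omega>)\<^sup>2 * (lin v \<omega>)\<^sup>2) = 1"
proof -
  define p where "p l = (u l + v l) / sqrt 2" for l
  define r where "r l = (u l - v l) / sqrt 2" for l
  have p: "(\<Sum>l\<in>I. (p l)\<^sup>2) = 1" and r: "(\<Sum>l\<in>I. (r l)\<^sup>2) = 1"
    using u v uv
    by (simp_all add: p_def r_def power_divide power2_sum power2_diff sum.distrib sum_subtractf
        flip: sum_divide_distrib)
       (simp_all add: mult.assoc flip: sum_distrib_left)
  have lp: "lin p \<omega> = (lin u \<omega> + lin v \<omega>) / sqrt 2" and lr: "lin r \<omega> = (lin u \<omega> - lin v \<omega>) / sqrt 2" for \<omega>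
    by (simp_all add: lin_def p_def r_def sum_divide_distrib algebra_simps diff_divide_distrib add_divide_distrib
        flip: sum.distrib sum_subtractf)
  \<comment> \<open>Polarisation of the fourth power.\<close>
  have pol: "(lin u \<omega>)\<^sup>2 * (lin v \<omega>)\<^sup>2 =
     (1/3) * (lin p \<omega> ^ 4 + lin r \<omega> ^ 4) - (1/6) * (lin u \<omega> ^ 4 + lin v \<omega> ^ 4)" for \<omega>
  proof -
    have "sqrt 2 ^ 4 = ((sqrt 2)\<^sup>2)\<^sup>2" by (simp only: flip: power_mult) simp
    then have s4: "sqrt 2 ^ 4 = (4::real)" by simp
    show ?thesis
      unfolding lp lr power_divide s4 by (simp add: field_simps power2_eq_square power4_eq_xxxx)
  qed
  note int = integrable_lin_pow[OF u] integrable_lin_pow[OF v] integrable_lin_pow[OF p] integrable_lin_pow[OF r]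
  have i1: "integrable M (\<lambda>\<omega>. (1/3) * (lin p \<omega> ^ 4 + lin r \<omega> ^ 4))"
    and i2: "integrable M (\<lambda>\<omega>. (1/6) * (lin u \<omega> ^ 4 + lin v \<omega> ^ 4))"
    by (intro integrable_mult_right Bochner_Integration.integrable_add int)+
  show "integrable M (\<lambda>\<omega>. (lin u \<omega>)\<^sup>2 * (lin v \<omega>)\<^sup>2)"
    unfolding pol by (rule Bochner_Integration.integrable_diff[OF i1 i2])
  show "(LINT \<omega>|M. (lin u \<omega>)\<^sup>2 * (lin v \<omega>)\<^sup>2) = 1"
    unfolding pol Bochner_Integration.integral_diff[OF i1 i2] integral_mult_right_zero
      Bochner_Integration.integral_add[OF int(1) int(2)] Bochner_Integration.integral_add[OF int(3) int(4)]
    by (simp add: integral_lin_fourth u v p r)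
qed

end

text \<open>An orthonormal basis \<open>u q\<close> indexed by the same set as the variables, so that one and the same family can
serve as the noise and, in an independent copy, as the auxiliary Gaussian family below.\<close>

locale orthonormal_gaussian_forms = std_gaussian_family M I X
  for M :: "'a measure" and I :: "'i set" and X :: "'i \<Rightarrow> 'a \<Rightarrow> real" +
  fixes u :: "'i \<Rightarrow> 'i \<Rightarrow> real"
  assumes orthonormal: "\<And>p q. p \<in> I \<Longrightarrow> q \<in> I \<Longrightarrow> (\<Sum>l\<in>I. u p l * u q l) = (if p = q then 1 else 0)"
begin

lemma unit: "q \<in> I \<Longrightarrow> (\<Sum>l\<in>I. (u q l)\<^sup>2) = 1"
  using orthonormal[of q q] by (simp add: power2_eq_square)

lemma
  shows integrable_quadratic_form: "integrable M (\<lambda>\<omega>. \<Sum>q\<in>I. W q * (lin (u q) \<omega>)\<^sup>2)"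
    and expectation_quadratic_form: "expectation (\<lambda>\<omega>. \<Sum>q\<in>I. W q * (lin (u q) \<omega>)\<^sup>2) = (\<Sum>q\<in>I. W q)"
    and variance_quadratic_form: "variance (\<lambda>\<omega>. \<Sum>q\<in>I. W q * (lin (u q) \<omega>)\<^sup>2) = 2 * (\<Sum>q\<in>I. (W q)\<^sup>2)"
proof -
  let ?T = "\<lambda>\<omega>. \<Sum>q\<in>I. W q * (lin (u q) \<omega>)\<^sup>2"
  have i1: "integrable M (\<lambda>\<omega>. W q * (lin (u q) \<omega>)\<^sup>2)" if "q \<in> I" for q
    using integrable_lin_pow[OF unit[OF that], of 2] by simp
  have p2: "integrable M (\<lambda>\<omega>. (lin (u p) \<omega>)\<^sup>2 * (lin (u q) \<omega>)\<^sup>2) \<and>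
       (LINT \<omega>|M. (lin (u p) \<omega>)\<^sup>2 * (lin (u q) \<omega>)\<^sup>2) = (if p = q then 3 else 1)"
    if "p \<in> I" "q \<in> I" for p q
  proof (cases "p = q")
    case True
    have "(lin (u p) \<omega>)\<^sup>2 * (lin (u q) \<omega>)\<^sup>2 = lin (u p) \<omega> ^ 4" for \<omega>
      using True by (simp flip: power_add)
    then show ?thesis
      using integrable_lin_pow[OF unit[OF that(1)], of 4] integral_lin_fourth[OF unit[OF that(1)]] True
      by simp
  next
    case False
    then have o: "(\<Sum>l\<in>I. u p l * u q l) = 0" using orthonormal[OF that] by simp
    show ?thesis
      using integrable_lin_squares[OF unit unit o] integral_lin_squares[OF unit unit o] that False by simp
  qed
  show T1: "integrable M ?T"
    by (intro Bochner_Integration.integrable_sum i1)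
  show E: "expectation ?T = (\<Sum>q\<in>I. W q)"
    by (subst Bochner_Integration.integral_sum[OF i1])
       (auto simp: integral_lin_square unit intro!: sum.cong)
  have sq: "(?T \<omega>)\<^sup>2 = (\<Sum>p\<in>I. \<Sum>q\<in>I. (W p * W q) * ((lin (u p) \<omega>)\<^sup>2 * (lin (u q) \<omega>)\<^sup>2))" for \<omega>
    by (simp add: power2_eq_square sum_product mult_ac)
  have T2: "integrable M (\<lambda>\<omega>. (?T \<omega>)\<^sup>2)"
    unfolding sq by (intro Bochner_Integration.integrable_sum integrable_mult_right) (use p2 in auto)
  have "expectation (\<lambda>\<omega>. (?T \<omega>)\<^sup>2) = (\<Sum>p\<in>I. \<Sum>q\<in>I. (W p * W q) * (if p = q then 3 else 1))"
    unfolding sq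
    by (subst Bochner_Integration.integral_sum, use p2 in auto)+
  also have "\<dots> = (\<Sum>p\<in>I. \<Sum>q\<in>I. W p * W q + (if p = q then 2 * W p * W q else 0))"
    by (intro sum.cong refl) auto
  also have "\<dots> = (\<Sum>q\<in>I. W q)\<^sup>2 + 2 * (\<Sum>q\<in>I. (W q)\<^sup>2)"
    by (simp add: sum.distrib finite_I power2_eq_square sum_product sum_distrib_left mult_ac)
  finally show "variance ?T = 2 * (\<Sum>q\<in>I. (W q)\<^sup>2)"
    using variance_eq[OF T1 T2] E by simp
qed

text \<open>Rotation invariance of the Gaussian law, in the form of a Hubbard-Stratonovich identity. Replace each factor
\<open>exp (z\<^sub>q\<^sup>2 x\<^sub>q\<^sup>2 / 2)\<close> by \<open>E exp (z\<^sub>q x\<^sub>q G\<^sub>q)\<close> with an independent copy \<open>G\<close> of the family and integrate over the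
original family first. The exponent is then linear in the noise, and integrating yields
\<open>exp (\<bar>\<Sum> z\<^sub>q G\<^sub>q u\<^sub>q\<bar>\<^sup>2 / 2)\<close> with the bilinear square, which orthonormality turns into
\<open>exp (\<Sum> z\<^sub>q\<^sup>2 G\<^sub>q\<^sup>2 / 2)\<close>. The bound on the real parts makes the double integral absolutely convergent.\<close>

lemma exp_quadratic_form:
  fixes z :: "'i \<Rightarrow> complex"
  assumes z: "\<And>q. q \<in> I \<Longrightarrow> (Re (z q))\<^sup>2 < 1"
  shows "(LINT \<omega>|M. exp (\<Sum>q\<in>I. (z q)\<^sup>2 / 2 * complex_of_real ((lin (u q) \<omega>)\<^sup>2)))
       = (\<Prod>q\<in>I. LINT x|std_normal_distribution. exp ((z q)\<^sup>2 / 2 * complex_of_real (x\<^sup>2)))"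
proof -
  interpret P: pair_sigma_finite M M ..
  \<comment> \<open>Here \<open>\<omega>\<close> carries the noise and \<open>\<omega>'\<close> the independent auxiliary family.\<close>
  define F where "F y \<omega> \<omega>' = exp (\<Sum>q\<in>I. y q * complex_of_real (X q \<omega>' * lin (u q) \<omega>))"
    for y :: "'i \<Rightarrow> complex" and \<omega> \<omega>'
  have inner1: "(LINT \<omega>'|M. F z \<omega> \<omega>') = exp (\<Sum>q\<in>I. (z q)\<^sup>2 / 2 * complex_of_real ((lin (u q) \<omega>)\<^sup>2))" for \<omega>
    using integral_exp_lin[of "\<lambda>q. z q * complex_of_real (lin (u q) \<omega>)"]
    by (simp add: F_def mult_ac power_mult_distrib sum_divide_distrib)
  have F_alt: "F y \<omega> \<omega>' = exp (\<Sum>l\<in>I. (\<Sum>q\<in>I. y q * X q \<omega>' * u q l) * complex_of_real (X l \<omega>))" for y \<omega> \<omega>'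
    unfolding F_def lin_def of_real_sum of_real_mult sum_distrib_left sum_distrib_right
    by (subst sum.swap) (simp add: mult_ac)
  have int2: "integrable M (\<lambda>\<omega>. F y \<omega> \<omega>')" for y \<omega>'
    unfolding F_alt by (rule integrable_exp_lin)
  have inner2: "(LINT \<omega>|M. F y \<omega> \<omega>') = exp (\<Sum>q\<in>I. (y q)\<^sup>2 / 2 * complex_of_real ((X q \<omega>')\<^sup>2))" for y \<omega>'
  proof -
    have "(LINT \<omega>|M. F y \<omega> \<omega>') = exp ((\<Sum>l\<in>I. (\<Sum>q\<in>I. y q * X q \<omega>' * u q l)\<^sup>2) / 2)"
      unfolding F_alt by (rule integral_exp_lin)
    also have "(\<Sum>l\<in>I. (\<Sum>q\<in>I. y q * X q \<omega>' * complex_of_real (u q l))\<^sup>2)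
       = (\<Sum>l\<in>I. \<Sum>p\<in>I. \<Sum>q\<in>I. (y p * X p \<omega>') * (y q * X q \<omega>') * complex_of_real (u p l * u q l))"
      by (simp add: power2_eq_square sum_product mult_ac)
    also have "\<dots> = (\<Sum>p\<in>I. \<Sum>l\<in>I. \<Sum>q\<in>I. (y p * X p \<omega>') * (y q * X q \<omega>') * complex_of_real (u p l * u q l))"
      by (rule sum.swap)
    also have "\<dots> = (\<Sum>p\<in>I. \<Sum>q\<in>I. \<Sum>l\<in>I. (y p * X p \<omega>') * (y q * X q \<omega>') * complex_of_real (u p l * u q l))"
      by (intro sum.cong refl sum.swap)
    also have "\<dots> = (\<Sum>p\<in>I. \<Sum>q\<in>I. (y p * X p \<omega>') * (y q * X q \<omega>') * complex_of_real (\<Sum>l\<in>I. u p l * u q l))"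
      by (simp only: of_real_sum sum_distrib_left)
    also have "\<dots> = (\<Sum>p\<in>I. \<Sum>q\<in>I. if p = q then (y p * X p \<omega>') * (y q * X q \<omega>') else 0)"
      by (intro sum.cong refl) (simp add: orthonormal)
    also have "\<dots> = (\<Sum>q\<in>I. (y q)\<^sup>2 * complex_of_real ((X q \<omega>')\<^sup>2))"
      by (simp add: finite_I power2_eq_square mult_ac)
    finally show ?thesis by (simp add: sum_divide_distrib)
  qed
  have normF: "norm (F z \<omega> \<omega>') = Re (F (\<lambda>q. complex_of_real (Re (z q))) \<omega> \<omega>')" for \<omega> \<omega>'
  proof -
    have "F (\<lambda>q. complex_of_real (Re (z q))) \<omega> \<omega>'
        = complex_of_real (exp (\<Sum>q\<in>I. Re (z q) * (X q \<omega>' * lin (u q) \<omega>)))"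
      by (simp add: F_def flip: exp_of_real)
    then show ?thesis by (simp add: F_def)
  qed
  have integrable_F: "integrable (M \<Otimes>\<^sub>M M) (\<lambda>(\<omega>', \<omega>). F z \<omega> \<omega>')"
  proof (rule P.Fubini_integrable)
    have [measurable]: "(\<lambda>p. X q (fst p)) \<in> borel_measurable (M \<Otimes>\<^sub>M M)" if "q \<in> I" for q
      using measurable_X[OF that] by measurable
    show "(\<lambda>(\<omega>', \<omega>). F z \<omega> \<omega>') \<in> borel_measurable (M \<Otimes>\<^sub>M M)"
      unfolding F_def split_beta' by measurable
    have eq: "(LINT \<omega>|M. norm (F z \<omega> \<omega>')) = (\<Prod>q\<in>I. exp ((Re (z q))\<^sup>2 * (X q \<omega>')\<^sup>2 / 2))" for \<omega>'
    proof -
      have "(LINT \<omega>|M. norm (F z \<omega> \<omega>')) = Re (LINT \<omega>|M. F (\<lambda>q. complex_of_real (Re (z q))) \<omega> \<omega>')"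
        unfolding normF by (intro integral_Re int2)
      also have "\<dots> = Re (exp (complex_of_real (\<Sum>q\<in>I. (Re (z q))\<^sup>2 * (X q \<omega>')\<^sup>2 / 2)))"
        by (simp add: inner2)
      also have "\<dots> = exp (\<Sum>q\<in>I. (Re (z q))\<^sup>2 * (X q \<omega>')\<^sup>2 / 2)"
        by (simp only: exp_of_real Re_complex_of_real)
      finally show ?thesis by (simp add: exp_sum finite_I)
    qed
    show "integrable M (\<lambda>\<omega>'. LINT \<omega>|M. norm (case (\<omega>', \<omega>) of (\<omega>', \<omega>) \<Rightarrow> F z \<omega> \<omega>'))"
      unfolding split eq
      by (rule integrable_prod_X) (auto intro!: integrable_std_normal_exp_square z)
    show "AE \<omega>' in M. integrable M (\<lambda>\<omega>. case (\<omega>', \<omega>) of (\<omega>', \<omega>) \<Rightarrow> F z \<omega> \<omega>')"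
      using int2 by simp
  qed
  have "(LINT \<omega>|M. exp (\<Sum>q\<in>I. (z q)\<^sup>2 / 2 * complex_of_real ((lin (u q) \<omega>)\<^sup>2)))
      = (LINT \<omega>|M. LINT \<omega>'|M. F z \<omega> \<omega>')"
    by (simp only: inner1)
  also have "\<dots> = (LINT \<omega>'|M. LINT \<omega>|M. F z \<omega> \<omega>')"
    using P.Fubini_integral[OF integrable_F] by simp
  also have "\<dots> = (LINT \<omega>|M. (\<Prod>q\<in>I. exp ((z q)\<^sup>2 / 2 * complex_of_real ((X q \<omega>)\<^sup>2))))"
    by (simp only: inner2 exp_sum[OF finite_I])
  also have "\<dots> = (\<Prod>q\<in>I. LINT x|std_normal_distribution. exp ((z q)\<^sup>2 / 2 * complex_of_real (x\<^sup>2)))"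
  proof (rule integral_prod_X)
    fix q assume q: "q \<in> I"
    show "integrable std_normal_distribution (\<lambda>x. exp ((z q)\<^sup>2 / 2 * complex_of_real (x\<^sup>2)))"
    proof (rule Bochner_Integration.integrable_bound[OF integrable_std_normal_exp_square[OF z[OF q]]])
      have "Re ((z q)\<^sup>2) \<le> (Re (z q))\<^sup>2" by (simp add: power2_eq_square)
      then have "Re ((z q)\<^sup>2 / 2 * complex_of_real (x\<^sup>2)) \<le> (Re (z q))\<^sup>2 * x\<^sup>2 / 2" for x :: real
        by (simp add: mult_right_mono divide_right_mono)
      then show "AE x in std_normal_distribution.
          norm (exp ((z q)\<^sup>2 / 2 * complex_of_real (x\<^sup>2))) \<le> norm (exp ((Re (z q))\<^sup>2 * x\<^sup>2 / 2))"
        by simp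
    qed simp
  qed simp
  finally show ?thesis .
qed

end

definition centred_chisq :: "real measure" where
  "centred_chisq = distr std_normal_distribution borel (\<lambda>x. x\<^sup>2 - 1)"

lemma real_distribution_centred_chisq: "real_distribution centred_chisq"
proof -
  interpret real_distribution std_normal_distribution by (rule real_dist_normal_dist)
  show ?thesis unfolding centred_chisq_def by (rule real_distribution_distr) simp
qed

lemma char_centred_chisq:
  "char centred_chisq t =
     exp (- \<i> * t) * (LINT x|std_normal_distribution. exp (\<i> * t * complex_of_real (x\<^sup>2)))"
proof -
  have "char centred_chisq t = (LINT x|std_normal_distribution. iexp (t * (x\<^sup>2 - 1)))"
    unfolding char_def centred_chisq_def by (subst integral_distr) auto
  also have "\<dots> = (LINT x|std_normal_distribution. exp (- \<i> * t) * exp (\<i> * t * complex_of_real (x\<^sup>2)))"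
    by (intro Bochner_Integration.integral_cong refl) (simp add: algebra_simps flip: exp_add)
  finally show ?thesis by simp
qed

text \<open>Second order expansion of the characteristic function: the centred square of a standard normal variable has
mean \<open>0\<close>, variance \<open>2\<close> and a finite third absolute moment.\<close>

lemma char_centred_chisq_approx:
  "\<exists>K\<ge>0. \<forall>t. cmod (char centred_chisq t - (1 - t\<^sup>2)) \<le> K * \<bar>t\<bar> ^ 3"
proof -
  interpret N: real_distribution std_normal_distribution by (rule real_dist_normal_dist)
  define Y where "Y x = x\<^sup>2 - 1" for x :: real
  note int = integrable_std_normal_distribution_moment
  have m2: "(LINT x|std_normal_distribution. x\<^sup>2) = 1" and m4: "(LINT x|std_normal_distribution. x ^ 4) = 3"
    using std_normal_distribution_even_moments(1)[of 1] std_normal_distribution_even_moments(1)[of 2]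
    by (simp_all add: fact_numeral)
  have Y2: "(Y x)\<^sup>2 = x ^ 4 - 2 * x\<^sup>2 + 1" and
    Y4: "Y x ^ 4 = x ^ 8 - 4 * x ^ 6 + 6 * x ^ 4 - 4 * x\<^sup>2 + 1" for x
    by (simp_all add: Y_def eval_nat_numeral algebra_simps)
  have i1: "integrable std_normal_distribution Y"
    unfolding Y_def by (simp add: int)
  have i2: "integrable std_normal_distribution (\<lambda>x. (Y x)\<^sup>2)"
    unfolding Y2 by (intro Bochner_Integration.integrable_add Bochner_Integration.integrable_diff integrable_mult_right int) simp
  have i4: "integrable std_normal_distribution (\<lambda>x. Y x ^ 4)"
    unfolding Y4 by (intro Bochner_Integration.integrable_add Bochner_Integration.integrable_diff integrable_mult_right int) simp
  have e1: "N.expectation Y = 0"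
    unfolding Y_def using int[of 2] m2 N.prob_space by simp
  have e2: "N.expectation (\<lambda>x. (Y x)\<^sup>2) = 2"
    unfolding Y2 using int[of 2] int[of 4] m2 m4 N.prob_space by simp
  define K where "K = N.expectation (\<lambda>x. 1 + Y x ^ 4) / 6"
  have i3: "integrable std_normal_distribution (\<lambda>x. 1 + Y x ^ 4)" using i4 by simp
  have K: "cmod (char centred_chisq t - (1 - t\<^sup>2)) \<le> K * \<bar>t\<bar> ^ 3" for t
  proof -
    have cube: "\<bar>y\<bar> ^ 3 \<le> 1 + y ^ 4" for y :: real
    proof (cases "\<bar>y\<bar> \<le> 1")
      case True
      then have "\<bar>y\<bar> ^ 3 \<le> 1" by (simp add: power_le_one)
      moreover have "0 \<le> y ^ 4" by (rule zero_le_even_power) simp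
      ultimately show ?thesis by linarith
    next
      case False
      then have "\<bar>y\<bar> ^ 3 \<le> \<bar>y\<bar> ^ 4" by (intro power_increasing) auto
      then show ?thesis by simp
    qed
    have "cmod (char centred_chisq t - (1 - t\<^sup>2 * 2 / 2)) \<le>
      (t\<^sup>2 / 6) * N.expectation (\<lambda>x. min (6 * (Y x)\<^sup>2) (\<bar>t\<bar> * \<bar>Y x\<bar> ^ 3))"
    proof (rule N.char_approx3'[OF _ i1 i2 e1])
      show "N.variance Y = 2" using e1 e2 by simp
      show "centred_chisq = distr std_normal_distribution borel Y"
        by (simp add: centred_chisq_def Y_def[abs_def])
    qed (simp add: Y_def[abs_def])
    also have "\<dots> \<le> (t\<^sup>2 / 6) * N.expectation (\<lambda>x. \<bar>t\<bar> * (1 + Y x ^ 4))"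
    proof (intro mult_left_mono integral_mono)
      show "integrable std_normal_distribution (\<lambda>x. \<bar>t\<bar> * (1 + Y x ^ 4))"
        by (intro integrable_mult_right i3)
      show "integrable std_normal_distribution (\<lambda>x. min (6 * (Y x)\<^sup>2) (\<bar>t\<bar> * \<bar>Y x\<bar> ^ 3))"
        by (rule Bochner_Integration.integrable_bound[OF integrable_mult_right[OF i2, of 6]])
           (auto simp: Y_def)
      show "min (6 * (Y x)\<^sup>2) (\<bar>t\<bar> * \<bar>Y x\<bar> ^ 3) \<le> \<bar>t\<bar> * (1 + Y x ^ 4)" for x
        using mult_left_mono[OF cube[of "Y x"], of "\<bar>t\<bar>"] by auto
    qed auto
    also have "\<dots> = K * \<bar>t\<bar> ^ 3"
      by (simp add: K_def power3_eq_cube power2_eq_square flip: abs_mult)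
    finally show ?thesis by simp
  qed
  have "K \<ge> 0" unfolding K_def by (intro divide_nonneg_nonneg integral_nonneg_AE) auto
  with K show ?thesis by blast
qed

text \<open>The exponent \<open>\<i> t b x\<^sup>2\<close> is \<open>z\<^sup>2 x\<^sup>2 / 2\<close> for a square root \<open>z\<close> of \<open>2 \<i> t b\<close>, and \<open>(Re z)\<^sup>2 \<le> 2 \<bar>t b\<bar>\<close>; this is where
the coefficients have to be small.\<close>

lemma (in orthonormal_gaussian_forms) char_centred_quadratic_form:
  assumes b: "\<And>q. q \<in> I \<Longrightarrow> 2 * \<bar>t * b q\<bar> < 1"
  shows "char (distr M borel (\<lambda>\<omega>. \<Sum>q\<in>I. b q * ((lin (u q) \<omega>)\<^sup>2 - 1))) t
       = (\<Prod>q\<in>I. char centred_chisq (t * b q))"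
proof -
  define z where "z q = csqrt (2 * \<i> * complex_of_real (t * b q))" for q
  have z2: "(z q)\<^sup>2 / 2 = \<i> * complex_of_real (t * b q)" for q
    by (simp add: z_def)
  have z1: "(Re (z q))\<^sup>2 < 1" if "q \<in> I" for q
  proof -
    have "(Re (z q))\<^sup>2 \<le> cmod (z q) ^ 2"
      by (simp add: cmod_power2)
    also have "\<dots> = cmod (2 * ((z q)\<^sup>2 / 2))"
      by (simp add: norm_power)
    also have "\<dots> = 2 * \<bar>t * b q\<bar>"
      unfolding z2 by (simp add: norm_mult abs_mult)
    finally show ?thesis using b[OF that] by simp
  qed
  have "char (distr M borel (\<lambda>\<omega>. \<Sum>q\<in>I. b q * ((lin (u q) \<omega>)\<^sup>2 - 1))) t
      = (LINT \<omega>|M. iexp (t * (\<Sum>q\<in>I. b q * ((lin (u q) \<omega>)\<^sup>2 - 1))))"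
    unfolding char_def by (subst integral_distr) auto
  also have "\<dots> = (LINT \<omega>|M. (\<Prod>q\<in>I. exp (- \<i> * complex_of_real (t * b q))) *
       exp (\<Sum>q\<in>I. (z q)\<^sup>2 / 2 * complex_of_real ((lin (u q) \<omega>)\<^sup>2)))"
    unfolding z2
    by (intro Bochner_Integration.integral_cong refl)
       (simp add: algebra_simps sum.distrib sum_subtractf sum_distrib_left sum_negf
          flip: exp_sum[OF finite_I] exp_add)
  also have "\<dots> = (\<Prod>q\<in>I. exp (- \<i> * complex_of_real (t * b q))) *
      (\<Prod>q\<in>I. LINT x|std_normal_distribution. exp ((z q)\<^sup>2 / 2 * complex_of_real (x\<^sup>2)))"
    by (subst integral_mult_right_zero) (simp only: exp_quadratic_form[OF z1])
  also have "\<dots> = (\<Prod>q\<in>I. char centred_chisq (t * b q))"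
    unfolding z2 prod.distrib[symmetric] char_centred_chisq by simp
  finally show ?thesis .
qed

lemma exp_minus_linear_bound:
  fixes x :: real
  assumes "x \<ge> 0"
  shows "\<bar>exp (- x) - (1 - x)\<bar> \<le> x\<^sup>2"
proof -
  have 1: "1 - x \<le> exp (- x)" using exp_ge_add_one_self[of "- x"] by simp
  have "exp (- x) \<le> 1 / (1 + x)"
    using exp_ge_add_one_self[of x] assms by (simp add: exp_minus field_simps)
  also have "\<dots> \<le> 1 - x + x\<^sup>2"
  proof -
    have "1 \<le> (1 - x + x\<^sup>2) * (1 + x)"
      using assms by (simp add: algebra_simps power2_eq_square)
    then show ?thesis using assms by (simp add: field_simps)
  qed
  finally show ?thesis using 1 by simp
qed

text \<open>A product of factors of modulus at most one differs from another such product by at most the sum of the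
differences; with \<open>\<Sum> b\<^sub>q\<^sup>2 = 1 / 2\<close> each power of \<open>\<bar>b\<^sub>q\<bar>\<close> beyond the second contributes a factor \<open>\<beta>\<close>.\<close>

lemma prod_char_centred_chisq_approx:
  assumes K: "\<And>t. cmod (char centred_chisq t - (1 - t\<^sup>2)) \<le> K * \<bar>t\<bar> ^ 3" and K0: "K \<ge> 0"
    and fin: "finite I"
    and b2: "(\<Sum>q\<in>I. (b q)\<^sup>2) = 1 / 2" and b: "\<And>q. q \<in> I \<Longrightarrow> \<bar>b q\<bar> \<le> \<beta>"
  shows "cmod ((\<Prod>q\<in>I. char centred_chisq (t * b q)) - exp (- t\<^sup>2 / 2)) \<le> (K * \<bar>t\<bar> ^ 3 * \<beta> + t ^ 4 * \<beta>\<^sup>2) / 2"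
proof -
  interpret C: real_distribution centred_chisq by (rule real_distribution_centred_chisq)
  have "complex_of_real (exp (- t\<^sup>2 / 2)) = complex_of_real (exp (\<Sum>q\<in>I. - ((t * b q)\<^sup>2)))"
    by (simp add: sum_negf power_mult_distrib b2 flip: sum_distrib_left)
  also have "\<dots> = (\<Prod>q\<in>I. complex_of_real (exp (- ((t * b q)\<^sup>2))))"
    using fin by (simp add: exp_sum)
  finally have e: "complex_of_real (exp (- t\<^sup>2 / 2)) = (\<Prod>q\<in>I. complex_of_real (exp (- ((t * b q)\<^sup>2))))" .
  have "cmod ((\<Prod>q\<in>I. char centred_chisq (t * b q)) - exp (- t\<^sup>2 / 2))
      \<le> (\<Sum>q\<in>I. cmod (char centred_chisq (t * b q) - exp (- ((t * b q)\<^sup>2))))"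
    unfolding e by (rule norm_prod_diff) (auto simp: C.cmod_char_le_1)
  also have "\<dots> \<le> (\<Sum>q\<in>I. (K * \<bar>t\<bar> ^ 3 * \<beta> + t ^ 4 * \<beta>\<^sup>2) * (b q)\<^sup>2)"
  proof (rule sum_mono)
    fix q assume q: "q \<in> I"
    have "cmod (char centred_chisq (t * b q) - exp (- ((t * b q)\<^sup>2)))
       \<le> cmod (char centred_chisq (t * b q) - (1 - (t * b q)\<^sup>2))
         + cmod (complex_of_real (exp (- ((t * b q)\<^sup>2)) - (1 - (t * b q)\<^sup>2)))"
      by (rule order_trans[OF _ norm_triangle_ineq4]) (simp add: algebra_simps)
    also have "\<dots> \<le> K * \<bar>t * b q\<bar> ^ 3 + ((t * b q)\<^sup>2)\<^sup>2"
      unfolding norm_of_real by (intro add_mono K exp_minus_linear_bound) simp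
    also have "\<dots> = K * \<bar>t\<bar> ^ 3 * (\<bar>b q\<bar> * (b q)\<^sup>2) + t ^ 4 * (\<bar>b q\<bar>\<^sup>2 * (b q)\<^sup>2)"
    proof -
      have "\<bar>b q\<bar> ^ 3 = \<bar>b q\<bar> * (b q)\<^sup>2"
        by (simp add: power3_eq_cube power2_eq_square mult.commute)
      then show ?thesis
        by (simp add: abs_mult power_mult_distrib flip: power_mult)
    qed
    also have "\<dots> \<le> K * \<bar>t\<bar> ^ 3 * (\<beta> * (b q)\<^sup>2) + t ^ 4 * (\<beta>\<^sup>2 * (b q)\<^sup>2)"
      using b[OF q] K0 by (intro add_mono mult_left_mono mult_right_mono power_mono) auto
    finally show "cmod (char centred_chisq (t * b q) - exp (- ((t * b q)\<^sup>2)))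
       \<le> (K * \<bar>t\<bar> ^ 3 * \<beta> + t ^ 4 * \<beta>\<^sup>2) * (b q)\<^sup>2"
      by (simp add: algebra_simps)
  qed
  also have "\<dots> = (K * \<bar>t\<bar> ^ 3 * \<beta> + t ^ 4 * \<beta>\<^sup>2) / 2"
    by (simp add: b2 flip: sum_distrib_left)
  finally show ?thesis .
qed

section \<open>The limit law of the test statistic\<close>

definition hartley_basis :: "nat \<Rightarrow> nat \<Rightarrow> nat \<Rightarrow> real" where
  "hartley_basis N q l =
     (cos (2 * pi * real q * (real l / real N)) + sin (2 * pi * real q * (real l / real N))) / sqrt (real N)"

lemma orthonormal_gaussian_forms_hartley:
  assumes "N \<ge> 1" "prob_space M" "prob_space.indep_vars M (\<lambda>_. borel) X {..<N}"
    and "\<And>l. l < N \<Longrightarrow> distributed M lborel (X l) std_normal_density"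
  shows "orthonormal_gaussian_forms M {..<N} X (hartley_basis N)"
proof -
  interpret prob_space M by fact
  show ?thesis
    by unfold_locales (use assms hartley_orthonormal[OF assms(1)] in \<open>auto simp: hartley_basis_def\<close>)
qed

text \<open>The null hypothesis at a fixed sample size \<open>s n\<close>: the observations are the noise \<open>X\<close>.\<close>

locale noise_only_model = orthonormal_gaussian_forms M "{..<s * n}" X "hartley_basis (s * n)"
  for M :: "'a measure" and X :: "nat \<Rightarrow> 'a \<Rightarrow> real" and s n :: nat +
  fixes m :: nat and lam :: real
  assumes m: "m \<ge> 1" and lam: "lam > 0" and n: "n \<ge> 1" and s: "s \<ge> 1"
begin

abbreviation weight :: "nat \<Rightarrow> real" where "weight \<equiv> spectral_weight m lam n (s * n)"

definition weight_energy :: real where "weight_energy = (\<Sum>q<s * n. (weight q)\<^sup>2)"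

definition statistic :: "'a \<Rightarrow> real" where
  "statistic \<omega> = test_stat m lam n s (observation (s * n) (\<lambda>t\<in>{0..1}. 0) (\<lambda>l. X l \<omega>))"

lemma statistic_eq: "statistic \<omega> = 1 / real (s * n) * (\<Sum>q<s * n. weight q * (lin (hartley_basis (s * n) q) \<omega>)\<^sup>2)"
proof -
  define N where "N = s * n"
  have N: "N \<ge> 1" using n s by (simp add: N_def)
  define y where "y = observation N (\<lambda>t\<in>{0..1}. 0) (\<lambda>l. X l \<omega>)"
  have y: "y l = X l \<omega>" if "l < N" for l
    using that by (simp add: y_def observation_def)
  have "(hartley N y (int q))\<^sup>2 = real N * (lin (hartley_basis N q) \<omega>)\<^sup>2" for q
  proof -
    have "lin (hartley_basis N q) \<omega> = hartley N y (int q) / sqrt (real N)"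
      unfolding lin_def unfolding hartley_def sum_divide_distrib N_def[symmetric]
      by (intro sum.cong refl) (simp add: y hartley_basis_def mult.commute)
    then show ?thesis using N by (simp add: power_divide)
  qed
  then have "statistic \<omega> = 1 / (real N)\<^sup>2 * (\<Sum>q<N. weight q * (real N * (lin (hartley_basis N q) \<omega>)\<^sup>2))"
    unfolding statistic_def test_stat_quadratic_form[OF m lam n s] by (simp add: N_def y_def)
  also have "\<dots> = 1 / (real N)\<^sup>2 * (real N * (\<Sum>q<N. weight q * (lin (hartley_basis N q) \<omega>)\<^sup>2))"
    unfolding sum_distrib_left by (simp only: mult_ac)
  also have "\<dots> = 1 / real N * (\<Sum>q<N. weight q * (lin (hartley_basis N q) \<omega>)\<^sup>2)"
    using N by (simp add: power2_eq_square)
  finally show ?thesis by (simp add: N_def)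
qed

lemma normalised_statistic:
  "(statistic \<omega> - expectation statistic) / sqrt (variance statistic) =
     (\<Sum>q<s * n. weight q / sqrt (2 * weight_energy) * ((lin (hartley_basis (s * n) q) \<omega>)\<^sup>2 - 1))"
proof -
  define Q where "Q \<omega> = (\<Sum>q<s * n. weight q * (lin (hartley_basis (s * n) q) \<omega>)\<^sup>2)" for \<omega>
  define c where "c = 1 / real (s * n)"
  have c: "c > 0" using n s by (simp add: c_def)
  have eq: "statistic = (\<lambda>\<omega>. c * Q \<omega>)"
    by (rule ext) (simp only: statistic_eq Q_def c_def)
  have EQ: "expectation Q = (\<Sum>q<s * n. weight q)" and VQ: "variance Q = 2 * weight_energy"
    unfolding Q_def weight_energy_def by (rule expectation_quadratic_form variance_quadratic_form)+
  have "variance statistic = expectation (\<lambda>\<omega>. c\<^sup>2 * (Q \<omega> - expectation Q)\<^sup>2)"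
    unfolding eq by (simp add: power_mult_distrib flip: right_diff_distrib)
  also have "\<dots> = c\<^sup>2 * (2 * weight_energy)" using VQ by simp
  finally have "sqrt (variance statistic) = c * sqrt (2 * weight_energy)"
    using c by (simp add: real_sqrt_mult)
  moreover have "statistic \<omega> - expectation statistic = c * (Q \<omega> - (\<Sum>q<s * n. weight q))"
    unfolding eq by (simp add: EQ right_diff_distrib)
  ultimately have "(statistic \<omega> - expectation statistic) / sqrt (variance statistic) =
      (Q \<omega> - (\<Sum>q<s * n. weight q)) / sqrt (2 * weight_energy)"
    using c by simp
  also have "\<dots> = (\<Sum>q<s * n. weight q / sqrt (2 * weight_energy) * ((lin (hartley_basis (s * n) q) \<omega>)\<^sup>2 - 1))"
    by (simp add: Q_def sum_divide_distrib algebra_simps diff_divide_distrib sum_subtractf)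
  finally show ?thesis .
qed

lemma char_normalised_statistic:
  assumes K: "\<And>t. cmod (char centred_chisq t - (1 - t\<^sup>2)) \<le> K * \<bar>t\<bar> ^ 3" "K \<ge> 0"
    and pos: "weight_energy > 0" and t: "2 * \<bar>t\<bar> < sqrt (2 * weight_energy)"
  defines "\<beta> \<equiv> 1 / sqrt (2 * weight_energy)"
  shows "cmod (char (distr M borel (\<lambda>\<omega>. (statistic \<omega> - expectation statistic) / sqrt (variance statistic))) t
      - exp (- t\<^sup>2 / 2)) \<le> (K * \<bar>t\<bar> ^ 3 * \<beta> + t ^ 4 * \<beta>\<^sup>2) / 2"
proof -
  define b where "b q = weight q / sqrt (2 * weight_energy)" for q
  have b: "\<bar>b q\<bar> \<le> \<beta>" for q
    using spectral_weight_nonneg[OF m lam n s, of "s * n" q] spectral_weight_le_1[OF m lam n s, of q] pos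
    by (simp add: b_def \<beta>_def divide_right_mono)
  have small: "2 * \<bar>t * b q\<bar> < 1" for q
  proof -
    have "2 * \<bar>t * b q\<bar> \<le> 2 * \<bar>t\<bar> * \<beta>"
      unfolding abs_mult using mult_left_mono[OF b[of q], of "2 * \<bar>t\<bar>"] by simp
    also have "\<dots> < 1" using t pos by (simp add: \<beta>_def field_simps)
    finally show ?thesis .
  qed
  have "(\<Sum>q<s * n. (b q)\<^sup>2) = weight_energy / (2 * weight_energy)"
    using pos unfolding b_def power_divide weight_energy_def[symmetric] sum_divide_distrib[symmetric] by simp
  then have b2: "(\<Sum>q<s * n. (b q)\<^sup>2) = 1 / 2" using pos by simp
  show ?thesis
    unfolding normalised_statistic b_def[symmetric] char_centred_quadratic_form[OF small]
    by (rule prod_char_centred_chisq_approx[OF K finite_lessThan b2 b])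
qed

lemma real_distribution_normalised_statistic:
  "real_distribution (distr M borel (\<lambda>\<omega>. (statistic \<omega> - expectation statistic) / sqrt (variance statistic)))"
  unfolding normalised_statistic by (rule real_distribution_distr) simp

text \<open>The first \<open>Z\<close> frequencies lie below both thresholds, the aliasing limit \<open>n / 2\<close> and the cut-off \<open>1 / (2 \<pi> h)\<close> of
the smoother, so each of them contributes at least a fixed constant.\<close>

lemma weight_energy_ge:
  assumes h: "h > 0" "lam = h ^ (2 * m)" and Z: "2 * Z \<le> n" "2 * pi * real Z * h \<le> 1"
  shows "real Z * (1 / (1 + 2 * zeta2)) ^ 4 \<le> weight_energy"
proof -
  define c where "c = 1 / (1 + 2 * zeta2)"
  have c0: "0 \<le> c" unfolding c_def zeta2_def by (intro divide_nonneg_nonneg add_nonneg_nonneg mult_nonneg_nonneg suminf_nonneg summable_inverse_Suc_square) auto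
  have big: "c ^ 4 \<le> (weight (Suc k))\<^sup>2" if "k < Z" for k
  proof -
    have "2 * pi * real (Suc k) * h \<le> 2 * pi * real Z * h"
      using that h by (intro mult_right_mono mult_left_mono) auto
    then have "2 * pi * real (Suc k) * h \<le> 1" using Z(2) by (rule order_trans)
    then have "c \<le> shrinkage m lam n k"
      unfolding c_def using that Z by (intro shrinkage_lower_bound[OF m h]) simp_all
    then have "c\<^sup>2 \<le> (shrinkage m lam n k)\<^sup>2" using c0 by (intro power_mono)
    also have "\<dots> \<le> weight (Suc k)" by (rule spectral_weight_ge[OF m lam n s])
    finally have "(c\<^sup>2)\<^sup>2 \<le> (weight (Suc k))\<^sup>2" by (intro power_mono) auto
    then show ?thesis by simp
  qed
  have "real Z * c ^ 4 \<le> (\<Sum>k<Z. (weight (Suc k))\<^sup>2)"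
    using sum_mono[of "{..<Z}" "\<lambda>_. c ^ 4" "\<lambda>k. (weight (Suc k))\<^sup>2"] big by simp
  also have "\<dots> = (\<Sum>q\<in>Suc ` {..<Z}. (weight q)\<^sup>2)"
    by (simp add: sum.reindex)
  also have "\<dots> \<le> weight_energy"
    unfolding weight_energy_def
  proof (rule sum_mono2)
    have ns: "n \<le> s * n" using s by simp
    have "Suc k < s * n" if "k < Z" for k
      using that Z(1) ns by linarith
    then show "Suc ` {..<Z} \<subseteq> {..<s * n}" by auto
  qed auto
  finally show ?thesis by (simp add: c_def)
qed

end

theorem theorem4p1:
  fixes m :: nat
    and n s :: "nat \<Rightarrow> nat"
    and lam h :: "nat \<Rightarrow> real"
    and M :: "nat \<Rightarrow> 'a measure"
    and eps :: "nat \<Rightarrow> nat \<Rightarrow> 'a \<Rightarrow> real"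
    and f :: "real \<Rightarrow> real"
  assumes m: "m \<ge> 1"
    and split: "\<And>N. N \<ge> 1 \<Longrightarrow> n N \<ge> 1 \<and> s N \<ge> 1 \<and> N = s N * n N"
    and lam_pos: "\<And>N. N \<ge> 1 \<Longrightarrow> lam N > 0"
    and h: "\<And>N. N \<ge> 1 \<Longrightarrow> h N = lam N powr (1 / (2 * real m))"
    and h_lim: "h \<longlonglongrightarrow> 0"
    and n_lim: "filterlim n at_top sequentially"
    and nh_lim: "\<exists>L :: ereal. (\<lambda>N. ereal (real (n N) * h N)) \<longlonglongrightarrow> L"
    and prob: "\<And>N. N \<ge> 1 \<Longrightarrow> prob_space (M N)"
    and indep: "\<And>N. N \<ge> 1 \<Longrightarrow> prob_space.indep_vars (M N) (\<lambda>_. borel) (eps N) {..<N}"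
    and normal: "\<And>N l. N \<ge> 1 \<Longrightarrow> l < N \<Longrightarrow>
                   distributed (M N) lborel (eps N l) std_normal_density"
    and H0: "f = (\<lambda>t\<in>{0..1}. 0)"
  shows "let T = (\<lambda>N \<omega>. test_stat m (lam N) (n N) (s N) (observation N f (\<lambda>l. eps N l \<omega>)));
             \<mu> = (\<lambda>N. prob_space.expectation (M N) (T N));
             \<sigma> = (\<lambda>N. sqrt (prob_space.variance (M N) (T N)))
         in weak_conv_m (\<lambda>N. distr (M N) borel (\<lambda>\<omega>. (T N \<omega> - \<mu> N) / \<sigma> N))
              std_normal_distribution"
proof -
  define T where "T N \<omega> = test_stat m (lam N) (n N) (s N) (observation N f (\<lambda>l. eps N l \<omega>))" for N \<omega>
  define P where "P N = distr (M N) borel (\<lambda>\<omega>. (T N \<omega> - prob_space.expectation (M N) (T N)) /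
      sqrt (prob_space.variance (M N) (T N)))" for N
  define D where "D N = (\<Sum>q<N. (spectral_weight m (lam N) (n N) N q)\<^sup>2)" for N
  have model: "noise_only_model (M N) (eps N) (s N) (n N) m (lam N)" if "N \<ge> 1" for N
  proof -
    have N: "s N * n N = N" using split[OF that] by simp
    interpret orthonormal_gaussian_forms "M N" "{..<s N * n N}" "eps N" "hartley_basis (s N * n N)"
      unfolding N by (rule orthonormal_gaussian_forms_hartley[OF that prob[OF that] indep[OF that] normal[OF that]])
    show ?thesis
      by unfold_locales (use m split[OF that] lam_pos[OF that] in auto)
  qed
  have T: "noise_only_model.statistic (eps N) (s N) (n N) m (lam N) = T N" if "N \<ge> 1" for N
    using split[OF that] by (intro ext) (simp add: noise_only_model.statistic_def[OF model[OF that]] T_def H0)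
  have D: "noise_only_model.weight_energy (s N) (n N) m (lam N) = D N" if "N \<ge> 1" for N
    using split[OF that] by (simp add: noise_only_model.weight_energy_def[OF model[OF that]] D_def)
  have h_pos: "h N > 0" and lam_h: "lam N = h N ^ (2 * m)" if "N \<ge> 1" for N
  proof -
    show "h N > 0" using h[OF that] lam_pos[OF that] by simp
    then have "h N ^ (2 * m) = h N powr real (2 * m)" by (rule powr_realpow[symmetric])
    also have "\<dots> = lam N" using h[OF that] lam_pos[OF that] m by (simp add: powr_powr)
    finally show "lam N = h N ^ (2 * m)" by simp
  qed
  have D_lim: "filterlim D at_top sequentially"
    unfolding filterlim_at_top
  proof
    fix x :: real
    define c where "c = (1 / (1 + 2 * zeta2)) ^ 4"
    have "0 \<le> zeta2" unfolding zeta2_def by (intro suminf_nonneg summable_inverse_Suc_square) simp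
    then have c: "c > 0" by (simp add: c_def)
    obtain Z :: nat where "x / c \<le> real Z" using real_arch_simple by blast
    then have Z: "x \<le> real Z * c" using c by (simp add: field_simps)
    have "(\<lambda>N. 2 * pi * real Z * h N) \<longlonglongrightarrow> 2 * pi * real Z * 0"
      by (intro tendsto_intros h_lim)
    then have "\<forall>\<^sub>F N in sequentially. 2 * pi * real Z * h N < 1"
      by (rule order_tendstoD) simp
    moreover have "\<forall>\<^sub>F N in sequentially. 2 * Z \<le> n N"
      using n_lim by (simp add: filterlim_at_top)
    ultimately show "\<forall>\<^sub>F N in sequentially. x \<le> D N"
      using eventually_ge_at_top[of 1]
    proof eventually_elim
      case (elim N)
      have "real Z * c \<le> D N"
        using noise_only_model.weight_energy_ge[OF model[OF elim(3)] h_pos[OF elim(3)] lam_h[OF elim(3)] elim(2)] elim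
        unfolding c_def D[OF elim(3)] by simp
      then show ?case using Z by simp
    qed
  qed
  obtain K where K: "\<And>t. cmod (char centred_chisq t - (1 - t\<^sup>2)) \<le> K * \<bar>t\<bar> ^ 3" "K \<ge> 0"
    using char_centred_chisq_approx by blast
  have sqrt_lim: "filterlim (\<lambda>N. sqrt (2 * D N)) at_top sequentially"
    by (intro filterlim_compose[OF sqrt_at_top] filterlim_tendsto_pos_mult_at_top[OF tendsto_const _ D_lim]) simp
  have \<beta>: "(\<lambda>N. 1 / sqrt (2 * D N)) \<longlonglongrightarrow> 0"
    by (intro tendsto_divide_0[OF tendsto_const] filterlim_at_top_imp_at_infinity sqrt_lim)
  have char_lim: "(\<lambda>N. char (P N) t) \<longlonglongrightarrow> char std_normal_distribution t" for t
  proof -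
    define \<beta> where "\<beta> N = 1 / sqrt (2 * D N)" for N
    have "(\<lambda>N. char (P N) t - exp (- t\<^sup>2 / 2)) \<longlonglongrightarrow> 0"
    proof (rule Lim_null_comparison)
      have "(\<lambda>N. (K * \<bar>t\<bar> ^ 3 * \<beta> N + t ^ 4 * (\<beta> N)\<^sup>2) / 2) \<longlonglongrightarrow> (K * \<bar>t\<bar> ^ 3 * 0 + t ^ 4 * 0\<^sup>2) / 2"
        unfolding \<beta>_def by (intro tendsto_intros \<beta>) simp
      then show "(\<lambda>N. (K * \<bar>t\<bar> ^ 3 * \<beta> N + t ^ 4 * (\<beta> N)\<^sup>2) / 2) \<longlonglongrightarrow> 0" by simp
      have "\<forall>\<^sub>F N in sequentially. 2 * \<bar>t\<bar> < sqrt (2 * D N)"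
        using sqrt_lim by (simp add: filterlim_at_top_dense)
      then show "\<forall>\<^sub>F N in sequentially. norm (char (P N) t - exp (- t\<^sup>2 / 2)) \<le> (K * \<bar>t\<bar> ^ 3 * \<beta> N + t ^ 4 * (\<beta> N)\<^sup>2) / 2"
        using eventually_ge_at_top[of 1]
      proof eventually_elim
        case (elim N)
        have "0 < sqrt (2 * D N)" using elim(1) by (rule le_less_trans[rotated]) simp
        then have "0 < D N" by simp
        then show ?case
          using noise_only_model.char_normalised_statistic[OF model[OF elim(2)] K, of t] elim(1)
          unfolding D[OF elim(2)] T[OF elim(2)] P_def \<beta>_def by simp
      qed
    qed
    then show ?thesis
      unfolding char_std_normal_distribution by (simp add: LIM_zero_iff flip: exp_of_real)
  qed
  have "weak_conv_m (\<lambda>N. P (Suc N)) std_normal_distribution"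
  proof (rule levy_continuity)
    show "real_distribution (P (Suc N))" for N
    proof -
      have N: "1 \<le> Suc N" by simp
      show ?thesis
        using noise_only_model.real_distribution_normalised_statistic[OF model[OF N]]
        unfolding T[OF N] P_def .
    qed
    show "(\<lambda>N. char (P (Suc N)) t) \<longlonglongrightarrow> char std_normal_distribution t" for t
      using char_lim[of t] by (rule LIMSEQ_Suc)
  qed (rule real_dist_normal_dist)
  then have "weak_conv_m P std_normal_distribution"
    unfolding weak_conv_m_def weak_conv_def by (auto dest: LIMSEQ_imp_Suc)
  then show ?thesis unfolding P_def T_def Let_def by simp
qed

end
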